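(* Let $n\ge 2$, let $f:\mathbb{C}^n\to\mathbb{C}^n$ be a biholomorphism, let $\Lambda\subset\mathbb{C}^n$ be a compact $f$-invariant set, and suppose that $f$ is partially hyperbolic on $\Lambda$ with splitting $T_\Lambda\mathbb{C}^n=E^s\oplus F$. Then the following statements are equivalent: (1) $f$ is uniformly hyperbolic on $\Lambda$ (with respect to the splitting $E^s\oplus F$, i.e. $F$ is an unstable direction). (2) The $cu$-leaves are forward expansive. (3) The $cu$-leaves are dynamically defined.
   Context: Partial hyperbolicity: $f$ is partially hyperbolic on the compact $f$-invariant set $\Lambda$ if there are a $Df$-invariant splitting $T_\Lambda\mathbb{C}^n=E^s\oplus F$ into complex subbundles and constants $0<\lambda<\mu$, $C>0$, with $\lambda<1$, such that $\|Df^m(x)|_{E^s(x)}\|\le C\lambda^m$ and $\|Df^{-m}(x)|_{F(x)}\|\le C\mu^{-m}$ for all $m\ge 0$ and $x\in\Lambda$. $F$ is an unstable direction if in addition there are $C'>0$ and $0<\theta<1$ with $\|Df^{-m}(x)|_{F(x)}\|\le C'\theta^m$ for all $m\ge 0$, $x\in\Lambda$. $cu$-leaves: let $k=\dim_{\mathbb{C}}E^s$, $l=\dim_{\mathbb{C}}F$ and $\Delta_j(0,r)=\{z\in\mathbb{C}^j: |z_i|<r,\ i=1,\dots,j\}$. By a theorem of Hirsch–Pugh–Shub there is a continuous function $\phi^{cu}:\Lambda\to \mathrm{Emb}^1(\Delta_l(0,1),\mathbb{C}^n)$ (the $C^1$-embeddings, with $\phi^{cu}(x)(0)=x$) such that,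 putting $W^{cu}_\varepsilon(x)=\phi^{cu}(x)\Delta_l(0,\varepsilon)$, one has $T_xW^{cu}_\varepsilon(x)=F(x)$, and for all $0<\varepsilon_1<1$ there is $\varepsilon_2>0$ with $f^{-1}(W^{cu}_{\varepsilon_2}(x))\subset W^{cu}_{\varepsilon_1}(f^{-1}(x))$ for all $x\in\Lambda$. Such a family is fixed; the sets $W^{cu}_\varepsilon(x)$ are the (local) $cu$-leaves (center-unstable leaves). Unstable sets: with $d$ the Euclidean distance, $W^u(x)=\{y: d(f^{-m}(x),f^{-m}(y))\to 0 \text{ as } m\to\infty\}$, and the local unstable set of size $\eta$ is $W^u_\eta(x)=\{y\in W^u(x): d(f^{-m}(x),f^{-m}(y))\le\eta \text{ for all } m\ge 0\}$. Dynamically defined: the $cu$-leaves are dynamically defined if for all sufficiently small $\varepsilon$ the leaf $W^{cu}_\varepsilon(x)$ is contained in the local unstable set of $x$, for all $x\in\Lambda$; precisely, for every $\eta>0$ there is $\varepsilon_0>0$ such that $W^{cu}_\varepsilon(x)\subset W^u_\eta(x)$ for all $x\in\Lambda$ and $0<\varepsilon<\varepsilon_0$. Forward expansive: the $cu$-leaves are forward expansive ($f$ is $cu$-forward expansive) if there are $\varepsilon\in(0,1]$ and a uniform constant $c>0$ such that for every $x\in\Lambda$ and every $y\in W^{cu}_\varepsilon(x)$ with $y\ne x$ there is $m\in\mathbb{N}$ with $d(f^m(y),f^m(x))>c$. *)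

theory Defs
  imports "HOL-Analysis.Analysis"
begin

text \<open>
  \<open>\<complex>\<^sup>n\<close> is \<^typ>\<open>complex ^ 'n\<close>. Its norm and distance are Euclidean. Complex subspaces, spans and
  dimensions are those of the interpretation \<open>vec\<close> (scalar multiplication \<open>*s\<close>), whereas
  \<open>subspace\<close>, \<open>span\<close>, \<open>dim\<close> and \<open>has_derivative\<close> without prefix refer to the real structure.
\<close>

definition holomorphic_map :: "(complex ^ 'n \<Rightarrow> complex ^ 'n) \<Rightarrow> bool" where
  "holomorphic_map f \<longleftrightarrow>
     (\<forall>x. \<exists>A. (f has_derivative A) (at x) \<and> Vector_Spaces.linear (*s) (*s) A)"

definition biholomorphism :: "(complex ^ 'n \<Rightarrow> complex ^ 'n) \<Rightarrow> bool" where
  "biholomorphism f \<longleftrightarrow> bij f \<and> holomorphic_map f \<and> holomorphic_map (inv f)"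

text \<open>The operator norm of the restriction \<open>A|\<^sub>V\<close>; it is 0 for \<open>V = {0}\<close>.\<close>

definition opnorm_on :: "(complex ^ 'n \<Rightarrow> complex ^ 'n) \<Rightarrow> (complex ^ 'n) set \<Rightarrow> real" where
  "opnorm_on A V = (SUP v\<in>{v\<in>V. norm v \<le> 1}. norm (A v))"

text \<open>Complex subbundles of \<open>\<Lambda> \<times> \<complex>\<^sup>n\<close>: constant rank, with continuous local frames.\<close>

definition complex_subbundle :: "(complex ^ 'n) set \<Rightarrow> (complex ^ 'n \<Rightarrow> (complex ^ 'n) set) \<Rightarrow> bool"
  where
  "complex_subbundle \<Lambda> E \<longleftrightarrow>
     (\<exists>k::nat. \<forall>x\<in>\<Lambda>. \<exists>U v. open U \<and> x \<in> U \<and>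
        (\<forall>i<k. continuous_on (U \<inter> \<Lambda>) (v i)) \<and>
        (\<forall>y\<in>U \<inter> \<Lambda>. inj_on (\<lambda>i. v i y) {..<k} \<and>
                    vec.independent ((\<lambda>i. v i y) ` {..<k}) \<and>
                    vec.span ((\<lambda>i. v i y) ` {..<k}) = E y))"

definition invariant_splitting ::
  "(complex ^ 'n \<Rightarrow> complex ^ 'n) \<Rightarrow> (complex ^ 'n) set \<Rightarrow>
   (complex ^ 'n \<Rightarrow> (complex ^ 'n) set) \<Rightarrow> (complex ^ 'n \<Rightarrow> (complex ^ 'n) set) \<Rightarrow> bool" where
  "invariant_splitting f \<Lambda> E F \<longleftrightarrow>
     complex_subbundle \<Lambda> E \<and> complex_subbundle \<Lambda> F \<and>
     (\<forall>x\<in>\<Lambda>. E x \<inter> F x = {0} \<and> (\<forall>w. \<exists>u\<in>E x. \<exists>v\<in>F x. w = u + v)) \<and>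
     (\<forall>x\<in>\<Lambda>. frechet_derivative f (at x) ` E x = E (f x) \<and>
             frechet_derivative f (at x) ` F x = F (f x))"

definition partially_hyperbolic ::
  "(complex ^ 'n \<Rightarrow> complex ^ 'n) \<Rightarrow> (complex ^ 'n) set \<Rightarrow>
   (complex ^ 'n \<Rightarrow> (complex ^ 'n) set) \<Rightarrow> (complex ^ 'n \<Rightarrow> (complex ^ 'n) set) \<Rightarrow> bool" where
  "partially_hyperbolic f \<Lambda> E F \<longleftrightarrow>
     invariant_splitting f \<Lambda> E F \<and>
     (\<exists>\<nu> \<mu> C. 0 < \<nu> \<and> \<nu> < \<mu> \<and> \<nu> < 1 \<and> C > 0 \<and>
        (\<forall>m. \<forall>x\<in>\<Lambda>.
           opnorm_on (frechet_derivative (f ^^ m) (at x)) (E x) \<le> C * \<nu> ^ m \<and>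
           opnorm_on (frechet_derivative (inv f ^^ m) (at x)) (F x) \<le> C / \<mu> ^ m))"

definition unstable_direction ::
  "(complex ^ 'n \<Rightarrow> complex ^ 'n) \<Rightarrow> (complex ^ 'n) set \<Rightarrow>
   (complex ^ 'n \<Rightarrow> (complex ^ 'n) set) \<Rightarrow> bool" where
  "unstable_direction f \<Lambda> F \<longleftrightarrow>
     (\<exists>C \<theta>. C > 0 \<and> 0 < \<theta> \<and> \<theta> < 1 \<and>
        (\<forall>m. \<forall>x\<in>\<Lambda>.
           opnorm_on (frechet_derivative (inv f ^^ m) (at x)) (F x) \<le> C * \<theta> ^ m))"

definition uniformly_hyperbolic ::
  "(complex ^ 'n \<Rightarrow> complex ^ 'n) \<Rightarrow> (complex ^ 'n) set \<Rightarrow>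
   (complex ^ 'n \<Rightarrow> (complex ^ 'n) set) \<Rightarrow> (complex ^ 'n \<Rightarrow> (complex ^ 'n) set) \<Rightarrow> bool" where
  "uniformly_hyperbolic f \<Lambda> E F \<longleftrightarrow>
     partially_hyperbolic f \<Lambda> E F \<and> unstable_direction f \<Lambda> F"

text \<open>
  The parameter space \<open>\<complex>\<^sup>l\<close>, \<open>0 \<le> l \<le> n\<close>, is realised isometrically as the coordinate subspace
  of \<open>\<complex>\<^sup>n\<close> spanned by the coordinates in a set \<open>J\<close> with \<open>l\<close> elements. A type-indexed \<open>\<complex>\<^sup>l\<close>
  would exclude the degenerate case \<open>l = 0\<close>.
\<close>

definition coord_space :: "'n set \<Rightarrow> (complex ^ 'n) set" where
  "coord_space J = {z. \<forall>i. i \<notin> J \<longrightarrow> z $ i = 0}"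

definition polydisc :: "'n set \<Rightarrow> real \<Rightarrow> (complex ^ 'n) set" where
  "polydisc J r = {z \<in> coord_space J. \<forall>i\<in>J. norm (z $ i) < r}"

text \<open>
  The derivative of a map defined on the unit polydisc of \<open>coord_space J\<close>. It is determined on
  \<open>coord_space J\<close> only, so it must be applied to vectors of that subspace only.
\<close>

definition disc_derivative ::
  "'n set \<Rightarrow> (complex ^ 'n \<Rightarrow> complex ^ 'n) \<Rightarrow> complex ^ 'n \<Rightarrow> complex ^ 'n \<Rightarrow> complex ^ 'n" where
  "disc_derivative J \<psi> z = frechet_derivative \<psi> (at z within polydisc J 1)"

text \<open>\<open>C\<^sup>1\<close> is meant in the real sense; the leaves are not assumed to be complex submanifolds.\<close>

definition C1_embedding :: "'n set \<Rightarrow> (complex ^ 'n \<Rightarrow> complex ^ 'n) \<Rightarrow> bool" where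
  "C1_embedding J \<psi> \<longleftrightarrow>
     (\<forall>z\<in>polydisc J 1. \<psi> differentiable (at z within polydisc J 1)) \<and>
     (\<forall>v\<in>coord_space J. continuous_on (polydisc J 1) (\<lambda>z. disc_derivative J \<psi> z v)) \<and>
     (\<forall>z\<in>polydisc J 1. inj_on (disc_derivative J \<psi> z) (coord_space J)) \<and>
     (\<exists>g. homeomorphism (polydisc J 1) (\<psi> ` polydisc J 1) \<psi> g)"

text \<open>
  Continuity of \<open>x \<mapsto> \<phi> x\<close> on \<open>\<Lambda>\<close> for the \<open>C\<^sup>1\<close> topology on maps of the open polydisc: uniform
  convergence on compact subsets of the maps and of their derivatives.
\<close>

definition C1_continuous_on ::
  "(complex ^ 'n) set \<Rightarrow> 'n set \<Rightarrow> (complex ^ 'n \<Rightarrow> complex ^ 'n \<Rightarrow> complex ^ 'n) \<Rightarrow> bool" where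
  "C1_continuous_on \<Lambda> J \<phi> \<longleftrightarrow>
     (\<forall>x\<in>\<Lambda>. \<forall>K e. compact K \<longrightarrow> K \<subseteq> polydisc J 1 \<longrightarrow> e > 0 \<longrightarrow>
        (\<exists>\<delta>>0. \<forall>y\<in>\<Lambda>. dist y x < \<delta> \<longrightarrow>
           (\<forall>z\<in>K. dist (\<phi> y z) (\<phi> x z) < e \<and>
                  opnorm_on (\<lambda>v. disc_derivative J (\<phi> y) z v - disc_derivative J (\<phi> x) z v)
                    (coord_space J) < e)))"

definition cu_leaf ::
  "'n set \<Rightarrow> (complex ^ 'n \<Rightarrow> complex ^ 'n \<Rightarrow> complex ^ 'n) \<Rightarrow> real \<Rightarrow> complex ^ 'n \<Rightarrow> (complex ^ 'n) set"
  where
  "cu_leaf J \<phi> \<epsilon> x = \<phi> x ` polydisc J \<epsilon>"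

text \<open>
  The maps \<open>\<phi> x\<close> are only meaningful on \<open>polydisc J 1\<close>, so leaf sizes are at most 1 throughout.
\<close>

definition cu_leaf_family ::
  "(complex ^ 'n \<Rightarrow> complex ^ 'n) \<Rightarrow> (complex ^ 'n) set \<Rightarrow> (complex ^ 'n \<Rightarrow> (complex ^ 'n) set) \<Rightarrow>
   'n set \<Rightarrow> (complex ^ 'n \<Rightarrow> complex ^ 'n \<Rightarrow> complex ^ 'n) \<Rightarrow> bool" where
  "cu_leaf_family f \<Lambda> F J \<phi> \<longleftrightarrow>
     (\<forall>x\<in>\<Lambda>. card J = vec.dim (F x)) \<and>
     (\<forall>x\<in>\<Lambda>. C1_embedding J (\<phi> x) \<and> \<phi> x 0 = x) \<and>
     C1_continuous_on \<Lambda> J \<phi> \<and>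
     (\<forall>x\<in>\<Lambda>. disc_derivative J (\<phi> x) 0 ` coord_space J = F x) \<and>
     (\<forall>\<epsilon>\<^sub>1. 0 < \<epsilon>\<^sub>1 \<and> \<epsilon>\<^sub>1 < 1 \<longrightarrow>
        (\<exists>\<epsilon>\<^sub>2. 0 < \<epsilon>\<^sub>2 \<and> \<epsilon>\<^sub>2 \<le> 1 \<and>
           (\<forall>x\<in>\<Lambda>. inv f ` cu_leaf J \<phi> \<epsilon>\<^sub>2 x \<subseteq> cu_leaf J \<phi> \<epsilon>\<^sub>1 (inv f x))))"

definition unstable_set ::
  "(complex ^ 'n \<Rightarrow> complex ^ 'n) \<Rightarrow> complex ^ 'n \<Rightarrow> (complex ^ 'n) set" where
  "unstable_set f x = {y. (\<lambda>m. dist ((inv f ^^ m) x) ((inv f ^^ m) y)) \<longlonglongrightarrow> 0}"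

definition local_unstable_set ::
  "(complex ^ 'n \<Rightarrow> complex ^ 'n) \<Rightarrow> real \<Rightarrow> complex ^ 'n \<Rightarrow> (complex ^ 'n) set" where
  "local_unstable_set f \<eta> x =
     {y \<in> unstable_set f x. \<forall>m. dist ((inv f ^^ m) x) ((inv f ^^ m) y) \<le> \<eta>}"

definition dynamically_defined ::
  "(complex ^ 'n \<Rightarrow> complex ^ 'n) \<Rightarrow> (complex ^ 'n) set \<Rightarrow> 'n set \<Rightarrow>
   (complex ^ 'n \<Rightarrow> complex ^ 'n \<Rightarrow> complex ^ 'n) \<Rightarrow> bool" where
  "dynamically_defined f \<Lambda> J \<phi> \<longleftrightarrow>
     (\<forall>\<eta>>0. \<exists>\<epsilon>\<^sub>0. 0 < \<epsilon>\<^sub>0 \<and> \<epsilon>\<^sub>0 \<le> 1 \<and>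
        (\<forall>x\<in>\<Lambda>. \<forall>\<epsilon>. 0 < \<epsilon> \<and> \<epsilon> < \<epsilon>\<^sub>0 \<longrightarrow> cu_leaf J \<phi> \<epsilon> x \<subseteq> local_unstable_set f \<eta> x))"

definition cu_forward_expansive ::
  "(complex ^ 'n \<Rightarrow> complex ^ 'n) \<Rightarrow> (complex ^ 'n) set \<Rightarrow> 'n set \<Rightarrow>
   (complex ^ 'n \<Rightarrow> complex ^ 'n \<Rightarrow> complex ^ 'n) \<Rightarrow> bool" where
  "cu_forward_expansive f \<Lambda> J \<phi> \<longleftrightarrow>
     (\<exists>\<epsilon> c. 0 < \<epsilon> \<and> \<epsilon> \<le> 1 \<and> c > 0 \<and>
        (\<forall>x\<in>\<Lambda>. \<forall>y\<in>cu_leaf J \<phi> \<epsilon> x. y \<noteq> x \<longrightarrow> (\<exists>m. dist ((f ^^ m) y) ((f ^^ m) x) > c)))"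

end

theory Submission
  imports Defs "HOL-Complex_Analysis.Cauchy_Integral_Formula"
begin

text \<open>
  The three properties are linked in a cycle: hyperbolicity implies forward expansivity, which implies
  that the leaves are dynamically defined, which implies hyperbolicity. Complex analysis enters
  in the last implication, which fails for smooth maps: on a centre direction \<open>f\<close> may act near 0 like
  \<open>x \<mapsto> x + x\<^sup>3\<close>, whose inverse iterates tend to 0, but not exponentially.

  \<^bold>\<open>Leaves near their centre.\<close> By compactness of \<open>\<Lambda>\<close> and \<open>C\<^sup>1\<close>-continuity of \<open>\<phi>\<close>, on a small polydisc
  every \<open>\<phi> x\<close> is uniformly close to its linear part, whose image is \<open>F x\<close>
  (\<open>leaf_map_uniform_linearisation\<close>). So differences of points of a small leaf are almost vectors of
  \<open>F x\<close>, and a power of \<open>f\<close> inverse changes distances in the leaf, up to a factor 2, at most as its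
  derivative on \<open>F x\<close> does (\<open>inverse_iterate_contracts_leaf\<close>).

  \<^bold>\<open>Hyperbolic implies expansive.\<close> Some inverse iterate then halves distances in small leaves. The
  leaves are locally invariant under \<open>f\<close> too, by invariance of domain (\<open>forward_step_into_leaf\<close>). If
  the forward orbit of a leaf point never leaves a small neighbourhood of that of \<open>x\<close>, it stays in small
  leaves, and pulling back from time \<open>k N\<close> bounds the distance to \<open>x\<close> by a multiple of \<open>2\<^sup>-\<^sup>k\<close>.

  \<^bold>\<open>Expansive implies dynamically defined.\<close> Compactness makes expansivity uniform: a leaf point that
  stays close for \<open>M\<close> steps has a small parameter (\<open>uniform_expansivity\<close>). Read backwards, the
  inverse orbit of a point near the centre cannot leave the leaves, and it approaches that of \<open>x\<close>.

  \<^bold>\<open>Dynamically defined implies hyperbolic.\<close> A small leaf is a Lipschitz graph over a ball of \<open>F x\<close>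
  (\<open>leaf_is_graph_over_F\<close>). Restrict the graph to a complex line of \<open>F x\<close>. Two difference quotients of
  this restriction differ by a vector of \<open>E x\<close>, which \<open>f\<^sup>-\<^sup>m\<close> expands far more than it expands
  differences of leaf points. Since all inverse iterates stay in the leaves, the difference quotients
  form a Cauchy family: the restriction is a holomorphic disc
  (\<open>backward_contracted_disc_is_holomorphic\<close>), although the leaf is only assumed to be \<open>C\<^sup>1\<close>. On this
  disc the inverse iterates are bounded, relative to those of \<open>x\<close>, and tend to 0; by the Cauchy formula
  so do their derivatives at the centre. Hence \<open>Df\<^sup>-\<^sup>m\<close> tends to 0 on every vector of \<open>F x\<close>, and
  compactness of the unit sphere bundle of \<open>F\<close> makes the decay exponential and uniform
  (\<open>unstable_if_backward_images_vanish\<close>).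
\<close>

section \<open>Complex vectors and holomorphic maps\<close>

lemma norm_vector_smult: "norm (c *s (v :: complex ^ 'n)) = norm c * norm v"
  by (simp add: norm_vec_def norm_mult L2_set_right_distrib)

lemma bounded_linear_vector_smult: "bounded_linear (\<lambda>c::complex. c *s (v :: complex ^ 'n))"
proof (rule bounded_linear_intro[where K = "norm v"])
  fix c d :: complex and r :: real
  show "(c + d) *s v = c *s v + d *s v" by (simp add: vec_eq_iff algebra_simps)
  show "(r *\<^sub>R c) *s v = r *\<^sub>R (c *s v)" by (simp add: vec_eq_iff)
  show "norm (c *s v) \<le> norm c * norm v" by (simp add: norm_vector_smult)
qed

lemma scaleR_eq_vector_smult: "r *\<^sub>R (v :: complex ^ 'n) = of_real r *s v"
  by (simp add: vec_eq_iff) (simp add: scaleR_conv_of_real)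

lemma complex_subspace_imp_real: "vec.subspace V \<Longrightarrow> subspace (V :: (complex ^ 'n) set)"
  unfolding subspace_def vec.subspace_def by (auto simp: scaleR_eq_vector_smult)

lemma norm_le_opnorm_on:
  fixes A :: "complex ^ 'n \<Rightarrow> complex ^ 'n"
  assumes A: "linear A" and V: "subspace V" and v: "v \<in> V"
  shows "norm (A v) \<le> opnorm_on A V * norm v"
proof (cases "v = 0")
  case True
  then show ?thesis using linear_0[OF A] by simp
next
  case False
  obtain B where B: "\<And>x. norm (A x) \<le> B * norm x" "B > 0"
    using linear_bounded_pos[OF A] by blast
  have bdd: "bdd_above ((\<lambda>v. norm (A v)) ` {v \<in> V. norm v \<le> 1})"
  proof (rule bdd_aboveI2)
    fix x assume "x \<in> {v \<in> V. norm v \<le> 1}"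
    then show "norm (A x) \<le> B"
      using B(1)[of x] B(2) by (smt (verit) mem_Collect_eq mult_left_le)
  qed
  have "norm (A (v /\<^sub>R norm v)) \<le> opnorm_on A V"
    unfolding opnorm_on_def
    by (rule cSUP_upper[OF _ bdd]) (use v V False in \<open>auto simp: subspace_scale\<close>)
  then show ?thesis
    using False by (simp add: linear_cmul[OF A] field_simps)
qed

lemma opnorm_on_le:
  fixes A :: "complex ^ 'n \<Rightarrow> complex ^ 'n"
  assumes "0 \<in> V" "B \<ge> 0" and le: "\<And>v. v \<in> V \<Longrightarrow> norm (A v) \<le> B * norm v"
  shows "opnorm_on A V \<le> B"
  unfolding opnorm_on_def
proof (rule cSUP_least)
  show "{v \<in> V. norm v \<le> 1} \<noteq> {}" using assms(1) by (auto intro!: exI[of _ 0])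
  fix v assume "v \<in> {v \<in> V. norm v \<le> 1}"
  then show "norm (A v) \<le> B"
    using le[of v] assms(2) by (smt (verit) mem_Collect_eq mult_left_le)
qed

lemma holomorphic_map_has_derivative:
  assumes "holomorphic_map g"
  shows "(g has_derivative frechet_derivative g (at x)) (at x)"
  using assms unfolding holomorphic_map_def
  by (meson differentiableI frechet_derivative_works)

lemma holomorphic_map_derivative_linear:
  assumes "holomorphic_map g"
  shows "Vector_Spaces.linear (*s) (*s) (frechet_derivative g (at x))"
  using assms holomorphic_map_has_derivative[OF assms, of x] unfolding holomorphic_map_def
  by (metis has_derivative_unique)

lemma holomorphic_map_derivative_smult:
  assumes "holomorphic_map g"
  shows "frechet_derivative g (at x) (c *s v) = c *s frechet_derivative g (at x) v"
  using holomorphic_map_derivative_linear[OF assms] unfolding Vector_Spaces.linear_iff by blast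

lemma holomorphic_map_continuous: "holomorphic_map g \<Longrightarrow> continuous_on S g"
  by (meson continuous_at_imp_continuous_on has_derivative_continuous holomorphic_map_has_derivative)

lemma holomorphic_map_compose:
  assumes g: "holomorphic_map g" and h: "holomorphic_map h"
  shows "holomorphic_map (g \<circ> h)"
    and "frechet_derivative (g \<circ> h) (at x) v =
           frechet_derivative g (at (h x)) (frechet_derivative h (at x) v)"
proof -
  have d: "((g \<circ> h) has_derivative frechet_derivative g (at (h x)) \<circ> frechet_derivative h (at x)) (at x)" for x
    by (intro diff_chain_at holomorphic_map_has_derivative g h)
  have "Vector_Spaces.linear (*s) (*s) (frechet_derivative g (at (h x)) \<circ> frechet_derivative h (at x))" for x
    using holomorphic_map_derivative_linear[OF g, of "h x"] holomorphic_map_derivative_linear[OF h, of x]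
    unfolding Vector_Spaces.linear_iff by simp
  then show "holomorphic_map (g \<circ> h)"
    using d unfolding holomorphic_map_def by blast
  show "frechet_derivative (g \<circ> h) (at x) v =
           frechet_derivative g (at (h x)) (frechet_derivative h (at x) v)"
    using frechet_derivative_at[OF d[of x]] by (metis comp_apply)
qed

lemma holomorphic_map_id: "holomorphic_map id"
  unfolding holomorphic_map_def by (metis has_derivative_id vec.linear_id id_def)

lemma holomorphic_map_funpow: "holomorphic_map g \<Longrightarrow> holomorphic_map (g ^^ m)"
  by (induction m) (simp_all add: holomorphic_map_id holomorphic_map_compose)

lemma holomorphic_map_disc_derivative:
  assumes "holomorphic_map g"
  shows "((\<lambda>t. g (x + t *s v)) has_derivative
           (\<lambda>s. s *s frechet_derivative g (at (x + t *s v)) v)) (at t)"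
proof -
  have "((\<lambda>t. x + t *s v) has_derivative (\<lambda>s. s *s v)) (at t)"
    using bounded_linear.has_derivative[OF bounded_linear_vector_smult has_derivative_ident, of v "at t"]
    by (auto intro!: derivative_eq_intros)
  from has_derivative_compose[OF this holomorphic_map_has_derivative[OF assms]]
  show ?thesis by (simp add: holomorphic_map_derivative_smult[OF assms])
qed

lemma has_field_derivative_component:
  fixes q :: "complex \<Rightarrow> complex ^ 'n"
  assumes "(q has_derivative (\<lambda>s. s *s w)) F"
  shows "((\<lambda>t. q t $ i) has_field_derivative w $ i) F"
  using bounded_linear.has_derivative[OF bounded_linear_vec_nth assms, of i]
  unfolding has_field_derivative_def by (simp add: mult.commute[of "w $ i"] mult_commute_abs)

text \<open>
  Cauchy's estimate on the circle \<open>\<bar>t\<bar> = 1\<close> for the entire function \<open>t \<mapsto> g (y + t v) - g (x + t v)\<close>. It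
  turns continuity of \<open>g\<close> into continuity of the derivative, whereas \<^const>\<open>holomorphic_map\<close> only asks for
  a derivative at each point.
\<close>

lemma holomorphic_map_derivative_diff_le:
  fixes g :: "complex ^ 'n \<Rightarrow> complex ^ 'n"
  assumes g: "holomorphic_map g" and v: "norm v = 1"
    and B: "\<And>t. norm t = 1 \<Longrightarrow> norm (g (y + t *s v) - g (x + t *s v)) \<le> B"
  shows "norm (frechet_derivative g (at y) v - frechet_derivative g (at x) v) \<le> real CARD('n) * B"
proof -
  let ?w = "frechet_derivative g (at y) v - frechet_derivative g (at x) v"
  have "norm (?w $ i) \<le> B" for i
  proof -
    let ?k = "\<lambda>t. (g (y + t *s v) - g (x + t *s v)) $ i"
    have d: "(?k has_field_derivative (frechet_derivative g (at (y + t *s v)) v -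
               frechet_derivative g (at (x + t *s v)) v) $ i) (at t)" for t
      by (rule has_field_derivative_component)
        (auto intro!: derivative_eq_intros holomorphic_map_disc_derivative[OF g]
          simp: vec.scale_right_diff_distrib)
    have "?k holomorphic_on ball 0 1" "continuous_on (cball 0 1) ?k"
      using d by (meson field_differentiable_def field_differentiable_at_within holomorphic_on_def
          continuous_at_imp_continuous_on DERIV_isCont)+
    then have "norm ((deriv ^^ 1) ?k 0) \<le> fact 1 * B / 1 ^ 1"
    proof (rule Cauchy_inequality)
      fix t :: complex assume "norm (0 - t) = 1"
      then have "norm (g (y + t *s v) - g (x + t *s v)) \<le> B" by (intro B) simp
      then show "norm (?k t) \<le> B" using Finite_Cartesian_Product.norm_nth_le order_trans by blast
    qed simp_all
    also have "(deriv ^^ 1) ?k 0 = ?w $ i" using DERIV_imp_deriv[OF d[of 0]] by simp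
    finally show ?thesis by simp
  qed
  then have "(\<Sum>i\<in>UNIV. norm (?w $ i)) \<le> real CARD('n) * B"
    by (intro sum_bounded_above) auto
  moreover have "norm ?w \<le> (\<Sum>i\<in>UNIV. norm (?w $ i))"
    unfolding norm_vec_def by (rule L2_set_le_sum) simp
  ultimately show ?thesis by linarith
qed

lemma holomorphic_map_derivative_uniform:
  fixes g :: "complex ^ 'n \<Rightarrow> complex ^ 'n"
  assumes g: "holomorphic_map g" and L: "compact L" and e: "e > 0"
  obtains \<delta> where "\<delta> > 0" "\<And>x y v. x \<in> L \<Longrightarrow> dist y x < \<delta> \<Longrightarrow>
     norm (frechet_derivative g (at y) v - frechet_derivative g (at x) v) \<le> e * norm v"
proof -
  \<comment> \<open>The unit circles around points at distance below 1 from \<open>L\<close> stay in this compact set.\<close>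
  let ?L = "{x + z |x z. x \<in> L \<and> z \<in> cball 0 2}"
  have "compact ?L" by (intro compact_sums L compact_cball)
  then have "uniformly_continuous_on ?L g"
    by (intro compact_uniformly_continuous holomorphic_map_continuous g)
  moreover have "e / real CARD('n) > 0" using e by simp
  ultimately have "\<exists>d>0. \<forall>a\<in>?L. \<forall>b\<in>?L. dist b a < d \<longrightarrow> dist (g b) (g a) < e / real CARD('n)"
    unfolding uniformly_continuous_on_def by blast
  then obtain d where d: "d > 0"
    "\<And>a b. a \<in> ?L \<Longrightarrow> b \<in> ?L \<Longrightarrow> dist b a < d \<Longrightarrow> dist (g b) (g a) < e / real CARD('n)"
    by blast
  have unit: "norm (frechet_derivative g (at y) v - frechet_derivative g (at x) v) \<le> e"
    if "x \<in> L" "dist y x < min d 1" "norm v = 1" for x y v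
  proof -
    have "norm (g (y + t *s v) - g (x + t *s v)) \<le> e / real CARD('n)" if t: "norm t = 1" for t
    proof -
      have "x + t *s v \<in> ?L" using \<open>x \<in> L\<close> t \<open>norm v = 1\<close>
        by (intro CollectI exI[of _ x] exI[of _ "t *s v"]) (simp add: norm_vector_smult)
      moreover have "y + t *s v \<in> ?L"
      proof -
        have "norm ((y - x) + t *s v) \<le> 2"
          using norm_triangle_ineq[of "y - x" "t *s v"] that(1) \<open>dist y x < min d 1\<close> t \<open>norm v = 1\<close>
          by (simp add: norm_vector_smult dist_norm)
        then show ?thesis using \<open>x \<in> L\<close>
          by (intro CollectI exI[of _ x] exI[of _ "(y - x) + t *s v"]) simp
      qed
      moreover have "dist (y + t *s v) (x + t *s v) < d"
        using \<open>dist y x < min d 1\<close> by simp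
      ultimately have "dist (g (y + t *s v)) (g (x + t *s v)) < e / real CARD('n)" by (rule d(2))
      then show ?thesis by (simp add: dist_norm)
    qed
    from holomorphic_map_derivative_diff_le[OF g that(3) this] show ?thesis by simp
  qed
  show ?thesis
  proof
    show "min d 1 > 0" using d by simp
    fix x y v assume xy: "x \<in> L" "dist y x < min d 1"
    show "norm (frechet_derivative g (at y) v - frechet_derivative g (at x) v) \<le> e * norm v"
    proof (cases "v = 0")
      case False
      have lin: "linear (\<lambda>v. frechet_derivative g (at y) v - frechet_derivative g (at x) v)"
        using has_derivative_linear[OF holomorphic_map_has_derivative[OF g]]
        by (intro linear_compose_sub) auto
      have "norm (v /\<^sub>R norm v) = 1" using False by simp
      from unit[OF xy this] show ?thesis
        using False by (simp add: linear_cmul[OF lin] divide_simps mult.commute)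
    next
      case True
      then show ?thesis
        using has_derivative_linear[OF holomorphic_map_has_derivative[OF g]] by (simp add: linear_0)
    qed
  qed
qed

text \<open>
  The mean value inequality for \<open>g\<close> minus its derivative at \<open>x\<close>, on a ball where the derivative is
  nearly constant. Both endpoints may vary: this is what compares two points of a leaf.
\<close>

lemma holomorphic_map_strict_derivative:
  fixes g :: "complex ^ 'n \<Rightarrow> complex ^ 'n"
  assumes g: "holomorphic_map g" and L: "compact L" and e: "e > 0"
  obtains \<delta> where "\<delta> > 0" "\<And>x y y'. x \<in> L \<Longrightarrow> dist y x < \<delta> \<Longrightarrow> dist y' x < \<delta> \<Longrightarrow>
     norm (g y - g y' - frechet_derivative g (at x) (y - y')) \<le> e * norm (y - y')"
proof -
  obtain d where d: "d > 0" "\<And>x y v. x \<in> L \<Longrightarrow> dist y x < d \<Longrightarrow>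
     norm (frechet_derivative g (at y) v - frechet_derivative g (at x) v) \<le> e * norm v"
    using holomorphic_map_derivative_uniform[OF assms] by metis
  show ?thesis
  proof
    show "d > 0" by fact
    fix x y y' assume *: "x \<in> L" "dist y x < d" "dist y' x < d"
    let ?A = "frechet_derivative g (at x)"
    have bl: "bounded_linear ?A" using holomorphic_map_has_derivative[OF g] has_derivative_bounded_linear by blast
    have "norm ((g y - ?A y) - (g y' - ?A y')) \<le> e * norm (y - y')"
    proof (rule differentiable_bound[of "ball x d" "\<lambda>y. g y - ?A y"
            "\<lambda>y v. frechet_derivative g (at y) v - ?A v"])
      show "((\<lambda>y. g y - ?A y) has_derivative (\<lambda>v. frechet_derivative g (at z) v - ?A v)) (at z within ball x d)" for z
        by (rule has_derivative_diff[OF has_derivative_at_withinI[OF holomorphic_map_has_derivative[OF g]]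
              bounded_linear_imp_has_derivative[OF bl]])
      show "onorm (\<lambda>v. frechet_derivative g (at z) v - ?A v) \<le> e" if "z \<in> ball x d" for z
        using d(2)[OF *(1), of z] that e by (intro onorm_le) (auto simp: dist_commute)
    qed (use * in \<open>auto simp: dist_commute\<close>)
    then show "norm (g y - g y' - ?A (y - y')) \<le> e * norm (y - y')"
      by (simp add: bounded_linear.linear[OF bl] linear_diff algebra_simps)
  qed
qed

lemma holomorphic_map_derivative_continuous:
  fixes g :: "complex ^ 'n \<Rightarrow> complex ^ 'n"
  assumes g: "holomorphic_map g"
  shows "continuous_on S (\<lambda>(x, v). frechet_derivative g (at x) v)"
proof -
  have "isCont (\<lambda>(x, v). frechet_derivative g (at x) v) q" for q
  proof -
    obtain p v where q: "q = (p, v)" by fastforce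
    let ?A = "\<lambda>x. frechet_derivative g (at x)"
    have bl: "bounded_linear (?A p)"
      using holomorphic_map_has_derivative[OF g] has_derivative_bounded_linear by blast
    have fix_point: "((\<lambda>(x, w). ?A p w) \<longlongrightarrow> ?A p v) (at q)"
      unfolding q case_prod_beta
      by (rule bounded_linear.tendsto[OF bl]) (auto intro!: tendsto_eq_intros)
    have "((\<lambda>(x, w). ?A x w - ?A p w) \<longlongrightarrow> 0) (at q)"
    proof (rule tendstoI)
      fix e :: real assume e: "e > 0"
      have "e / (norm v + 1) > 0" using e by (simp add: add_nonneg_pos)
      then obtain \<delta> where \<delta>: "\<delta> > 0" "\<And>x w. dist x p < \<delta> \<Longrightarrow>
          norm (?A x w - ?A p w) \<le> e / (norm v + 1) * norm w"
        using holomorphic_map_derivative_uniform[OF g, of "{p}"] by (metis compact_sing singletonI)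
      have "((\<lambda>r. dist (fst r) p) \<longlongrightarrow> 0) (at q)" "((\<lambda>r. norm (snd r)) \<longlongrightarrow> norm v) (at q)"
        unfolding q by (auto intro!: tendsto_eq_intros)
      then have "\<forall>\<^sub>F r in at q. dist (fst r) p < \<delta>" "\<forall>\<^sub>F r in at q. norm (snd r) < norm v + 1"
        using \<delta>(1) by (auto intro: order_tendstoD)
      then show "\<forall>\<^sub>F r in at q. dist (case r of (x, w) \<Rightarrow> ?A x w - ?A p w) 0 < e"
      proof eventually_elim
        case (elim r)
        have "norm (?A (fst r) (snd r) - ?A p (snd r)) \<le> e / (norm v + 1) * norm (snd r)"
          by (rule \<delta>(2)) (fact elim)
        also have "\<dots> < e / (norm v + 1) * (norm v + 1)"
          using elim(2) \<open>e / (norm v + 1) > 0\<close> by (rule mult_strict_left_mono)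
        also have "\<dots> = e" by (simp add: add_nonneg_eq_0_iff)
        finally show ?case by (simp add: case_prod_beta)
      qed
    qed
    from tendsto_add[OF this fix_point] show ?thesis
      by (simp add: isCont_def q case_prod_unfold)
  qed
  then show ?thesis by (simp add: continuous_at_imp_continuous_on)
qed

lemma holomorphic_map_derivative_bounded:
  fixes g :: "complex ^ 'n \<Rightarrow> complex ^ 'n"
  assumes g: "holomorphic_map g" and L: "compact L"
  obtains K where "K > 0" "\<And>x v. x \<in> L \<Longrightarrow> norm (frechet_derivative g (at x) v) \<le> K * norm v"
proof -
  have "compact ((\<lambda>(x, v). frechet_derivative g (at x) v) ` (L \<times> sphere 0 1))"
    by (intro compact_continuous_image holomorphic_map_derivative_continuous g compact_Times L) simp
  then obtain K where K: "K > 0" "\<And>w. w \<in> (\<lambda>(x, v). frechet_derivative g (at x) v) ` (L \<times> sphere 0 1) \<Longrightarrow> norm w \<le> K"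
    using compact_imp_bounded bounded_pos by metis
  show ?thesis
  proof
    show "K > 0" by fact
    fix x v assume x: "x \<in> L"
    have lin: "linear (frechet_derivative g (at x))"
      using has_derivative_linear[OF holomorphic_map_has_derivative[OF g]] .
    show "norm (frechet_derivative g (at x) v) \<le> K * norm v"
    proof (cases "v = 0")
      case False
      have "norm (frechet_derivative g (at x) (v /\<^sub>R norm v)) \<le> K"
        by (rule K(2)) (use x False in \<open>auto intro!: image_eqI[of _ _ "(x, v /\<^sub>R norm v)"]\<close>)
      then show ?thesis using False by (simp add: linear_cmul[OF lin] divide_simps mult.commute)
    qed (simp add: linear_0[OF lin])
  qed
qed

text \<open>
  The pattern behind every uniform leaf size below: a radius that works near each point, and may be
  shrunk, can be chosen once for a compact set.
\<close>

lemma compact_uniform_radius: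
  assumes L: "compact L"
    and loc: "\<And>p. p \<in> L \<Longrightarrow> \<exists>\<delta>>0. \<exists>r>0. \<forall>y\<in>L. dist y p < \<delta> \<longrightarrow> P y r"
    and mono: "\<And>y r s. y \<in> L \<Longrightarrow> P y r \<Longrightarrow> 0 < s \<Longrightarrow> s \<le> r \<Longrightarrow> P y s"
  shows "\<exists>r::real. r > 0 \<and> (\<forall>y\<in>L. P y r)"
proof -
  obtain \<delta> r where \<delta>r: "\<And>p. p \<in> L \<Longrightarrow> \<delta> p > 0 \<and> r p > 0 \<and> (\<forall>y\<in>L. dist y p < \<delta> p \<longrightarrow> P y (r p))"
    using loc by metis
  obtain C where C: "C \<subseteq> L" "finite C" "L \<subseteq> (\<Union>p\<in>C. ball p (\<delta> p))"
  proof (rule compactE_image[OF L, of L "\<lambda>p. ball p (\<delta> p)"])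
    show "L \<subseteq> (\<Union>p\<in>L. ball p (\<delta> p))" using \<delta>r by force
  qed auto
  let ?r = "Min (insert 1 (r ` C))"
  have pos: "?r > 0" using C \<delta>r by (subst Min_gr_iff) auto
  show ?thesis
  proof (intro exI[of _ ?r] conjI ballI pos)
    fix y assume y: "y \<in> L"
    then obtain p where p: "p \<in> C" "dist y p < \<delta> p" using C(3) by (auto simp: dist_commute)
    then have "P y (r p)" using \<delta>r C(1) y by blast
    moreover have "?r \<le> r p" using C(2) p(1) by (intro Min_le) auto
    ultimately show "P y ?r" using mono y pos by blast
  qed
qed

text \<open>
  The image of the open ball is open in \<open>T\<close> by invariance of domain, the image of the closed ball is
  compact, and inside the ball of radius \<open>\<rho>\<close> the two coincide, because the sphere is sent outside it.
  A connected set that meets an open and closed subset lies in it.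
\<close>

lemma injective_map_covers_ball:
  fixes h :: "'a::euclidean_space \<Rightarrow> 'b::euclidean_space"
  assumes S: "subspace S" and T: "subspace T" and dim: "dim T \<le> dim S"
    and cont: "continuous_on (S \<inter> cball 0 s) h" and inj: "inj_on h (S \<inter> cball 0 s)"
    and into: "h ` (S \<inter> cball 0 s) \<subseteq> T" and h0: "h 0 = 0" and s: "s > 0"
    and big: "\<And>z. z \<in> S \<Longrightarrow> norm z = s \<Longrightarrow> norm (h z) \<ge> \<rho>"
  shows "T \<inter> ball 0 \<rho> \<subseteq> h ` (S \<inter> ball 0 s)"
proof (cases "\<rho> > 0")
  case True
  let ?I = "h ` (S \<inter> ball 0 s)"
  have op: "openin (top_of_set T) ?I"
  proof (rule invariance_of_domain_subspaces[OF _ S T dim])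
    show "openin (top_of_set S) (S \<inter> ball 0 s)" by (simp add: openin_open_Int)
    show "continuous_on (S \<inter> ball 0 s) h" using cont by (rule continuous_on_subset) auto
    show "inj_on h (S \<inter> ball 0 s)" using inj by (rule inj_on_subset) auto
    show "h \<in> S \<inter> ball 0 s \<rightarrow> T" using into by auto
  qed
  let ?U = "T \<inter> ball 0 \<rho>"
  have eq: "?U \<inter> ?I = ?U \<inter> h ` (S \<inter> cball 0 s)"
  proof -
    have "h z \<in> ?I" if "z \<in> S" "norm z \<le> s" "norm (h z) < \<rho>" for z
      using big[of z] that by (intro imageI) (cases "norm z = s"; auto)
    then show ?thesis by auto
  qed
  have "connected ?U" using subspace_imp_convex[OF T] by (intro convex_connected convex_Int) auto
  moreover have "openin (top_of_set ?U) (?U \<inter> ?I)"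
    using op by (auto simp: openin_open)
  moreover have "closedin (top_of_set ?U) (?U \<inter> ?I)"
    unfolding eq
    by (intro closedin_closed_Int compact_imp_closed compact_continuous_image cont
        closed_Int_compact closed_subspace S compact_cball)
  moreover have "?U \<inter> ?I \<noteq> {}"
  proof -
    have "0 \<in> ?U" "0 \<in> ?I"
      using True s h0 S T by (auto simp: subspace_0 intro!: image_eqI[of _ _ 0])
    then show ?thesis by blast
  qed
  ultimately have "?U \<inter> ?I = ?U" unfolding connected_clopen by blast
  then show ?thesis by blast
qed (auto simp: ball_empty)

text \<open>
  The derivative at 0 is a Cauchy integral over the circle of radius 1/2, to which dominated
  convergence applies; no locally uniform convergence has to be known beforehand.
\<close>

lemma deriv_tendsto_0_of_bounded_pointwise:
  fixes p :: "nat \<Rightarrow> complex \<Rightarrow> complex"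
  assumes hol: "\<And>m. p m holomorphic_on ball 0 1"
    and bd: "\<And>m t. t \<in> ball 0 1 \<Longrightarrow> norm (p m t) \<le> B"
    and lim: "\<And>t. t \<in> ball 0 1 \<Longrightarrow> (\<lambda>m. p m t) \<longlonglongrightarrow> 0"
  shows "(\<lambda>m. deriv (p m) 0) \<longlonglongrightarrow> 0"
proof -
  let ?c = "circlepath 0 (1/2)"
  let ?F = "\<lambda>m u. p m (?c u) / (?c u)^2 * vector_derivative ?c (at u)"
  have nc: "norm (?c u) = 1/2" for u by (simp add: circlepath norm_mult norm_divide)
  have hol': "p m holomorphic_on ball 0 (1/2)" "continuous_on (cball 0 (1/2)) (p m)" for m
    using hol[of m] by (auto intro: holomorphic_on_subset continuous_on_subset holomorphic_on_imp_continuous_on)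
  have 1: "(\<lambda>u. p m u / (u - 0)^2) contour_integrable_on ?c"
    "(p m has_field_derivative (1 / (2 * of_real pi * \<i>) * contour_integral ?c (\<lambda>u. p m u / (u - 0)^2))) (at 0)" for m
    by (rule Cauchy_derivative_integral_circlepath[OF hol'(2,1)]; simp)+
  have "(\<lambda>m. integral {0..1} (?F m)) \<longlonglongrightarrow> integral {0..1::real} (\<lambda>u. 0::complex)"
  proof (rule dominated_convergence(2)[where f = ?F and g = "\<lambda>u. 0" and h = "\<lambda>u. B * 4 * pi"])
    show "?F m integrable_on {0..1}" for m
      using 1(1)[of m] by (simp add: contour_integrable_on)
    show "norm (?F m u) \<le> B * 4 * pi" if "u \<in> {0..1}" for m u
    proof -
      have "norm (vector_derivative ?c (at u)) = pi"
        by (simp add: vector_derivative_circlepath norm_mult)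
      moreover have "norm (p m (?c u)) \<le> B" by (rule bd) (simp add: nc)
      ultimately show ?thesis by (simp add: norm_mult norm_divide norm_power nc power2_eq_square)
    qed
    show "(\<lambda>m. ?F m u) \<longlonglongrightarrow> 0" if "u \<in> {0..1}" for u
      by (intro tendsto_mult_left_zero tendsto_divide_zero lim) (simp add: nc)
  qed (intro integrable_continuous_interval continuous_intros)
  then have "(\<lambda>m. 1 / (2 * of_real pi * \<i>) * contour_integral ?c (\<lambda>u. p m u / (u - 0)^2)) \<longlonglongrightarrow> 0"
    by (intro tendsto_mult_right_zero) (simp add: contour_integral_integral)
  then show ?thesis using DERIV_imp_deriv[OF 1(2)] by simp
qed

text \<open>
  Completeness provides the derivative, so no candidate for it is needed.
\<close>

lemma complex_derivative_Cauchy_criterion: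
  fixes q :: "complex \<Rightarrow> complex ^ 'n"
  assumes "\<And>e. e > 0 \<Longrightarrow> \<exists>\<delta>>0. \<forall>s s'. 0 < norm s \<and> norm s < \<delta> \<and> 0 < norm s' \<and> norm s' < \<delta> \<longrightarrow>
     norm (inverse s *s (q (t + s) - q t) - inverse s' *s (q (t + s') - q t)) < e"
  obtains w where "(q has_derivative (\<lambda>s. s *s w)) (at t)"
    and "((\<lambda>s. inverse s *s (q (t + s) - q t)) \<longlongrightarrow> w) (at 0)"
proof -
  let ?d = "\<lambda>s. inverse s *s (q (t + s) - q t)"
  have "cauchy_filter (filtermap ?d (at 0))"
    unfolding cauchy_filter_metric_filtermap
  proof (intro allI impI)
    fix e :: real assume "e > 0"
    from assms[OF this] obtain \<delta> where "\<delta> > 0" "\<forall>s s'. 0 < norm s \<and> norm s < \<delta> \<and> 0 < norm s' \<and> norm s' < \<delta> \<longrightarrow>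
     norm (?d s - ?d s') < e" by blast
    then show "\<exists>P. eventually P (at 0) \<and> (\<forall>s s'. P s \<and> P s' \<longrightarrow> dist (?d s) (?d s') < e)"
      by (intro exI[of _ "\<lambda>s. s \<noteq> 0 \<and> norm s < \<delta>"]) (auto simp: dist_norm eventually_at)
  qed
  moreover have "complete (UNIV :: (complex ^ 'n) set)"
    by (simp add: complete_eq_closed)
  ultimately obtain w where w: "(?d \<longlongrightarrow> w) (at 0)"
    using cauchy_filter_complete_converges[of "filtermap ?d (at 0)" UNIV]
    by (auto simp: filterlim_def filtermap_bot_iff)
  have "(\<lambda>s. norm (q (t + s) - q t - s *s w) / norm s) \<midarrow>0\<rightarrow> 0"
  proof (rule Lim_transform_eventually)
    show "((\<lambda>s. norm (?d s - w)) \<longlongrightarrow> 0) (at 0)" using w by (simp add: LIM_zero tendsto_norm_zero)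
    show "\<forall>\<^sub>F s in at 0. norm (?d s - w) = norm (q (t + s) - q t - s *s w) / norm s"
    proof (rule eventually_mono[OF eventually_neq_at_within[of 0]])
      fix s :: complex assume "s \<noteq> 0"
      then have "?d s - w = inverse s *s (q (t + s) - q t - s *s w)"
        by (simp add: vec_eq_iff field_simps)
      then show "norm (?d s - w) = norm (q (t + s) - q t - s *s w) / norm s"
        by (simp only: norm_vector_smult norm_inverse divide_inverse mult.commute)
    qed
  qed
  then show ?thesis
    by (intro that[OF _ w]) (simp add: has_derivative_at bounded_linear_vector_smult)
qed

section \<open>Continuous families of embedded discs\<close>

lemma subspace_coord_space: "subspace (coord_space J)"
  by (auto simp: subspace_def coord_space_def)

text \<open>
  The derivative of a map on the polydisc carries information on \<^const>\<open>coord_space\<close> only. Precomposing it with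
  this projection gives a linear map on the whole space whose norm can be controlled.
\<close>

definition coord_proj :: "'n set \<Rightarrow> complex ^ 'n \<Rightarrow> complex ^ 'n" where
  "coord_proj J z = (\<chi> i. if i \<in> J then z $ i else 0)"

lemma linear_coord_proj: "linear (coord_proj J)"
  by (rule linearI) (auto simp: coord_proj_def vec_eq_iff)

lemma coord_proj_in: "coord_proj J z \<in> coord_space J"
  by (simp add: coord_proj_def coord_space_def)

lemma coord_proj_id: "z \<in> coord_space J \<Longrightarrow> coord_proj J z = z"
  by (auto simp: coord_proj_def coord_space_def vec_eq_iff)

lemma polydisc_subset_coord_space: "polydisc J r \<subseteq> coord_space J"
  by (auto simp: polydisc_def)

lemma polydisc_mono: "r \<le> s \<Longrightarrow> polydisc J r \<subseteq> polydisc J s"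
  by (force simp: polydisc_def)

lemma norm_less_imp_polydisc: "z \<in> coord_space J \<Longrightarrow> norm z < r \<Longrightarrow> z \<in> polydisc J r"
  unfolding polydisc_def using Finite_Cartesian_Product.norm_nth_le[of z] le_less_trans by blast

lemma zero_in_polydisc: "r > 0 \<Longrightarrow> 0 \<in> polydisc J r"
  by (simp add: norm_less_imp_polydisc subspace_coord_space subspace_0)

lemma norm_le_of_polydisc:
  assumes "z \<in> polydisc J r" "r > 0"
  shows "norm (z :: complex ^ 'n) \<le> real CARD('n) * r"
proof -
  have "norm z \<le> (\<Sum>i\<in>UNIV. norm (z $ i))"
    unfolding norm_vec_def by (rule L2_set_le_sum) simp
  also have "\<dots> \<le> real CARD('n) * r"
  proof (rule sum_bounded_above)
    show "norm (z $ i) \<le> r" for i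
      using assms by (cases "i \<in> J") (auto simp: polydisc_def coord_space_def intro: less_imp_le)
  qed
  finally show ?thesis .
qed

lemma convex_polydisc:
  fixes J :: "('n::finite) set"
  shows "convex (polydisc J r)"
proof -
  have "polydisc J r = coord_space J \<inter> (\<Inter>i\<in>J. (\<lambda>z. z $ i) -` ball 0 r)"
    by (auto simp: polydisc_def)
  moreover have "convex ((\<lambda>z :: complex ^ 'n. z $ i) -` ball 0 r)" for i :: 'n
    by (intro convex_linear_vimage bounded_linear.linear bounded_linear_vec_nth) simp
  ultimately show ?thesis
    using subspace_imp_convex[OF subspace_coord_space] by (auto intro!: convex_Int convex_INT)
qed

text \<open>
  Reduces operator norms on \<^const>\<open>coord_space\<close> to finitely many vectors. \<^const>\<open>C1_embedding\<close> gives
  continuity of the derivative vector by vector, and this lemma makes it continuity in norm.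
\<close>

lemma norm_le_sum_on_coord_space:
  fixes A :: "complex ^ 'n \<Rightarrow> complex ^ 'n"
  assumes A: "linear A" and v: "v \<in> coord_space J"
  shows "norm (A v) \<le> (\<Sum>b\<in>Basis. norm (A (coord_proj J b))) * norm v"
proof -
  have "v = coord_proj J (\<Sum>b\<in>Basis. (v \<bullet> b) *\<^sub>R b)"
    by (simp add: euclidean_representation coord_proj_id[OF v])
  also have "\<dots> = (\<Sum>b\<in>Basis. (v \<bullet> b) *\<^sub>R coord_proj J b)"
    by (simp add: linear_sum[OF linear_coord_proj] linear_cmul[OF linear_coord_proj])
  finally have "A v = A (\<Sum>b\<in>Basis. (v \<bullet> b) *\<^sub>R coord_proj J b)" by simp
  also have "\<dots> = (\<Sum>b\<in>Basis. (v \<bullet> b) *\<^sub>R A (coord_proj J b))"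
    by (simp add: linear_sum[OF A] linear_cmul[OF A])
  also have "norm \<dots> \<le> (\<Sum>b\<in>Basis. norm v * norm (A (coord_proj J b)))"
    by (rule sum_norm_le) (simp add: Basis_le_norm mult_right_mono)
  finally show ?thesis by (simp add: sum_distrib_left mult.commute)
qed

locale leaf_family =
  fixes \<Lambda> :: "(complex ^ 'n) set" and J :: "('n::finite) set"
    and \<phi> :: "complex ^ 'n \<Rightarrow> complex ^ 'n \<Rightarrow> complex ^ 'n"
  assumes compact_base: "compact \<Lambda>"
    and embedding: "x \<in> \<Lambda> \<Longrightarrow> C1_embedding J (\<phi> x)"
    and centre: "x \<in> \<Lambda> \<Longrightarrow> \<phi> x 0 = x"
    and C1_continuous: "C1_continuous_on \<Lambda> J \<phi>"
begin

abbreviation leaf_tangent :: "complex ^ 'n \<Rightarrow> complex ^ 'n \<Rightarrow> complex ^ 'n" where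
  "leaf_tangent x \<equiv> disc_derivative J (\<phi> x) 0"

lemma leaf_map_has_derivative:
  assumes "x \<in> \<Lambda>" "z \<in> polydisc J 1"
  shows "(\<phi> x has_derivative disc_derivative J (\<phi> x) z) (at z within polydisc J 1)"
proof -
  have "\<phi> x differentiable (at z within polydisc J 1)"
    using embedding[OF assms(1)] assms(2) unfolding C1_embedding_def by blast
  then show ?thesis unfolding disc_derivative_def by (rule frechet_derivative_works[THEN iffD1])
qed

lemma linear_disc_derivative:
  assumes "x \<in> \<Lambda>" "z \<in> polydisc J 1"
  shows "linear (disc_derivative J (\<phi> x) z)"
  using leaf_map_has_derivative[OF assms] by (rule has_derivative_linear)

lemma linear_leaf_tangent: "x \<in> \<Lambda> \<Longrightarrow> linear (leaf_tangent x)"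
  by (simp add: linear_disc_derivative zero_in_polydisc)

lemma leaf_map_homeomorphism:
  assumes "x \<in> \<Lambda>"
  shows "\<exists>g. homeomorphism (polydisc J 1) (\<phi> x ` polydisc J 1) (\<phi> x) g"
  using embedding[OF assms] unfolding C1_embedding_def by (elim conjE)

lemma inj_leaf_map:
  assumes "x \<in> \<Lambda>"
  shows "inj_on (\<phi> x) (polydisc J 1)"
proof -
  obtain g where "homeomorphism (polydisc J 1) (\<phi> x ` polydisc J 1) (\<phi> x) g"
    using leaf_map_homeomorphism[OF assms] by blast
  then show ?thesis by (intro inj_on_inverseI[of _ g]) (rule homeomorphism_apply1)
qed

lemma leaf_map_nearby:
  assumes x: "x \<in> \<Lambda>" and K: "compact K" "K \<subseteq> polydisc J 1" and e: "e > 0"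
  obtains \<delta> where "\<delta> > 0" "\<And>y z. y \<in> \<Lambda> \<Longrightarrow> dist y x < \<delta> \<Longrightarrow> z \<in> K \<Longrightarrow>
      dist (\<phi> y z) (\<phi> x z) < e \<and>
      (\<forall>v\<in>coord_space J. norm (disc_derivative J (\<phi> y) z v - disc_derivative J (\<phi> x) z v) \<le> e * norm v)"
proof -
  from C1_continuous x K e have "\<exists>\<delta>>0. \<forall>y\<in>\<Lambda>. dist y x < \<delta> \<longrightarrow>
      (\<forall>z\<in>K. dist (\<phi> y z) (\<phi> x z) < e \<and>
        opnorm_on (\<lambda>v. disc_derivative J (\<phi> y) z v - disc_derivative J (\<phi> x) z v) (coord_space J) < e)"
    unfolding C1_continuous_on_def by blast
  then obtain \<delta> where \<delta>: "\<delta> > 0" "\<And>y z. y \<in> \<Lambda> \<Longrightarrow> dist y x < \<delta> \<Longrightarrow> z \<in> K \<Longrightarrow> dist (\<phi> y z) (\<phi> x z) < e \<and>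
        opnorm_on (\<lambda>v. disc_derivative J (\<phi> y) z v - disc_derivative J (\<phi> x) z v) (coord_space J) < e"
    by blast
  show ?thesis
  proof (rule that[OF \<delta>(1)])
    fix y z assume yz: "y \<in> \<Lambda>" "dist y x < \<delta>" "z \<in> K"
    let ?A = "\<lambda>v. disc_derivative J (\<phi> y) z v - disc_derivative J (\<phi> x) z v"
    have "z \<in> polydisc J 1" using K(2) yz(3) by blast
    then have lin: "linear ?A"
      using x yz(1) by (intro linear_compose_sub linear_disc_derivative)
    have "norm (?A v) \<le> e * norm v" if v: "v \<in> coord_space J" for v
    proof -
      have "norm (?A v) \<le> opnorm_on ?A (coord_space J) * norm v"
        by (rule norm_le_opnorm_on[OF lin subspace_coord_space v])
      also have "\<dots> \<le> e * norm v" using \<delta>(2)[OF yz] by (intro mult_right_mono) auto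
      finally show ?thesis .
    qed
    then show "dist (\<phi> y z) (\<phi> x z) < e \<and> (\<forall>v\<in>coord_space J. norm (?A v) \<le> e * norm v)"
      using \<delta>(2)[OF yz] by blast
  qed
qed

lemma leaf_map_jointly_continuous:
  assumes K: "compact K" "K \<subseteq> polydisc J 1"
  shows "continuous_on (\<Lambda> \<times> K) (\<lambda>(x, z). \<phi> x z)"
  unfolding continuous_on_iff
proof (intro ballI allI impI)
  fix q and e :: real assume q: "q \<in> \<Lambda> \<times> K" and e: "e > 0"
  obtain x z where xz: "q = (x, z)" "x \<in> \<Lambda>" "z \<in> K" using q by blast
  have "e / 2 > 0" using e by simp
  from leaf_map_nearby[OF xz(2) K this] obtain \<delta> where \<delta>: "\<delta> > 0"
    "\<And>y z. y \<in> \<Lambda> \<Longrightarrow> dist y x < \<delta> \<Longrightarrow> z \<in> K \<Longrightarrow> dist (\<phi> y z) (\<phi> x z) < e / 2" by metis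
  have "continuous_on K (\<phi> x)"
    using leaf_map_homeomorphism[OF xz(2)] K(2) homeomorphism_cont1 continuous_on_subset by blast
  then obtain \<delta>' where \<delta>': "\<delta>' > 0" "\<And>z'. z' \<in> K \<Longrightarrow> dist z' z < \<delta>' \<Longrightarrow> dist (\<phi> x z') (\<phi> x z) < e / 2"
    using xz(3) \<open>e / 2 > 0\<close> unfolding continuous_on_iff by blast
  show "\<exists>d>0. \<forall>q'\<in>\<Lambda> \<times> K. dist q' q < d \<longrightarrow> dist (case q' of (x, z) \<Rightarrow> \<phi> x z) (case q of (x, z) \<Rightarrow> \<phi> x z) < e"
  proof (intro exI[of _ "min \<delta> \<delta>'"] conjI ballI impI)
    fix q' assume "q' \<in> \<Lambda> \<times> K" and d: "dist q' q < min \<delta> \<delta>'"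
    then obtain y z' where yz: "q' = (y, z')" "y \<in> \<Lambda>" "z' \<in> K" by blast
    have "dist y x < \<delta>" "dist z' z < \<delta>'"
      using d dist_fst_le[of q' q] dist_snd_le[of q' q] by (auto simp: yz(1) xz(1))
    then have "dist (\<phi> y z') (\<phi> x z') < e / 2" "dist (\<phi> x z') (\<phi> x z) < e / 2"
      using \<delta>(2) \<delta>'(2) yz by blast+
    then show "dist (case q' of (x, z) \<Rightarrow> \<phi> x z) (case q of (x, z) \<Rightarrow> \<phi> x z) < e"
      using dist_triangle[of "\<phi> y z'" "\<phi> x z" "\<phi> x z'"] by (simp add: yz(1) xz(1))
  qed (use \<delta> \<delta>' in simp)
qed

lemma leaf_tangent_nearby:
  assumes x: "x \<in> \<Lambda>" and e: "e > 0"
  obtains \<delta> where "\<delta> > 0" "\<And>y v. y \<in> \<Lambda> \<Longrightarrow> dist y x < \<delta> \<Longrightarrow> v \<in> coord_space J \<Longrightarrow>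
      norm (leaf_tangent y v - leaf_tangent x v) \<le> e * norm v"
proof -
  have 0: "{0} \<subseteq> polydisc J 1" by (simp add: zero_in_polydisc)
  show ?thesis
  proof (rule leaf_map_nearby[OF x compact_sing 0 e])
    fix \<delta> assume "\<delta> > 0" and "\<And>y z. y \<in> \<Lambda> \<Longrightarrow> dist y x < \<delta> \<Longrightarrow> z \<in> {0} \<Longrightarrow>
      dist (\<phi> y z) (\<phi> x z) < e \<and>
      (\<forall>v\<in>coord_space J. norm (disc_derivative J (\<phi> y) z v - disc_derivative J (\<phi> x) z v) \<le> e * norm v)"
    then show ?thesis by (intro that[of \<delta>]) auto
  qed
qed

text \<open>
  At one centre this is injectivity of the derivative in finite dimension; the bounds persist at nearby
  centres, and compactness does the rest.
\<close>

lemma leaf_tangent_bounds: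
  obtains \<alpha> \<beta> where "\<alpha> > 0" "\<beta> > 0"
    "\<And>x v. x \<in> \<Lambda> \<Longrightarrow> v \<in> coord_space J \<Longrightarrow> \<alpha> * norm v \<le> norm (leaf_tangent x v)"
    "\<And>x v. x \<in> \<Lambda> \<Longrightarrow> v \<in> coord_space J \<Longrightarrow> norm (leaf_tangent x v) \<le> \<beta> * norm v"
proof -
  let ?S = "coord_space J"
  define P where "P x r \<longleftrightarrow> (\<forall>v\<in>?S. r * norm v \<le> norm (leaf_tangent x v) \<and> r * norm (leaf_tangent x v) \<le> norm v)" for x r
  have "\<exists>r::real. r > 0 \<and> (\<forall>x\<in>\<Lambda>. P x r)"
  proof (rule compact_uniform_radius[OF compact_base, of P])
    fix p assume p: "p \<in> \<Lambda>"
    have lin: "linear (leaf_tangent p)" by (rule linear_leaf_tangent[OF p])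
    have "inj_on (leaf_tangent p) ?S"
      using embedding[OF p] zero_in_polydisc[of 1 J] unfolding C1_embedding_def by auto
    then have "\<forall>v\<in>?S. leaf_tangent p v = 0 \<longrightarrow> v = 0"
      using inj_onD[of "leaf_tangent p" ?S _ 0] linear_0[OF lin] subspace_0[OF subspace_coord_space[of J]] by auto
    then obtain a where a: "a > 0" "\<forall>v\<in>?S. norm (leaf_tangent p v) \<ge> a * norm v"
      using injective_imp_isometric[OF closed_subspace[OF subspace_coord_space] subspace_coord_space
          linear_conv_bounded_linear[THEN iffD1, OF lin]] by blast
    obtain b where b: "b > 0" "\<And>v. norm (leaf_tangent p v) \<le> b * norm v"
      using linear_bounded_pos[OF lin] by blast
    have "a / 2 > 0" using a by simp
    from leaf_tangent_nearby[OF p this] obtain \<delta> where \<delta>: "\<delta> > 0" "\<And>y v. y \<in> \<Lambda> \<Longrightarrow> dist y p < \<delta> \<Longrightarrow> v \<in> ?S \<Longrightarrow>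
      norm (leaf_tangent y v - leaf_tangent p v) \<le> a / 2 * norm v" by metis
    let ?r = "min (a / 2) (1 / (b + a))"
    have "P y ?r" if y: "y \<in> \<Lambda>" "dist y p < \<delta>" for y
      unfolding P_def
    proof (intro ballI conjI)
      fix v assume v: "v \<in> ?S"
      have close: "norm (leaf_tangent y v - leaf_tangent p v) \<le> a / 2 * norm v" by (rule \<delta>(2)[OF y v])
      have "norm (leaf_tangent p v) \<le> norm (leaf_tangent y v) + norm (leaf_tangent y v - leaf_tangent p v)"
        by (metis norm_minus_commute norm_triangle_sub)
      then have "a / 2 * norm v \<le> norm (leaf_tangent y v)" using close a(2) v by fastforce
      then show "?r * norm v \<le> norm (leaf_tangent y v)"
        by (meson dual_order.trans min.cobounded1 mult_right_mono norm_ge_zero)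
      have "norm (leaf_tangent y v) \<le> norm (leaf_tangent p v) + norm (leaf_tangent y v - leaf_tangent p v)"
        by (rule norm_triangle_sub)
      also have "\<dots> \<le> b * norm v + a / 2 * norm v" using close b(2)[of v] by linarith
      also have "\<dots> \<le> (b + a) * norm v" using a(1) by (simp add: algebra_simps)
      finally have le: "norm (leaf_tangent y v) \<le> (b + a) * norm v" .
      have "?r * norm (leaf_tangent y v) \<le> 1 / (b + a) * norm (leaf_tangent y v)"
        by (intro mult_right_mono) auto
      also have "\<dots> \<le> norm v" using le a(1) b(1) by (simp add: field_simps)
      finally show "?r * norm (leaf_tangent y v) \<le> norm v" .
    qed
    moreover have "?r > 0" using a(1) b(1) by simp
    ultimately show "\<exists>\<delta>>0. \<exists>r>0. \<forall>y\<in>\<Lambda>. dist y p < \<delta> \<longrightarrow> P y r" using \<delta>(1) by blast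
  next
    fix y r s :: real and x assume "P x r" "0 < s" "s \<le> r"
    then show "P x s" unfolding P_def by (meson mult_right_mono norm_ge_zero order_trans)
  qed
  then obtain r where r: "r > 0" "\<And>x. x \<in> \<Lambda> \<Longrightarrow> P x r" by blast
  show ?thesis
  proof (rule that[of r "1 / r"])
    fix x v assume "x \<in> \<Lambda>" "v \<in> ?S"
    then show "r * norm v \<le> norm (leaf_tangent x v)" "norm (leaf_tangent x v) \<le> 1 / r * norm v"
      using r unfolding P_def by (auto simp: field_simps)
  qed (use r in auto)
qed

lemma leaf_derivative_near_centre:
  assumes \<kappa>: "\<kappa> > 0"
  obtains r where "0 < r" "\<And>x z v. x \<in> \<Lambda> \<Longrightarrow> z \<in> coord_space J \<Longrightarrow> norm z \<le> r \<Longrightarrow> z \<in> polydisc J 1 \<Longrightarrow> v \<in> coord_space J \<Longrightarrow>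
     norm (disc_derivative J (\<phi> x) z v - leaf_tangent x v) \<le> \<kappa> * norm v"
proof -
  let ?S = "coord_space J" and ?D = "\<lambda>x. disc_derivative J (\<phi> x)"
  define P where "P x r \<longleftrightarrow> (\<forall>z\<in>?S \<inter> polydisc J 1. norm z \<le> r \<longrightarrow> (\<forall>v\<in>?S. norm (?D x z v - leaf_tangent x v) \<le> \<kappa> * norm v))" for x r
  have "\<exists>r::real. r > 0 \<and> (\<forall>x\<in>\<Lambda>. P x r)"
  proof (rule compact_uniform_radius[OF compact_base, of P])
    fix p assume p: "p \<in> \<Lambda>"
    have 0: "0 \<in> polydisc J 1" by (simp add: zero_in_polydisc)
    have "\<kappa> / 3 > 0" using \<kappa> by simp
    let ?N = "\<lambda>z. \<Sum>b\<in>Basis. norm (?D p z (coord_proj J b) - leaf_tangent p (coord_proj J b))"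
    have "continuous_on (polydisc J 1) ?N"
      using embedding[OF p] coord_proj_in unfolding C1_embedding_def
      by (intro continuous_intros) blast+
    then obtain s where s: "s > 0" "\<And>z. z \<in> polydisc J 1 \<Longrightarrow> dist z 0 < s \<Longrightarrow> dist (?N z) (?N 0) < \<kappa> / 3"
      using 0 \<open>\<kappa> / 3 > 0\<close> unfolding continuous_on_iff by blast
    have near: "norm (?D p z v - leaf_tangent p v) \<le> \<kappa> / 3 * norm v"
      if z: "z \<in> polydisc J 1" "norm z < s" and v: "v \<in> ?S" for z v
    proof -
      have lin: "linear (\<lambda>v. ?D p z v - leaf_tangent p v)"
        using p z 0 by (intro linear_compose_sub linear_disc_derivative)
      have "norm (?D p z v - leaf_tangent p v) \<le> ?N z * norm v"
        by (rule norm_le_sum_on_coord_space[OF lin v])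
      moreover have "?N z \<le> \<kappa> / 3" using s(2)[of z] z by (simp add: dist_norm)
      ultimately show ?thesis by (meson mult_right_mono norm_ge_zero order_trans)
    qed
    let ?K = "?S \<inter> cball 0 (1 / 2)"
    have K: "compact ?K" "?K \<subseteq> polydisc J 1"
      by (auto intro!: closed_Int_compact closed_subspace subspace_coord_space norm_less_imp_polydisc)
    from leaf_map_nearby[OF p K \<open>\<kappa> / 3 > 0\<close>] obtain \<delta> where \<delta>: "\<delta> > 0"
      "\<And>y z v. y \<in> \<Lambda> \<Longrightarrow> dist y p < \<delta> \<Longrightarrow> z \<in> ?K \<Longrightarrow> v \<in> ?S \<Longrightarrow> norm (?D y z v - ?D p z v) \<le> \<kappa> / 3 * norm v"
      by metis
    let ?r = "min (s / 2) (1 / 2)"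
    have "P y ?r" if y: "y \<in> \<Lambda>" "dist y p < \<delta>" for y
      unfolding P_def
    proof (intro ballI impI)
      fix z v assume z: "z \<in> ?S \<inter> polydisc J 1" "norm z \<le> ?r" and v: "v \<in> ?S"
      have "z \<in> ?K" "0 \<in> ?K" using z subspace_0[OF subspace_coord_space[of J]] by auto
      then have "norm (?D y z v - ?D p z v) \<le> \<kappa> / 3 * norm v" "norm (?D y 0 v - ?D p 0 v) \<le> \<kappa> / 3 * norm v"
        using \<delta>(2)[OF y _ v] by blast+
      moreover have "norm (?D p z v - leaf_tangent p v) \<le> \<kappa> / 3 * norm v"
        using z s(1) by (intro near v) auto
      moreover have "?D y z v - leaf_tangent y v =
          (?D y z v - ?D p z v) + (?D p z v - leaf_tangent p v) - (?D y 0 v - ?D p 0 v)" by simp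
      ultimately show "norm (?D y z v - leaf_tangent y v) \<le> \<kappa> * norm v"
        using norm_triangle_ineq[of "?D y z v - ?D p z v" "?D p z v - leaf_tangent p v"]
          norm_triangle_ineq4[of "(?D y z v - ?D p z v) + (?D p z v - leaf_tangent p v)" "?D y 0 v - ?D p 0 v"]
        by (simp add: field_simps)
    qed
    moreover have "?r > 0" using s(1) by simp
    ultimately show "\<exists>\<delta>>0. \<exists>r>0. \<forall>y\<in>\<Lambda>. dist y p < \<delta> \<longrightarrow> P y r" using \<delta>(1) by blast
  next
    fix y r s :: real and x assume "P x r" "0 < s" "s \<le> r"
    then show "P x s" unfolding P_def by (meson order_trans)
  qed
  then obtain r where "r > 0" "\<And>x. x \<in> \<Lambda> \<Longrightarrow> P x r" by blast
  then show ?thesis using that[of r] unfolding P_def by blast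
qed

text \<open>
  The one quantitative fact about leaves on which all later estimates rest. It is the mean value
  inequality on the convex polydisc, where the derivative of \<open>\<phi> x\<close> is uniformly close to its value at 0.
\<close>

lemma leaf_map_uniform_linearisation:
  assumes \<kappa>: "\<kappa> > 0"
  obtains r where "0 < r" "r \<le> 1"
    "\<And>x z z'. x \<in> \<Lambda> \<Longrightarrow> z \<in> polydisc J r \<Longrightarrow> z' \<in> polydisc J r \<Longrightarrow>
       norm (\<phi> x z - \<phi> x z' - leaf_tangent x (z - z')) \<le> \<kappa> * norm (z - z')"
proof -
  let ?D = "\<lambda>x. disc_derivative J (\<phi> x)"
  obtain r' where r': "r' > 0" "\<And>x z v. x \<in> \<Lambda> \<Longrightarrow> z \<in> coord_space J \<Longrightarrow> norm z \<le> r' \<Longrightarrow> z \<in> polydisc J 1 \<Longrightarrow> v \<in> coord_space J \<Longrightarrow>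
     norm (?D x z v - leaf_tangent x v) \<le> \<kappa> * norm v"
    using leaf_derivative_near_centre[OF \<kappa>] by metis
  define r where "r = min 1 (r' / real CARD('n))"
  have r: "0 < r" "r \<le> 1" using r'(1) by (auto simp: r_def)
  show ?thesis
  proof (rule that[OF r])
    fix x z z' assume x: "x \<in> \<Lambda>" and z: "z \<in> polydisc J r" "z' \<in> polydisc J r"
    have sub: "polydisc J r \<subseteq> polydisc J 1" using r by (intro polydisc_mono)
    let ?h = "\<lambda>z. \<phi> x z - leaf_tangent x z"
    have "norm (?h z - ?h z') \<le> \<kappa> * norm (z - z')"
    proof (rule differentiable_bound[OF convex_polydisc[of J r], of ?h
            "\<lambda>y v. ?D x y (coord_proj J v) - leaf_tangent x (coord_proj J v)"])
      fix y assume y: "y \<in> polydisc J r"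
      have y1: "y \<in> polydisc J 1" using y sub by blast
      have "((\<lambda>z. \<phi> x z - leaf_tangent x z) has_derivative (\<lambda>v. ?D x y v - leaf_tangent x v)) (at y within polydisc J 1)"
        by (intro has_derivative_diff leaf_map_has_derivative x y1
            bounded_linear_imp_has_derivative linear_conv_bounded_linear[THEN iffD1] linear_leaf_tangent)
      then have "(?h has_derivative (\<lambda>v. ?D x y v - leaf_tangent x v)) (at y within polydisc J r)"
        by (rule has_derivative_subset[OF _ sub])
      moreover have lin: "linear (\<lambda>v. ?D x y v - leaf_tangent x v)"
        by (intro linear_compose_sub linear_disc_derivative linear_leaf_tangent x y1)
      have "bounded_linear (\<lambda>v. ?D x y (coord_proj J v) - leaf_tangent x (coord_proj J v))"
        using linear_compose[OF linear_coord_proj lin] by (simp add: linear_conv_bounded_linear o_def)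
      moreover have "coord_proj J (w - y) = w - y" if "w \<in> polydisc J r" for w
        using that y polydisc_subset_coord_space[of J r] subspace_coord_space
        by (intro coord_proj_id subspace_diff) auto
      ultimately show "(?h has_derivative (\<lambda>v. ?D x y (coord_proj J v) - leaf_tangent x (coord_proj J v)))
          (at y within polydisc J r)"
        by (simp add: has_derivative_within_alt)
      have "norm y \<le> r'"
      proof -
        have "norm y \<le> real CARD('n) * r" by (rule norm_le_of_polydisc[OF y r(1)])
        also have "\<dots> \<le> r'" using r'(1) by (simp add: r_def min_def field_simps)
        finally show ?thesis .
      qed
      have "norm (?D x y (coord_proj J v) - leaf_tangent x (coord_proj J v)) \<le> \<kappa> * norm v" for v
      proof -
        have "norm (?D x y (coord_proj J v) - leaf_tangent x (coord_proj J v)) \<le> \<kappa> * norm (coord_proj J v)"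
          using y polydisc_subset_coord_space[of J r]
          by (intro r'(2) x y1 coord_proj_in \<open>norm y \<le> r'\<close>) auto
        also have "norm (coord_proj J v) \<le> norm v"
          unfolding norm_vec_def by (rule L2_set_mono) (auto simp: coord_proj_def)
        finally show ?thesis using \<kappa> by simp
      qed
      then show "onorm (\<lambda>v. ?D x y (coord_proj J v) - leaf_tangent x (coord_proj J v)) \<le> \<kappa>"
        using \<kappa> by (intro onorm_le) auto
    qed (use z in auto)
    then show "norm (\<phi> x z - \<phi> x z' - leaf_tangent x (z - z')) \<le> \<kappa> * norm (z - z')"
      by (simp add: linear_diff[OF linear_leaf_tangent[OF x]] algebra_simps)
  qed
qed

end

section \<open>Partially hyperbolic sets\<close>

lemma eq_0_if_norm_le_geometric:
  assumes "\<And>m. norm a \<le> c * r ^ m" "0 \<le> r" "r < (1::real)"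
  shows "a = 0"
proof -
  have "(\<lambda>m. c * r ^ m) \<longlonglongrightarrow> c * 0"
    using assms by (intro tendsto_mult LIMSEQ_realpow_zero tendsto_const)
  then have "norm a \<le> c * 0" by (rule LIMSEQ_le_const) (use assms(1) in blast)
  then show ?thesis by simp
qed

text \<open>
  The rates are parameters, so that all lemmas speak of the same constants.
\<close>

locale partially_hyperbolic_set =
  fixes f :: "complex ^ 'n \<Rightarrow> complex ^ 'n"
    and \<Lambda> :: "(complex ^ 'n) set"
    and E F :: "complex ^ 'n \<Rightarrow> (complex ^ 'n) set"
    and \<nu> \<mu> C :: real
  assumes biholomorphism: "biholomorphism f"
    and compact_set: "compact \<Lambda>"
    and invariant: "f ` \<Lambda> = \<Lambda>"
    and splitting: "invariant_splitting f \<Lambda> E F"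
    and rates: "0 < \<nu>" "\<nu> < \<mu>" "\<nu> < 1" "C > 0"
    and opnorm_E: "x \<in> \<Lambda> \<Longrightarrow> opnorm_on (frechet_derivative (f ^^ m) (at x)) (E x) \<le> C * \<nu> ^ m"
    and opnorm_F: "x \<in> \<Lambda> \<Longrightarrow> opnorm_on (frechet_derivative (inv f ^^ m) (at x)) (F x) \<le> C / \<mu> ^ m"
begin

abbreviation D :: "nat \<Rightarrow> complex ^ 'n \<Rightarrow> complex ^ 'n \<Rightarrow> complex ^ 'n" where
  "D m x \<equiv> frechet_derivative (f ^^ m) (at x)"

abbreviation G :: "nat \<Rightarrow> complex ^ 'n \<Rightarrow> complex ^ 'n \<Rightarrow> complex ^ 'n" where
  "G m x \<equiv> frechet_derivative (inv f ^^ m) (at x)"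

lemma bij_f: "bij f"
  and holomorphic_iterate: "holomorphic_map (f ^^ m)"
  and holomorphic_inverse_iterate: "holomorphic_map (inv f ^^ m)"
  using biholomorphism by (simp_all add: biholomorphism_def holomorphic_map_funpow)

lemma iterate_cancel:
  "(f ^^ m) ((inv f ^^ m) x) = x" "(inv f ^^ m) ((f ^^ m) x) = x"
  using bij_fn[OF bij_f, of m] by (simp_all add: inv_fn[OF bij_f, symmetric] bij_is_surj surj_f_inv_f bij_is_inj)

lemma iterate_in_set: "x \<in> \<Lambda> \<Longrightarrow> (f ^^ m) x \<in> \<Lambda>"
  using invariant by (induction m) auto

lemma inverse_iterate_in_set: "x \<in> \<Lambda> \<Longrightarrow> (inv f ^^ m) x \<in> \<Lambda>"
proof (induction m)
  case (Suc m)
  then obtain y where "y \<in> \<Lambda>" "(inv f ^^ m) x = f y" using invariant by blast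
  then show ?case using bij_f by (simp add: bij_is_inj)
qed simp

lemma linear_D: "linear (D m x)" and linear_G: "linear (G m x)"
  using has_derivative_linear holomorphic_map_has_derivative holomorphic_iterate holomorphic_inverse_iterate
  by blast+

lemma G_add: "G (m + n) x v = G m ((inv f ^^ n) x) (G n x v)"
  by (simp only: funpow_add holomorphic_map_compose(2)[OF holomorphic_inverse_iterate holomorphic_inverse_iterate])

lemma D_add: "D (m + n) x v = D m ((f ^^ n) x) (D n x v)"
  by (simp only: funpow_add holomorphic_map_compose(2)[OF holomorphic_iterate holomorphic_iterate])

lemma D_G_cancel: "D m ((inv f ^^ m) x) (G m x v) = v"
proof -
  have "f ^^ m \<circ> inv f ^^ m = id" by (simp add: fun_eq_iff iterate_cancel)
  then show ?thesis
    using holomorphic_map_compose(2)[OF holomorphic_iterate[of m] holomorphic_inverse_iterate[of m], of x v]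
    by (simp add: frechet_derivative_id id_def)
qed

lemma G_D_cancel: "G m ((f ^^ m) x) (D m x v) = v"
proof -
  have "inv f ^^ m \<circ> f ^^ m = id" by (simp add: fun_eq_iff iterate_cancel)
  then show ?thesis
    using holomorphic_map_compose(2)[OF holomorphic_inverse_iterate[of m] holomorphic_iterate[of m], of x v]
    by (simp add: frechet_derivative_id id_def)
qed

lemma subbundle_fibre_subspace: "complex_subbundle \<Lambda> V \<Longrightarrow> x \<in> \<Lambda> \<Longrightarrow> vec.subspace (V x)"
proof -
  assume "complex_subbundle \<Lambda> V" "x \<in> \<Lambda>"
  then obtain k :: nat and U v where "x \<in> U" and
    "\<forall>y\<in>U \<inter> \<Lambda>. inj_on (\<lambda>i. v i y) {..<k} \<and> vec.independent ((\<lambda>i. v i y) ` {..<k}) \<and>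
       vec.span ((\<lambda>i. v i y) ` {..<k}) = V y"
    unfolding complex_subbundle_def by blast
  then have "vec.span ((\<lambda>i. v i x) ` {..<k}) = V x" using \<open>x \<in> \<Lambda>\<close> by blast
  then show "vec.subspace (V x)" by (metis vec.subspace_span)
qed

lemma complex_subspace_E: "x \<in> \<Lambda> \<Longrightarrow> vec.subspace (E x)"
  and complex_subspace_F: "x \<in> \<Lambda> \<Longrightarrow> vec.subspace (F x)"
  using splitting subbundle_fibre_subspace unfolding invariant_splitting_def by blast+

lemma subspace_E: "x \<in> \<Lambda> \<Longrightarrow> subspace (E x)"
  and subspace_F: "x \<in> \<Lambda> \<Longrightarrow> subspace (F x)"
  by (simp_all add: complex_subspace_imp_real complex_subspace_E complex_subspace_F)

lemma E_F_trivial: "x \<in> \<Lambda> \<Longrightarrow> v \<in> E x \<Longrightarrow> v \<in> F x \<Longrightarrow> v = 0"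
  using splitting unfolding invariant_splitting_def by blast

lemma splitE:
  assumes "x \<in> \<Lambda>"
  obtains e u where "e \<in> E x" "u \<in> F x" "w = e + u"
  using splitting assms unfolding invariant_splitting_def by meson

lemma derivative_preserves_splitting:
  assumes "x \<in> \<Lambda>"
  shows "v \<in> E x \<Longrightarrow> D m x v \<in> E ((f ^^ m) x)" "v \<in> F x \<Longrightarrow> D m x v \<in> F ((f ^^ m) x)"
    "v \<in> E x \<Longrightarrow> G m x v \<in> E ((inv f ^^ m) x)" "v \<in> F x \<Longrightarrow> G m x v \<in> F ((inv f ^^ m) x)"
proof -
  have step: "D 1 y v \<in> V (f y)" "G 1 y v \<in> V (inv f y)"
    if V: "V = E \<or> V = F" and y: "y \<in> \<Lambda>" and v: "v \<in> V y" for V y v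
  proof -
    have im: "D 1 y ` V y = V (f y)" if "y \<in> \<Lambda>" for y
    proof -
      have "frechet_derivative f (at y) ` E y = E (f y)" "frechet_derivative f (at y) ` F y = F (f y)"
        using splitting that unfolding invariant_splitting_def by blast+
      then show ?thesis using V by auto
    qed
    show "D 1 y v \<in> V (f y)" using im[OF y] v by blast
    have "inv f y \<in> \<Lambda>" "f (inv f y) = y"
      using inverse_iterate_in_set[OF y, of 1] iterate_cancel(1)[of 1 y] by auto
    then obtain w where w: "w \<in> V (inv f y)" "v = D 1 (inv f y) w" using im[of "inv f y"] v by auto
    then show "G 1 y v \<in> V (inv f y)"
      using G_D_cancel[of 1 "inv f y" w] \<open>f (inv f y) = y\<close> by simp
  qed
  have D: "v \<in> V x \<Longrightarrow> D m x v \<in> V ((f ^^ m) x)" if V: "V = E \<or> V = F" for V m v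
  proof (induction m)
    case 0
    then show ?case by (simp add: frechet_derivative_id id_def)
  next
    case (Suc m)
    then show ?case
      using step(1)[OF V iterate_in_set[OF assms, of m]] D_add[of 1 m x v] by (simp add: o_def)
  qed
  have G: "v \<in> V x \<Longrightarrow> G m x v \<in> V ((inv f ^^ m) x)" if V: "V = E \<or> V = F" for V m v
  proof (induction m)
    case 0
    then show ?case by (simp add: frechet_derivative_id id_def)
  next
    case (Suc m)
    then show ?case
      using step(2)[OF V inverse_iterate_in_set[OF assms, of m]] G_add[of 1 m x v] by (simp add: o_def)
  qed
  show "v \<in> E x \<Longrightarrow> D m x v \<in> E ((f ^^ m) x)" "v \<in> F x \<Longrightarrow> D m x v \<in> F ((f ^^ m) x)"
    "v \<in> E x \<Longrightarrow> G m x v \<in> E ((inv f ^^ m) x)" "v \<in> F x \<Longrightarrow> G m x v \<in> F ((inv f ^^ m) x)"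
    using D G by blast+
qed

lemma mu_pos: "\<mu> > 0" using rates by simp

lemma E_contracted: "x \<in> \<Lambda> \<Longrightarrow> v \<in> E x \<Longrightarrow> norm (D m x v) \<le> C * \<nu> ^ m * norm v"
  using norm_le_opnorm_on[OF linear_D subspace_E] opnorm_E
  by (meson mult_right_mono norm_ge_zero order_trans)

lemma F_backward: "x \<in> \<Lambda> \<Longrightarrow> v \<in> F x \<Longrightarrow> norm (G m x v) \<le> C / \<mu> ^ m * norm v"
  using norm_le_opnorm_on[OF linear_G subspace_F] opnorm_F
  by (meson mult_right_mono norm_ge_zero order_trans)

lemma E_backward: "x \<in> \<Lambda> \<Longrightarrow> v \<in> E x \<Longrightarrow> norm v \<le> C * \<nu> ^ m * norm (G m x v)"
  using E_contracted[OF inverse_iterate_in_set derivative_preserves_splitting(3), of x v m m] by (simp add: D_G_cancel)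

lemma F_forward: "x \<in> \<Lambda> \<Longrightarrow> v \<in> F x \<Longrightarrow> norm v \<le> C / \<mu> ^ m * norm (D m x v)"
  using F_backward[OF iterate_in_set derivative_preserves_splitting(2), of x v m m] by (simp add: G_D_cancel)

text \<open>
  A component in \<open>E p\<close> would grow at least like \<open>\<nu>\<^sup>-\<^sup>m\<close> under the inverse iterates, faster than
  the rate \<open>\<mu>\<^sup>-\<^sup>m\<close> allows. So the fibres of \<open>F\<close> are cut out by closed growth conditions, and compactness
  of the disc bundle of \<open>F\<close> follows without using local frames. The same works for \<open>E\<close>.
\<close>

lemma in_F_if_backward_rate:
  assumes p: "p \<in> \<Lambda>" and rate: "\<And>m. norm (G m p v) \<le> B / \<mu> ^ m"
  shows "v \<in> F p"
proof -
  obtain e u where eu: "e \<in> E p" "u \<in> F p" "v = e + u" using splitE[OF p] .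
  have "norm e \<le> C * (B + C * norm u) * (\<nu> / \<mu>) ^ m" for m
  proof -
    have "G m p e = G m p v - G m p u" by (simp add: eu(3) linear_add[OF linear_G])
    then have "norm (G m p e) \<le> B / \<mu> ^ m + C / \<mu> ^ m * norm u"
      using norm_triangle_ineq4[of "G m p v" "G m p u"] rate[of m] F_backward[OF p eu(2), of m] by simp
    then have "norm e \<le> C * \<nu> ^ m * (B / \<mu> ^ m + C / \<mu> ^ m * norm u)"
      using E_backward[OF p eu(1), of m] rates
      by (meson mult_left_mono mult_nonneg_nonneg order_trans less_imp_le zero_le_power)
    then show ?thesis by (simp add: power_divide algebra_simps add_divide_distrib)
  qed
  then have "e = 0" by (rule eq_0_if_norm_le_geometric) (use rates mu_pos in auto)
  then show ?thesis using eu by simp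
qed

lemma in_E_if_forward_rate:
  assumes p: "p \<in> \<Lambda>" and rate: "\<And>m. norm (D m p v) \<le> B * \<nu> ^ m"
  shows "v \<in> E p"
proof -
  obtain e u where eu: "e \<in> E p" "u \<in> F p" "v = e + u" using splitE[OF p] .
  have "norm u \<le> C * (B + C * norm e) * (\<nu> / \<mu>) ^ m" for m
  proof -
    have "D m p u = D m p v - D m p e" by (simp add: eu(3) linear_add[OF linear_D])
    then have "norm (D m p u) \<le> B * \<nu> ^ m + C * \<nu> ^ m * norm e"
      using norm_triangle_ineq4[of "D m p v" "D m p e"] rate[of m] E_contracted[OF p eu(1), of m] by simp
    then have "norm u \<le> C / \<mu> ^ m * (B * \<nu> ^ m + C * \<nu> ^ m * norm e)"
      using F_forward[OF p eu(2), of m] rates mu_pos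
      by (meson mult_left_mono divide_nonneg_nonneg order_trans less_imp_le zero_le_power)
    then show ?thesis by (simp add: power_divide algebra_simps add_divide_distrib)
  qed
  then have "u = 0" by (rule eq_0_if_norm_le_geometric) (use rates mu_pos in auto)
  then show ?thesis using eu by simp
qed

lemma closed_rate_condition:
  assumes g: "\<And>m. holomorphic_map (g m)"
  shows "closed {(x, v). \<forall>m. norm (frechet_derivative (g m) (at x) v) \<le> c m * norm v}"
proof -
  have "closed {q. norm (case q of (x, v) \<Rightarrow> frechet_derivative (g m) (at x) v) \<le> c m * norm (snd q)}" for m
    by (intro closed_Collect_le continuous_intros holomorphic_map_derivative_continuous g)
  then have "closed (\<Inter>m. {q. norm (case q of (x, v) \<Rightarrow> frechet_derivative (g m) (at x) v) \<le> c m * norm (snd q)})"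
    by blast
  then show ?thesis by (rule back_subst[of closed]) auto
qed

lemma compact_E_bundle: "compact {(x, v). x \<in> \<Lambda> \<and> v \<in> E x \<and> norm v \<le> r}"
proof -
  have "v \<in> E x \<longleftrightarrow> (\<forall>m. norm (D m x v) \<le> C * \<nu> ^ m * norm v)" if "x \<in> \<Lambda>" for x v
    using that E_contracted[of x v] in_E_if_forward_rate[of x v "C * norm v"] by (auto simp: mult_ac)
  then have "{(x, v). x \<in> \<Lambda> \<and> v \<in> E x \<and> norm v \<le> r} =
      (\<Lambda> \<times> cball 0 r) \<inter> {(x, v). \<forall>m. norm (D m x v) \<le> C * \<nu> ^ m * norm v}"
    by auto
  then show ?thesis
    using closed_rate_condition[of "\<lambda>m. f ^^ m" "\<lambda>m. C * \<nu> ^ m"]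
    by (simp add: compact_Int_closed compact_Times compact_set holomorphic_iterate)
qed

lemma compact_F_bundle: "compact {(x, v). x \<in> \<Lambda> \<and> v \<in> F x \<and> norm v \<le> r}"
proof -
  have "v \<in> F x \<longleftrightarrow> (\<forall>m. norm (G m x v) \<le> C / \<mu> ^ m * norm v)" if "x \<in> \<Lambda>" for x v
    using that F_backward[of x v] in_F_if_backward_rate[of x v "C * norm v"] by (auto simp: mult_ac)
  then have "{(x, v). x \<in> \<Lambda> \<and> v \<in> F x \<and> norm v \<le> r} =
      (\<Lambda> \<times> cball 0 r) \<inter> {(x, v). \<forall>m. norm (G m x v) \<le> C / \<mu> ^ m * norm v}"
    by auto
  then show ?thesis
    using closed_rate_condition[of "\<lambda>m. inv f ^^ m" "\<lambda>m. C / \<mu> ^ m"]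
    by (simp add: compact_Int_closed compact_Times compact_set holomorphic_inverse_iterate)
qed

text \<open>
  The norm of \<open>e + u\<close> is continuous and positive on the compact set of pairs with \<open>\<bar>e\<bar> = 1\<close> and
  \<open>\<bar>u\<bar> \<le> 2\<close>; for longer \<open>u\<close> the triangle inequality suffices.
\<close>

lemma splitting_angle:
  obtains K where "K \<ge> 1"
    "\<forall>x\<in>\<Lambda>. \<forall>e\<in>E x. \<forall>u\<in>F x. norm e \<le> K * norm (e + u) \<and> norm u \<le> K * norm (e + u)"
proof -
  let ?S = "{((x, e), (y, u)). x \<in> \<Lambda> \<and> e \<in> E x \<and> y \<in> \<Lambda> \<and> u \<in> F y \<and> x = y \<and> norm e = 1 \<and> norm u \<le> 2}"
  let ?h = "\<lambda>q :: ((complex ^ 'n) \<times> (complex ^ 'n)) \<times> (complex ^ 'n) \<times> (complex ^ 'n). norm (snd (fst q) + snd (snd q))"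
  have "?S = {(x, v). x \<in> \<Lambda> \<and> v \<in> E x \<and> norm v \<le> 1} \<times> {(x, v). x \<in> \<Lambda> \<and> v \<in> F x \<and> norm v \<le> 2} \<inter>
      ({q. fst (fst q) = fst (snd q)} \<inter> {q. norm (snd (fst q)) = 1})" by auto
  moreover have "compact \<dots>"
    by (intro compact_Int_closed compact_Times compact_E_bundle compact_F_bundle closed_Int closed_Collect_eq continuous_intros)
  ultimately have "compact ?S" by simp
  have pos: "?h q > 0" if q: "q \<in> ?S" for q
  proof -
    obtain x e u where eu: "q = ((x, e), (x, u))" "x \<in> \<Lambda>" "e \<in> E x" "u \<in> F x" "norm e = 1" using q by auto
    have "e + u \<noteq> 0"
    proof
      assume "e + u = 0"
      then have "e = - u" by (simp add: add_eq_0_iff2)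
      then have "e \<in> F x" using eu subspace_neg[OF subspace_F] by blast
      then show False using E_F_trivial eu by force
    qed
    then show ?thesis by (simp add: eu(1))
  qed
  obtain \<rho> where \<rho>: "0 < \<rho>" "\<rho> \<le> 1" "\<And>q. q \<in> ?S \<Longrightarrow> \<rho> \<le> ?h q"
  proof (cases "?S = {}")
    case True
    then show ?thesis using that[of 1] by (metis empty_iff order_refl zero_less_one)
  next
    case False
    have "continuous_on ?S ?h" by (intro continuous_intros)
    from continuous_attains_inf[OF \<open>compact ?S\<close> False this] obtain q where "q \<in> ?S" "\<And>q'. q' \<in> ?S \<Longrightarrow> ?h q \<le> ?h q'"
      by blast
    then show ?thesis using pos[of q] by (intro that[of "min 1 (?h q)"]) (auto simp: min_le_iff_disj simp del: mem_Collect_eq)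
  qed
  have E: "\<rho> * norm e \<le> norm (e + u)" if x: "x \<in> \<Lambda>" and e: "e \<in> E x" and u: "u \<in> F x" for x e u
  proof (cases "e = 0")
    case False
    let ?e = "e /\<^sub>R norm e" and ?u = "u /\<^sub>R norm e"
    have eu: "?e \<in> E x" "?u \<in> F x" "norm ?e = 1"
      using e u False by (auto simp: subspace_scale subspace_E[OF x] subspace_F[OF x])
    have "\<rho> \<le> norm (?e + ?u)"
    proof (cases "norm ?u \<le> 2")
      case True
      then show ?thesis using \<rho>(3)[of "((x, ?e), (x, ?u))"] x eu by simp
    next
      case False
      then show ?thesis using norm_triangle_ineq2[of ?u "- ?e"] eu(3) \<rho>(2)
        by (simp add: add.commute del: norm_scaleR)
    qed
    also have "?e + ?u = (e + u) /\<^sub>R norm e" by (simp add: scaleR_add_right)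
    finally show ?thesis using False by (simp add: divide_simps mult.commute)
  qed simp
  show ?thesis
  proof (rule that[of "1 + 1 / \<rho>"], goal_cases)
    case 1
    show "1 \<le> 1 + 1 / \<rho>" using \<rho> by simp
  next
    case 2
    show ?case
    proof (intro ballI)
      fix x e u assume "x \<in> \<Lambda>" "e \<in> E x" "u \<in> F x"
      from E[OF this] have *: "norm e \<le> 1 / \<rho> * norm (e + u)" using \<rho> by (simp add: field_simps)
      moreover have "norm u \<le> norm (e + u) + norm e" using norm_triangle_ineq4[of "e + u" e] by simp
      ultimately show "norm e \<le> (1 + 1 / \<rho>) * norm (e + u) \<and> norm u \<le> (1 + 1 / \<rho>) * norm (e + u)"
        by (simp add: algebra_simps add_increasing)
    qed
  qed
qed

text \<open>
  The factor 8 pays for two losses: off \<open>\<Lambda>\<close> the expansion of \<open>E\<close> is only half as strong, and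
  distances in a leaf may change twice as much as vectors of \<open>F\<close>. A ratio of 2 remains.
\<close>

lemma domination_at_some_time:
  obtains N where "8 * (C / \<mu> ^ N) \<le> 1 / (C * \<nu> ^ N)"
proof -
  have "(\<lambda>N. 8 * C\<^sup>2 * (\<nu> / \<mu>) ^ N) \<longlonglongrightarrow> 8 * C\<^sup>2 * 0"
    using rates mu_pos by (intro tendsto_mult LIMSEQ_realpow_zero tendsto_const) auto
  then have "\<forall>\<^sub>F N in sequentially. 8 * C\<^sup>2 * (\<nu> / \<mu>) ^ N < 1" by (rule order_tendstoD) simp
  then obtain N where "8 * C\<^sup>2 * (\<nu> / \<mu>) ^ N < 1" using eventually_happens trivial_limit_sequentially by blast
  then have "8 * (C / \<mu> ^ N) \<le> 1 / (C * \<nu> ^ N)"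
    using rates mu_pos by (simp add: field_simps power2_eq_square power_divide)
  then show ?thesis by (rule that)
qed

text \<open>
  At points outside \<open>\<Lambda>\<close> the subspace \<open>E x\<close> is not invariant, but by domination the cone of vectors whose
  \<open>F\<close>-component is at most their \<open>E\<close>-component is, even after a small perturbation \<open>B\<close> of the derivative.
\<close>

lemma E_cone_step:
  assumes x: "x \<in> \<Lambda>" and K: "K \<ge> 1" "\<forall>x\<in>\<Lambda>. \<forall>e\<in>E x. \<forall>u\<in>F x. norm e \<le> K * norm (e + u) \<and> norm u \<le> K * norm (e + u)"
    and a: "a = 1 / (C * \<nu> ^ N)" and dom: "8 * (C / \<mu> ^ N) \<le> a"
    and B: "\<And>w. norm (B w - G N x w) \<le> a / (8 * K) * norm w"
    and e: "e \<in> E x" and u: "u \<in> F x" and cone: "norm u \<le> norm e"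
  obtains e' u' where "e' \<in> E ((inv f ^^ N) x)" "u' \<in> F ((inv f ^^ N) x)" "B (e + u) = e' + u'"
    "norm u' \<le> norm e'" "a / 2 * norm e \<le> norm e'"
proof -
  let ?x = "(inv f ^^ N) x"
  have x': "?x \<in> \<Lambda>" by (rule inverse_iterate_in_set[OF x])
  have apos: "a > 0" using a rates by simp
  let ?err = "B (e + u) - G N x (e + u)"
  obtain p q where pq: "p \<in> E ?x" "q \<in> F ?x" "?err = p + q" using splitE[OF x'] .
  have "norm (e + u) \<le> 2 * norm e" using norm_triangle_ineq[of e u] cone by simp
  then have "K * norm ?err \<le> K * (a / (8 * K) * (2 * norm e))"
    using B[of "e + u"] apos K(1) by (meson mult_left_mono order_trans divide_nonneg_nonneg mult_nonneg_nonneg less_imp_le zero_le_numeral le_numeral_extra(1) order.trans)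
  also have "\<dots> = a / 4 * norm e" using K(1) by simp
  finally have err: "norm p \<le> a / 4 * norm e" "norm q \<le> a / 4 * norm e"
    using K(2)[rule_format, OF x' pq(1,2)] pq(3) by auto
  have Ge: "a * norm e \<le> norm (G N x e)"
    using E_backward[OF x e, of N] rates by (simp add: a field_simps)
  have "norm (G N x u) \<le> C / \<mu> ^ N * norm u" by (rule F_backward[OF x u])
  also have "\<dots> \<le> a / 8 * norm e"
  proof (rule mult_mono)
    show "C / \<mu> ^ N \<le> a / 8" using dom by linarith
  qed (use cone apos in auto)
  finally have Gu: "norm (G N x u) \<le> a / 8 * norm e" .
  have ae: "0 \<le> a * norm e" using apos by simp
  have lower: "norm (G N x e + p) \<ge> a / 2 * norm e"
  proof -
    have "norm (G N x e) \<le> norm (G N x e + p) + norm p" using norm_triangle_ineq4[of "G N x e + p" p] by simp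
    then show ?thesis using Ge err(1) ae by linarith
  qed
  have "norm (G N x u + q) \<le> a / 2 * norm e"
    using norm_triangle_ineq[of "G N x u" q] Gu err(2) ae by linarith
  with lower have "norm (G N x u + q) \<le> norm (G N x e + p)" by linarith
  moreover have "G N x e + p \<in> E ?x" "G N x u + q \<in> F ?x"
    using derivative_preserves_splitting[OF x] e u pq x' by (auto intro!: subspace_add subspace_E subspace_F)
  moreover have "B (e + u) = (G N x e + p) + (G N x u + q)"
    using pq(3) by (simp add: linear_add[OF linear_G] algebra_simps)
  ultimately show ?thesis using that lower by blast
qed

lemma E_expands_near_backward_orbit:
  assumes a: "a = 1 / (C * \<nu> ^ N)" and dom: "8 * (C / \<mu> ^ N) \<le> a"
  obtains \<eta> K where "\<eta> > 0" "K > 0"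
    "\<And>x y e k. x \<in> \<Lambda> \<Longrightarrow> e \<in> E x \<Longrightarrow> \<forall>m. dist ((inv f ^^ m) y) ((inv f ^^ m) x) < \<eta> \<Longrightarrow>
       (a / 2) ^ k * norm e \<le> K * norm (G (N * k) y e)"
proof -
  obtain K where K: "K \<ge> 1"
    "\<forall>x\<in>\<Lambda>. \<forall>e\<in>E x. \<forall>u\<in>F x. norm e \<le> K * norm (e + u) \<and> norm u \<le> K * norm (e + u)"
    using splitting_angle by blast
  have apos: "a > 0" using a rates by simp
  then have "a / (8 * K) > 0" using K(1) by simp
  then obtain \<eta> where \<eta>: "\<eta> > 0" "\<And>x y w. x \<in> \<Lambda> \<Longrightarrow> dist y x < \<eta> \<Longrightarrow>
     norm (G N y w - G N x w) \<le> a / (8 * K) * norm w"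
    using holomorphic_map_derivative_uniform[OF holomorphic_inverse_iterate compact_set] by metis
  show ?thesis
  proof (rule that[OF \<eta>(1)])
    show "K > 0" using K(1) by simp
    fix x y e k assume x: "x \<in> \<Lambda>" and e: "e \<in> E x"
      and close: "\<forall>m. dist ((inv f ^^ m) y) ((inv f ^^ m) x) < \<eta>"
    have "\<exists>e'\<in>E ((inv f ^^ (N * k)) x). \<exists>u'\<in>F ((inv f ^^ (N * k)) x).
        G (N * k) y e = e' + u' \<and> norm u' \<le> norm e' \<and> (a / 2) ^ k * norm e \<le> norm e'"
    proof (induction k)
      case 0
      then show ?case using e subspace_0[OF subspace_F[OF x]]
        by (intro bexI[of _ e] bexI[of _ 0]) (auto simp: frechet_derivative_id id_def)
    next
      case (Suc k)
      let ?x = "(inv f ^^ (N * k)) x" and ?y = "(inv f ^^ (N * k)) y"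
      from Suc obtain e' u' where eu: "e' \<in> E ?x" "u' \<in> F ?x" "G (N * k) y e = e' + u'"
        "norm u' \<le> norm e'" "(a / 2) ^ k * norm e \<le> norm e'" by blast
      have x': "?x \<in> \<Lambda>" by (rule inverse_iterate_in_set[OF x])
      obtain e'' u'' where eu'': "e'' \<in> E ((inv f ^^ N) ?x)" "u'' \<in> F ((inv f ^^ N) ?x)"
          "G N ?y (e' + u') = e'' + u''" "norm u'' \<le> norm e''" "a / 2 * norm e' \<le> norm e''"
        using E_cone_step[OF x' K a dom \<eta>(2)[OF x' close[rule_format]] eu(1,2,4)] by blast
      have "(a / 2) ^ Suc k * norm e = a / 2 * ((a / 2) ^ k * norm e)" by simp
      also have "\<dots> \<le> a / 2 * norm e'" using eu(5) apos by (intro mult_left_mono) auto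
      also have "\<dots> \<le> norm e''" by fact
      finally have "(a / 2) ^ Suc k * norm e \<le> norm e''" .
      moreover have "(inv f ^^ (N * Suc k)) x = (inv f ^^ N) ?x" by (simp add: funpow_add)
      moreover have "G (N * Suc k) y e = e'' + u''"
        using G_add[of N "N * k" y e] eu(3) eu''(3) by simp
      ultimately show ?case using eu'' by auto
    qed
    then obtain e' u' where eu: "e' \<in> E ((inv f ^^ (N * k)) x)" "u' \<in> F ((inv f ^^ (N * k)) x)"
      "G (N * k) y e = e' + u'" "(a / 2) ^ k * norm e \<le> norm e'" by blast
    then show "(a / 2) ^ k * norm e \<le> K * norm (G (N * k) y e)"
      using K(2)[rule_format, OF inverse_iterate_in_set[OF x] eu(1,2)] by auto
  qed
qed

text \<open>
  By compactness every vector of \<open>F\<close> is halved at some time, which depends on the vector but is bounded by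
  a common \<open>m0\<close>. Following each vector through its own halving times gives the rate \<open>\<theta>\<close> with \<open>\<theta>\<^sup>m\<^sup>0 = 1/2\<close>.
\<close>

lemma unstable_if_backward_images_vanish:
  assumes shrink: "\<And>x v. x \<in> \<Lambda> \<Longrightarrow> v \<in> F x \<Longrightarrow> (\<lambda>m. G m x v) \<longlonglongrightarrow> 0"
  shows "unstable_direction f \<Lambda> F"
proof -
  let ?S = "{(x, v). x \<in> \<Lambda> \<and> v \<in> F x \<and> norm v = 1}"
  let ?g = "\<lambda>m (x, v). norm (G m x v)"
  have "?S = {(x, v). x \<in> \<Lambda> \<and> v \<in> F x \<and> norm v \<le> 1} \<inter> {q. norm (snd q) = 1}" by auto
  moreover have "compact \<dots>"
    by (intro compact_Int_closed compact_F_bundle closed_Collect_eq continuous_intros)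
  ultimately have comp: "compact ?S" by simp
  have op: "open (?g m -` {..<1/2})" for m
  proof -
    have "continuous_on UNIV (\<lambda>q. norm (case q of (x, v) \<Rightarrow> G m x v))"
      by (intro continuous_intros holomorphic_map_derivative_continuous holomorphic_inverse_iterate)
    then have "continuous_on UNIV (?g m)" by (simp add: case_prod_unfold)
    then show ?thesis by (intro open_vimage) auto
  qed
  obtain M where M: "M \<noteq> {}" "finite M" "0 \<notin> M" "?S \<subseteq> (\<Union>m\<in>M. ?g m -` {..<1/2})"
  proof -
    have "?S \<subseteq> (\<Union>m\<in>{1..}. ?g m -` {..<1/2})"
    proof
      fix q assume "q \<in> ?S"
      then obtain x v where q: "q = (x, v)" "x \<in> \<Lambda>" "v \<in> F x" by auto
      have "(\<lambda>m. norm (G m x v)) \<longlonglongrightarrow> 0" using shrink[OF q(2,3)] by (rule tendsto_norm_zero)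
      then have "\<forall>\<^sub>F m in sequentially. norm (G m x v) < 1/2" by (rule order_tendstoD) simp
      then have "\<forall>\<^sub>F m in sequentially. norm (G m x v) < 1/2 \<and> 1 \<le> m"
        using eventually_ge_at_top[of 1] by (rule eventually_conj)
      then obtain m where "norm (G m x v) < 1/2" "1 \<le> m"
        using eventually_happens trivial_limit_sequentially by blast
      then show "q \<in> (\<Union>m\<in>{1..}. ?g m -` {..<1/2})" using q(1) by auto
    qed
    then obtain M where M: "M \<subseteq> {1..}" "finite M" "?S \<subseteq> (\<Union>m\<in>M. ?g m -` {..<1/2})"
      by (rule compactE_image[where f = "\<lambda>m. ?g m -` {..<1/2}" and C = "{1..}", OF comp op])
    show ?thesis
    proof (rule that[of "insert 1 M"])
      show "?S \<subseteq> (\<Union>m\<in>insert 1 M. ?g m -` {..<1/2})" using M(3) by blast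
    qed (use M in auto)
  qed
  define m0 where "m0 = Max M"
  have m0: "m \<le> m0" if "m \<in> M" for m using that M(2) by (simp add: m0_def)
  have "m0 > 0" using M m0 by (metis all_not_in_conv gr_zeroI le_zero_eq)
  have halve: "\<exists>m. 0 < m \<and> m \<le> m0 \<and> norm (G m x v) \<le> norm v / 2" if x: "x \<in> \<Lambda>" and v: "v \<in> F x" for x v
  proof (cases "v = 0")
    case True
    then show ?thesis using \<open>m0 > 0\<close> by (auto intro!: exI[of _ m0] simp: linear_0[OF linear_G])
  next
    case False
    then have "(x, v /\<^sub>R norm v) \<in> ?S" using x v by (simp add: subspace_scale subspace_F)
    then have "(x, v /\<^sub>R norm v) \<in> (\<Union>m\<in>M. ?g m -` {..<1/2})" by (rule subsetD[OF M(4)])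
    then obtain m where m: "m \<in> M" "norm (G m x (v /\<^sub>R norm v)) < 1/2" by auto
    then have "norm (G m x v) \<le> norm v / 2"
      using False by (simp add: linear_cmul[OF linear_G] field_simps)
    then show ?thesis using m(1) m0 M(3) by (metis gr_zeroI)
  qed
  obtain B where B: "B > 0" "\<And>m x v. m \<le> m0 \<Longrightarrow> x \<in> \<Lambda> \<Longrightarrow> norm (G m x v) \<le> B * norm v"
  proof -
    have "\<exists>K>0. \<forall>x\<in>\<Lambda>. \<forall>v. norm (G m x v) \<le> K * norm v" for m
      using holomorphic_map_derivative_bounded[OF holomorphic_inverse_iterate compact_set] by metis
    then obtain K where K: "\<And>m. K m > 0" "\<And>m x v. x \<in> \<Lambda> \<Longrightarrow> norm (G m x v) \<le> K m * norm v" by metis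
    show ?thesis
    proof (rule that[of "\<Sum>m\<le>m0. K m"])
      show "(\<Sum>m\<le>m0. K m) > 0" by (intro sum_pos K(1)) auto
      fix m x v assume "m \<le> m0" "x \<in> \<Lambda>"
      then have "K m \<le> (\<Sum>m\<le>m0. K m)" using K(1) by (intro member_le_sum) (auto intro: less_imp_le)
      then show "norm (G m x v) \<le> (\<Sum>m\<le>m0. K m) * norm v"
        using K(2)[OF \<open>x \<in> \<Lambda>\<close>, of m v] by (meson mult_right_mono norm_ge_zero order_trans)
    qed
  qed
  define \<theta> where "\<theta> = root m0 (1/2)"
  have \<theta>: "0 < \<theta>" "\<theta> < 1" "\<theta> ^ m0 = 1/2" using \<open>m0 > 0\<close> by (auto simp: \<theta>_def real_root_lt_1_iff)
  have half_le: "1/2 \<le> \<theta> ^ m" if "m \<le> m0" for m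
    using power_decreasing[OF that, of \<theta>] \<theta> by simp
  have decay: "x \<in> \<Lambda> \<Longrightarrow> v \<in> F x \<Longrightarrow> norm (G n x v) \<le> 2 * B * \<theta> ^ n * norm v" for n x v
  proof (induction n arbitrary: x v rule: less_induct)
    case (less n)
    show ?case
    proof (cases "n \<le> m0")
      case True
      have "norm (G n x v) \<le> B * norm v" by (rule B(2)[OF True less.prems(1)])
      also have "\<dots> \<le> 2 * B * \<theta> ^ n * norm v"
        using half_le[OF True] B(1) by (intro mult_right_mono) (auto simp: field_simps)
      finally show ?thesis .
    next
      case False
      obtain m where m: "0 < m" "m \<le> m0" "norm (G m x v) \<le> norm v / 2" using halve[OF less.prems] by blast
      let ?n = "n - m"
      have n: "n = ?n + m" using m False by simp
      have "norm (G n x v) = norm (G ?n ((inv f ^^ m) x) (G m x v))"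
        using G_add[of ?n m x v] n by simp
      also have "\<dots> \<le> 2 * B * \<theta> ^ ?n * norm (G m x v)"
        using m(1) False less.prems
        by (intro less.IH inverse_iterate_in_set derivative_preserves_splitting(4)) auto
      also have "\<dots> \<le> 2 * B * \<theta> ^ ?n * (norm v / 2)"
        using m(3) B(1) \<theta>(1) by (intro mult_left_mono) auto
      also have "\<dots> \<le> 2 * B * \<theta> ^ ?n * (\<theta> ^ m * norm v)"
        using half_le[OF m(2)] B(1) \<theta>(1) mult_right_mono[OF half_le[OF m(2)], of "norm v"]
        by (intro mult_left_mono) auto
      also have "\<dots> = 2 * B * \<theta> ^ n * norm v"
        using power_add[of \<theta> ?n m] n by simp
      finally show ?thesis .
    qed
  qed
  show ?thesis
    unfolding unstable_direction_def
  proof (rule exI[of _ "2 * B"], rule exI[of _ \<theta>], intro conjI allI ballI)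
    fix m x assume x: "x \<in> \<Lambda>"
    show "opnorm_on (G m x) (F x) \<le> 2 * B * \<theta> ^ m"
      using decay[OF x] B(1) \<theta>(1) by (intro opnorm_on_le subspace_0 subspace_F x) auto
  qed (use B \<theta> in auto)
qed

end

section \<open>Center-unstable leaves near their centre\<close>

lemma cu_leaf_mono: "r \<le> s \<Longrightarrow> cu_leaf J \<phi> r x \<subseteq> cu_leaf J \<phi> s x"
  unfolding cu_leaf_def using polydisc_mono by blast

locale partially_hyperbolic_leaves =
  partially_hyperbolic_set f \<Lambda> E F \<nu> \<mu> C + leaf_family \<Lambda> J \<phi>
  for f :: "complex ^ 'n \<Rightarrow> complex ^ 'n" and \<Lambda> E F \<nu> \<mu> C J \<phi> +
  assumes tangent: "x \<in> \<Lambda> \<Longrightarrow> leaf_tangent x ` coord_space J = F x"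
    and local_invariance: "0 < \<epsilon>\<^sub>1 \<Longrightarrow> \<epsilon>\<^sub>1 < 1 \<Longrightarrow> \<exists>\<epsilon>\<^sub>2. 0 < \<epsilon>\<^sub>2 \<and> \<epsilon>\<^sub>2 \<le> 1 \<and>
          (\<forall>x\<in>\<Lambda>. inv f ` cu_leaf J \<phi> \<epsilon>\<^sub>2 x \<subseteq> cu_leaf J \<phi> \<epsilon>\<^sub>1 (inv f x))"
begin

abbreviation leaf :: "real \<Rightarrow> complex ^ 'n \<Rightarrow> (complex ^ 'n) set" where
  "leaf \<equiv> cu_leaf J \<phi>"

lemma centre_in_leaf: "x \<in> \<Lambda> \<Longrightarrow> r > 0 \<Longrightarrow> x \<in> leaf r x"
  unfolding cu_leaf_def using centre zero_in_polydisc by (metis image_eqI)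

lemma inverse_step_into_leaf:
  assumes "0 < s" "s < 1"
  obtains r where "0 < r" "r \<le> 1"
    "\<And>x y. x \<in> \<Lambda> \<Longrightarrow> y \<in> leaf r x \<Longrightarrow> inv f y \<in> leaf s (inv f x)"
  using local_invariance[OF assms] by blast

lemma leaf_map_bilipschitz:
  obtains r \<alpha> \<beta> where "0 < r" "r \<le> 1" "0 < \<alpha>" "0 < \<beta>"
    "\<And>x z z'. x \<in> \<Lambda> \<Longrightarrow> z \<in> polydisc J r \<Longrightarrow> z' \<in> polydisc J r \<Longrightarrow>
       \<alpha> * norm (z - z') \<le> norm (\<phi> x z - \<phi> x z') \<and> norm (\<phi> x z - \<phi> x z') \<le> \<beta> * norm (z - z')"
proof -
  obtain \<alpha> \<beta> where ab: "\<alpha> > 0" "\<beta> > 0"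
    "\<And>x v. x \<in> \<Lambda> \<Longrightarrow> v \<in> coord_space J \<Longrightarrow> \<alpha> * norm v \<le> norm (leaf_tangent x v)"
    "\<And>x v. x \<in> \<Lambda> \<Longrightarrow> v \<in> coord_space J \<Longrightarrow> norm (leaf_tangent x v) \<le> \<beta> * norm v"
    using leaf_tangent_bounds by metis
  have "\<alpha> / 2 > 0" using ab by simp
  then obtain r where r: "0 < r" "r \<le> 1"
    "\<And>x z z'. x \<in> \<Lambda> \<Longrightarrow> z \<in> polydisc J r \<Longrightarrow> z' \<in> polydisc J r \<Longrightarrow>
       norm (\<phi> x z - \<phi> x z' - leaf_tangent x (z - z')) \<le> \<alpha> / 2 * norm (z - z')"
    using leaf_map_uniform_linearisation by metis
  show ?thesis
  proof (rule that[of r "\<alpha> / 2" "\<beta> + \<alpha> / 2"])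
    fix x z z' assume x: "x \<in> \<Lambda>" and z: "z \<in> polydisc J r" "z' \<in> polydisc J r"
    let ?w = "leaf_tangent x (z - z')" and ?d = "\<phi> x z - \<phi> x z'"
    have "z - z' \<in> coord_space J"
      using z polydisc_subset_coord_space[of J r] by (intro subspace_diff subspace_coord_space) auto
    note this = ab(3,4)[OF x this]
    moreover have "norm (?d - ?w) \<le> \<alpha> / 2 * norm (z - z')" by (rule r(3)[OF x z])
    moreover have "norm ?d \<le> norm ?w + norm (?d - ?w)" by (rule norm_triangle_sub)
    moreover have "norm ?w \<le> norm ?d + norm (?d - ?w)"
      using norm_triangle_sub[of ?w ?d] by (simp add: norm_minus_commute)
    ultimately show "\<alpha> / 2 * norm (z - z') \<le> norm ?d \<and> norm ?d \<le> (\<beta> + \<alpha> / 2) * norm (z - z')"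
      by (simp add: distrib_right)
  qed (use r ab in auto)
qed

lemma leaf_differences_almost_in_F:
  assumes \<kappa>: "\<kappa> > 0"
  obtains r where "0 < r" "r \<le> 1"
    "\<And>x y y'. x \<in> \<Lambda> \<Longrightarrow> y \<in> leaf r x \<Longrightarrow> y' \<in> leaf r x \<Longrightarrow>
       \<exists>w\<in>F x. norm (y - y' - w) \<le> \<kappa> * norm w"
proof -
  obtain \<alpha> where \<alpha>: "\<alpha> > 0"
    "\<And>x v. x \<in> \<Lambda> \<Longrightarrow> v \<in> coord_space J \<Longrightarrow> \<alpha> * norm v \<le> norm (leaf_tangent x v)"
    using leaf_tangent_bounds by metis
  have "\<kappa> * \<alpha> > 0" using \<kappa> \<alpha> by simp
  then obtain r where r: "0 < r" "r \<le> 1"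
    "\<And>x z z'. x \<in> \<Lambda> \<Longrightarrow> z \<in> polydisc J r \<Longrightarrow> z' \<in> polydisc J r \<Longrightarrow>
       norm (\<phi> x z - \<phi> x z' - leaf_tangent x (z - z')) \<le> \<kappa> * \<alpha> * norm (z - z')"
    using leaf_map_uniform_linearisation by metis
  show ?thesis
  proof (rule that[OF r(1,2)])
    fix x y y' assume x: "x \<in> \<Lambda>" and "y \<in> leaf r x" "y' \<in> leaf r x"
    then obtain z z' where z: "z \<in> polydisc J r" "z' \<in> polydisc J r" "y = \<phi> x z" "y' = \<phi> x z'"
      unfolding cu_leaf_def by blast
    have zz: "z - z' \<in> coord_space J"
      using z polydisc_subset_coord_space[of J r] by (intro subspace_diff subspace_coord_space) auto
    have "norm (y - y' - leaf_tangent x (z - z')) \<le> \<kappa> * (\<alpha> * norm (z - z'))"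
      using r(3)[OF x z(1,2)] by (simp add: z(3,4) mult.assoc)
    also have "\<dots> \<le> \<kappa> * norm (leaf_tangent x (z - z'))"
      using \<alpha>(2)[OF x zz] \<kappa> by (intro mult_left_mono) auto
    finally show "\<exists>w\<in>F x. norm (y - y' - w) \<le> \<kappa> * norm w"
      using tangent[OF x] zz by blast
  qed
qed

lemma small_leaf:
  assumes "\<eta> > 0"
  obtains r where "0 < r" "r \<le> 1" "\<And>x y. x \<in> \<Lambda> \<Longrightarrow> y \<in> leaf r x \<Longrightarrow> dist y x < \<eta>"
proof -
  obtain r \<beta> where r: "0 < r" "r \<le> 1" "0 < \<beta>"
    "\<And>x z z'. x \<in> \<Lambda> \<Longrightarrow> z \<in> polydisc J r \<Longrightarrow> z' \<in> polydisc J r \<Longrightarrow> norm (\<phi> x z - \<phi> x z') \<le> \<beta> * norm (z - z')"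
    using leaf_map_bilipschitz by metis
  define s where "s = min r (\<eta> / (2 * \<beta> * real CARD('n)))"
  have s: "0 < s" "s \<le> r" "\<beta> * (real CARD('n) * s) < \<eta>"
  proof -
    show "0 < s" "s \<le> r" using r assms by (auto simp: s_def)
    have "\<beta> * (real CARD('n) * s) \<le> \<beta> * (real CARD('n) * (\<eta> / (2 * \<beta> * real CARD('n))))"
      using r(3) by (intro mult_left_mono) (auto simp: s_def)
    also have "\<dots> = \<eta> / 2" using r(3) by simp
    finally show "\<beta> * (real CARD('n) * s) < \<eta>" using assms by simp
  qed
  show ?thesis
  proof (rule that[of s])
    fix x y assume x: "x \<in> \<Lambda>" and "y \<in> leaf s x"
    then obtain z where z: "z \<in> polydisc J s" "y = \<phi> x z" unfolding cu_leaf_def by blast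
    have "norm (\<phi> x z - \<phi> x 0) \<le> \<beta> * norm (z - 0)"
      using z polydisc_mono[OF s(2)] r(1) by (intro r(4) x) (auto intro: zero_in_polydisc)
    also have "\<dots> \<le> \<beta> * (real CARD('n) * s)"
      using norm_le_of_polydisc[OF z(1) s(1)] r(3) by simp
    finally show "dist y x < \<eta>" using s(3) z(2) centre[OF x] by (simp add: dist_norm)
  qed (use s r in auto)
qed

text \<open>
  Smallness in space can be traded for smallness of the parameter. This is what keeps orbits inside the
  leaves: local invariance enlarges the leaf, and closeness to the centre shrinks it back.
\<close>

lemma close_leaf_points_have_small_parameter:
  obtains r \<alpha> where "0 < r" "r \<le> 1" "0 < \<alpha>"
    "\<And>x y s. x \<in> \<Lambda> \<Longrightarrow> y \<in> leaf r x \<Longrightarrow> dist y x < \<alpha> * s \<Longrightarrow> y \<in> leaf s x"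
proof -
  obtain r \<alpha> where r: "0 < r" "r \<le> 1" "0 < \<alpha>"
    "\<And>x z z'. x \<in> \<Lambda> \<Longrightarrow> z \<in> polydisc J r \<Longrightarrow> z' \<in> polydisc J r \<Longrightarrow> \<alpha> * norm (z - z') \<le> norm (\<phi> x z - \<phi> x z')"
    using leaf_map_bilipschitz by metis
  show ?thesis
  proof (rule that[OF r(1-3)])
    fix x y s assume x: "x \<in> \<Lambda>" and y: "y \<in> leaf r x" "dist y x < \<alpha> * s"
    then obtain z where z: "z \<in> polydisc J r" "y = \<phi> x z" unfolding cu_leaf_def by blast
    have "\<alpha> * norm z \<le> dist y x"
      using r(4)[OF x z(1) zero_in_polydisc[OF r(1)]] z(2) centre[OF x] by (simp add: dist_norm)
    then have "norm z < s" using y(2) r(3) by (meson le_less_trans mult_less_cancel_left_pos)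
    then have "z \<in> polydisc J s"
      using z(1) polydisc_subset_coord_space[of J r] by (intro norm_less_imp_polydisc) auto
    then show "y \<in> leaf s x" using z(2) unfolding cu_leaf_def by blast
  qed
qed

text \<open>
  A difference of leaf points is almost a vector of \<open>F x\<close>, and the inverse iterate is almost linear near
  \<open>x\<close>; the factor 2 absorbs both errors.
\<close>

lemma inverse_iterate_contracts_leaf:
  assumes b: "b > 0" and F_bound: "\<And>x v. x \<in> \<Lambda> \<Longrightarrow> v \<in> F x \<Longrightarrow> norm (G N x v) \<le> b * norm v"
  obtains r where "0 < r" "r \<le> 1"
    "\<And>x y y'. x \<in> \<Lambda> \<Longrightarrow> y \<in> leaf r x \<Longrightarrow> y' \<in> leaf r x \<Longrightarrow>
       norm ((inv f ^^ N) y - (inv f ^^ N) y') \<le> 2 * b * norm (y - y')"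
proof -
  obtain K where K: "K > 0" "\<And>x v. x \<in> \<Lambda> \<Longrightarrow> norm (G N x v) \<le> K * norm v"
    using holomorphic_map_derivative_bounded[OF holomorphic_inverse_iterate compact_set] by metis
  \<comment> \<open>Chosen so that \<open>(b + b/4) * 4/3 + b/4 < 2 * b\<close>.\<close>
  define \<kappa> where "\<kappa> = min (1/4) (b / (4 * K))"
  have \<kappa>: "\<kappa> > 0" "\<kappa> \<le> 1/4" "K * \<kappa> \<le> b / 4"
  proof -
    show "\<kappa> > 0" "\<kappa> \<le> 1/4" using b K by (auto simp: \<kappa>_def)
    have "K * \<kappa> \<le> K * (b / (4 * K))" using K by (intro mult_left_mono) (auto simp: \<kappa>_def)
    then show "K * \<kappa> \<le> b / 4" using K by simp
  qed
  obtain r1 where r1: "0 < r1" "r1 \<le> 1" "\<And>x y y'. x \<in> \<Lambda> \<Longrightarrow> y \<in> leaf r1 x \<Longrightarrow> y' \<in> leaf r1 x \<Longrightarrow>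
       \<exists>w\<in>F x. norm (y - y' - w) \<le> \<kappa> * norm w"
    using leaf_differences_almost_in_F[OF \<kappa>(1)] by metis
  have "b / 4 > 0" using b by simp
  then obtain \<delta> where \<delta>: "\<delta> > 0" "\<And>x y y'. x \<in> \<Lambda> \<Longrightarrow> dist y x < \<delta> \<Longrightarrow> dist y' x < \<delta> \<Longrightarrow>
     norm ((inv f ^^ N) y - (inv f ^^ N) y' - G N x (y - y')) \<le> b / 4 * norm (y - y')"
    using holomorphic_map_strict_derivative[OF holomorphic_inverse_iterate compact_set] by metis
  obtain r2 where r2: "0 < r2" "r2 \<le> 1" "\<And>x y. x \<in> \<Lambda> \<Longrightarrow> y \<in> leaf r2 x \<Longrightarrow> dist y x < \<delta>"
    using small_leaf[OF \<delta>(1)] by metis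
  show ?thesis
  proof (rule that[of "min r1 r2"])
    fix x y y' assume x: "x \<in> \<Lambda>" and y: "y \<in> leaf (min r1 r2) x" "y' \<in> leaf (min r1 r2) x"
    have y1: "y \<in> leaf r1 x" "y' \<in> leaf r1 x" and y2: "y \<in> leaf r2 x" "y' \<in> leaf r2 x"
      using y cu_leaf_mono[of "min r1 r2" r1 J \<phi> x] cu_leaf_mono[of "min r1 r2" r2 J \<phi> x] by auto
    let ?d = "y - y'"
    obtain w where w: "w \<in> F x" "norm (?d - w) \<le> \<kappa> * norm w" using r1(3)[OF x y1] by blast
    have w_le: "3 * norm w \<le> 4 * norm ?d"
    proof -
      have "norm w \<le> norm ?d + norm (?d - w)" by (metis norm_minus_commute norm_triangle_sub)
      moreover have "\<kappa> * norm w \<le> 1/4 * norm w" using \<kappa> by (intro mult_right_mono) auto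
      ultimately show ?thesis using w(2) by linarith
    qed
    have "norm (G N x ?d) \<le> norm (G N x w) + norm (G N x (?d - w))"
      using norm_triangle_ineq[of "G N x w" "G N x (?d - w)"] by (simp add: linear_add[OF linear_G, symmetric])
    also have "norm (G N x (?d - w)) \<le> K * (\<kappa> * norm w)"
      using K(2)[OF x, of "?d - w"] w(2) K(1) by (meson mult_left_mono less_imp_le order_trans)
    also have "K * (\<kappa> * norm w) \<le> b / 4 * norm w"
      using mult_right_mono[OF \<kappa>(3), of "norm w"] by (simp add: mult.assoc)
    also have "norm (G N x w) \<le> b * norm w" by (rule F_bound[OF x w(1)])
    finally have "norm (G N x ?d) \<le> b * norm w + b / 4 * norm w" by simp
    also have "\<dots> = (5 * b / 12) * (3 * norm w)" by (simp add: algebra_simps)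
    also have "\<dots> \<le> (5 * b / 12) * (4 * norm ?d)" using w_le b by (intro mult_left_mono) auto
    finally have "norm (G N x ?d) \<le> 5 / 3 * (b * norm ?d)" by (simp add: algebra_simps)
    moreover have "norm ((inv f ^^ N) y - (inv f ^^ N) y' - G N x ?d) \<le> b / 4 * norm ?d"
      by (intro \<delta>(2) x r2(3) y2)
    moreover have "norm ((inv f ^^ N) y - (inv f ^^ N) y') \<le>
        norm (G N x ?d) + norm ((inv f ^^ N) y - (inv f ^^ N) y' - G N x ?d)"
      by (rule norm_triangle_sub)
    moreover have "0 \<le> b * norm ?d" using b by simp
    ultimately show "norm ((inv f ^^ N) y - (inv f ^^ N) y') \<le> 2 * b * norm ?d" by simp
  qed (use r1 r2 in auto)
qed

section \<open>Uniform hyperbolicity implies forward expansivity\<close>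

text \<open>
  Local invariance is assumed for the inverse map only. But \<open>f\<close> inverse maps a leaf at \<open>f x\<close> injectively
  into the leaf at \<open>x\<close>, of the same dimension, so its image contains a neighbourhood of \<open>x\<close> in that leaf,
  of a size that the bi-Lipschitz bounds control.
\<close>

lemma forward_step_into_leaf:
  assumes s0: "s > 0"
  obtains \<rho> where "0 < \<rho>" "\<rho> \<le> 1" "\<And>x y. x \<in> \<Lambda> \<Longrightarrow> y \<in> leaf \<rho> x \<Longrightarrow> f y \<in> leaf s (f x)"
proof -
  let ?S = "coord_space J"
  obtain r \<alpha> \<beta> where r: "0 < r" "r \<le> 1" "0 < \<alpha>" "0 < \<beta>"
    "\<And>x z z'. x \<in> \<Lambda> \<Longrightarrow> z \<in> polydisc J r \<Longrightarrow> z' \<in> polydisc J r \<Longrightarrow>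
       \<alpha> * norm (z - z') \<le> norm (\<phi> x z - \<phi> x z') \<and> norm (\<phi> x z - \<phi> x z') \<le> \<beta> * norm (z - z')"
    using leaf_map_bilipschitz by metis
  have Lip0: "holomorphic_map (f ^^ 1)" by (rule holomorphic_iterate)
  obtain K where K: "K > 0" "\<And>x v. x \<in> \<Lambda> \<Longrightarrow> norm (D 1 x v) \<le> K * norm v"
    using holomorphic_map_derivative_bounded[OF Lip0 compact_set] by metis
  obtain \<delta> where \<delta>: "\<delta> > 0" "\<And>x y y'. x \<in> \<Lambda> \<Longrightarrow> dist y x < \<delta> \<Longrightarrow> dist y' x < \<delta> \<Longrightarrow>
     norm ((f ^^ 1) y - (f ^^ 1) y' - D 1 x (y - y')) \<le> 1 * norm (y - y')"
    using holomorphic_map_strict_derivative[OF Lip0 compact_set zero_less_one] by metis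
  have Lip: "norm (f y - f x) \<le> (K + 1) * norm (y - x)" if "x \<in> \<Lambda>" "dist y x < \<delta>" for x y
    using \<delta>(2)[OF that, of x] \<delta>(1) K(2)[OF that(1), of "y - x"] norm_triangle_sub[of "f y - f x" "D 1 x (y - x)"]
    by (simp add: algebra_simps)
  obtain r1 where r1: "0 < r1" "r1 \<le> 1" "\<And>x y. x \<in> \<Lambda> \<Longrightarrow> y \<in> leaf r1 x \<Longrightarrow> dist y x < \<delta>"
    using small_leaf[OF \<delta>(1)] by metis
  define t where "t = min (r / 2) r1"
  have t: "0 < t" "t < 1" "t \<le> r" "t \<le> r1" using r r1 by (auto simp: t_def)
  obtain u where u: "0 < u" "u \<le> 1" "\<And>x y. x \<in> \<Lambda> \<Longrightarrow> y \<in> leaf u x \<Longrightarrow> inv f y \<in> leaf t (inv f x)"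
    using inverse_step_into_leaf[OF t(1,2)] by metis
  define v where "v = min (min u r) s / 2"
  have v: "0 < v" "v < u" "v < r" "v < s" using u r s0 by (auto simp: v_def)
  define R where "R = \<alpha> * v / ((K + 1) * \<beta>)"
  have R: "R > 0" using r v K by (simp add: R_def)
  have sub1: "polydisc J r \<subseteq> polydisc J 1" by (intro polydisc_mono r)
  have cov: "?S \<inter> ball 0 R \<subseteq> {z'. f (\<phi> x z') \<in> leaf s (f x)}" if x: "x \<in> \<Lambda>" for x
  proof -
    have fx: "f x \<in> \<Lambda>" using iterate_in_set[OF x, of 1] by simp
    have inv_fx: "inv f (f x) = x" using bij_f by (simp add: bij_is_inj)
    obtain g where g: "homeomorphism (polydisc J 1) (\<phi> x ` polydisc J 1) (\<phi> x) g"
      using leaf_map_homeomorphism[OF x] by blast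
    \<comment> \<open>The map \<open>f\<close> inverse in leaf parameters, from the leaf at \<open>f x\<close> to that at \<open>x\<close>.\<close>
    define h where "h z = g (inv f (\<phi> (f x) z))" for z
    have in_poly: "z \<in> polydisc J u \<inter> polydisc J r" if "z \<in> ?S \<inter> cball 0 v" for z
      using that v by (auto intro!: norm_less_imp_polydisc)
    have h: "h z \<in> polydisc J t" "\<phi> x (h z) = inv f (\<phi> (f x) z)" if z: "z \<in> polydisc J u" for z
    proof -
      have "\<phi> (f x) z \<in> leaf u (f x)" using z unfolding cu_leaf_def by blast
      then have "inv f (\<phi> (f x) z) \<in> leaf t x" using u(3)[OF fx] inv_fx by simp
      then obtain z' where z': "z' \<in> polydisc J t" "inv f (\<phi> (f x) z) = \<phi> x z'" unfolding cu_leaf_def by blast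
      moreover have "z' \<in> polydisc J 1" using z'(1) polydisc_mono[OF t(3)] sub1 by blast
      ultimately have "h z = z'" using homeomorphism_apply1[OF g] by (simp add: h_def)
      then show "h z \<in> polydisc J t" "\<phi> x (h z) = inv f (\<phi> (f x) z)" using z' by auto
    qed
    have fh: "f (\<phi> x (h z)) = \<phi> (f x) z" if "z \<in> polydisc J u" for z
      using h(2)[OF that] bij_f by (simp add: bij_is_surj surj_f_inv_f)
    have "?S \<inter> ball 0 R \<subseteq> h ` (?S \<inter> ball 0 v)"
    proof (rule injective_map_covers_ball[OF subspace_coord_space subspace_coord_space order_refl])
      have c1: "continuous_on (?S \<inter> cball 0 v) (\<phi> (f x))"
      proof -
        obtain g' where "homeomorphism (polydisc J 1) (\<phi> (f x) ` polydisc J 1) (\<phi> (f x)) g'"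
          using leaf_map_homeomorphism[OF fx] by blast
        then show ?thesis
          using in_poly sub1 by (intro continuous_on_subset[OF homeomorphism_cont1]) auto
      qed
      have c2: "continuous_on (?S \<inter> cball 0 v) (\<lambda>z. inv f (\<phi> (f x) z))"
        using holomorphic_map_continuous[OF holomorphic_inverse_iterate[of 1], of UNIV] c1
        by (auto intro: continuous_on_compose2)
      have "(\<lambda>z. inv f (\<phi> (f x) z)) ` (?S \<inter> cball 0 v) \<subseteq> \<phi> x ` polydisc J 1"
      proof (rule image_subsetI)
        fix z assume "z \<in> ?S \<inter> cball 0 v"
        then have "z \<in> polydisc J u" using in_poly by blast
        from h[OF this] show "inv f (\<phi> (f x) z) \<in> \<phi> x ` polydisc J 1"
          using polydisc_mono[of t 1 J] t(2) by (intro image_eqI[of _ _ "h z"]) auto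
      qed
      then show "continuous_on (?S \<inter> cball 0 v) h"
        unfolding h_def by (rule continuous_on_compose2[OF homeomorphism_cont2[OF g] c2])
      show "inj_on h (?S \<inter> cball 0 v)"
      proof (rule inj_onI)
        fix z z' assume z: "z \<in> ?S \<inter> cball 0 v" "z' \<in> ?S \<inter> cball 0 v" and eq: "h z = h z'"
        have "\<phi> (f x) z = \<phi> (f x) z'" using fh[of z] fh[of z'] eq in_poly z by simp
        then show "z = z'" using inj_leaf_map[OF fx] in_poly z sub1 by (meson IntD2 inj_onD subsetD)
      qed
      show "h ` (?S \<inter> cball 0 v) \<subseteq> ?S"
        using h(1) in_poly polydisc_subset_coord_space[of J t] by blast
      show "h 0 = 0"
        using homeomorphism_apply1[OF g zero_in_polydisc] by (simp add: h_def centre fx x inv_fx)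
      show "v > 0" by (rule v)
      fix z assume z: "z \<in> ?S" "norm z = v"
      then have zu: "z \<in> polydisc J u" and zr: "z \<in> polydisc J r" using in_poly by auto
      have hr: "h z \<in> polydisc J r" using h(1)[OF zu] polydisc_mono[OF t(3)] by blast
      have "dist (\<phi> x (h z)) x < \<delta>"
      proof (rule r1(3)[OF x])
        show "\<phi> x (h z) \<in> leaf r1 x"
          using h(1)[OF zu] polydisc_mono[OF t(4)] unfolding cu_leaf_def by blast
      qed
      from Lip[OF x this] have "norm (\<phi> (f x) z - f x) \<le> (K + 1) * norm (\<phi> x (h z) - x)"
        using fh[OF zu] by simp
      also have "\<dots> \<le> (K + 1) * (\<beta> * norm (h z))"
        using r(5)[OF x hr zero_in_polydisc[OF r(1)]] K(1) by (intro mult_left_mono) (auto simp: centre[OF x])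
      finally have "norm (\<phi> (f x) z - f x) \<le> (K + 1) * \<beta> * norm (h z)" by (simp add: mult.assoc)
      moreover have "\<alpha> * v \<le> norm (\<phi> (f x) z - f x)"
        using r(5)[OF fx zr zero_in_polydisc[OF r(1)]] z(2) by (simp add: centre[OF fx])
      ultimately have "\<alpha> * v \<le> (K + 1) * \<beta> * norm (h z)" by linarith
      then show "R \<le> norm (h z)" using K(1) r(4) by (simp add: R_def pos_divide_le_eq mult.commute)
    qed
    moreover have "f (\<phi> x (h z)) \<in> leaf s (f x)" if "z \<in> ?S \<inter> ball 0 v" for z
    proof -
      have "z \<in> ?S \<inter> cball 0 v" using that by auto
      then have "f (\<phi> x (h z)) = \<phi> (f x) z" using fh in_poly by blast
      moreover have "z \<in> polydisc J s" using that v by (auto intro!: norm_less_imp_polydisc)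
      ultimately show ?thesis unfolding cu_leaf_def by blast
    qed
    ultimately show ?thesis by blast
  qed
  define \<rho> where "\<rho> = min 1 (R / (2 * real CARD('n)))"
  have \<rho>': "0 < \<rho>" "\<rho> \<le> 1" "real CARD('n) * \<rho> < R"
  proof -
    show "0 < \<rho>" "\<rho> \<le> 1" using R by (auto simp: \<rho>_def)
    have "real CARD('n) * \<rho> \<le> real CARD('n) * (R / (2 * real CARD('n)))"
      by (intro mult_left_mono) (auto simp: \<rho>_def)
    also have "\<dots> = R / 2" by simp
    also have "\<dots> < R" using R by linarith
    finally show "real CARD('n) * \<rho> < R" .
  qed
  show ?thesis
  proof (rule that[OF \<rho>'(1,2)])
    fix x y assume x: "x \<in> \<Lambda>" and "y \<in> leaf \<rho> x"
    then obtain z where z: "z \<in> polydisc J \<rho>" "y = \<phi> x z" unfolding cu_leaf_def by blast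
    have "norm z < R" using norm_le_of_polydisc[OF z(1) \<rho>'(1)] \<rho>'(3) by linarith
    then have "z \<in> ?S \<inter> ball 0 R" using z(1) polydisc_subset_coord_space[of J \<rho>] by auto
    then show "f y \<in> leaf s (f x)" using cov[OF x] z(2) by blast
  qed
qed

text \<open>
  If the orbits of \<open>y\<close> and \<open>x\<close> stay \<open>c\<close>-close forever, then \<open>y\<close> stays in small leaves, and there
  the inverse of the \<open>N\<close>-th iterate halves distances: pulling back from time \<open>N k\<close> shows that \<open>y\<close> and \<open>x\<close>
  are \<open>c 2\<^sup>-\<^sup>k\<close>-close for all \<open>k\<close>.
\<close>

theorem unstable_imp_forward_expansive:
  assumes "unstable_direction f \<Lambda> F"
  shows "cu_forward_expansive f \<Lambda> J \<phi>"
proof -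
  obtain C' \<theta> where C': "C' > 0" "0 < \<theta>" "\<theta> < 1"
    "\<And>m x. x \<in> \<Lambda> \<Longrightarrow> opnorm_on (G m x) (F x) \<le> C' * \<theta> ^ m"
    using assms unfolding unstable_direction_def by blast
  have "(\<lambda>m. C' * \<theta> ^ m) \<longlonglongrightarrow> C' * 0"
    using C' by (intro tendsto_mult LIMSEQ_realpow_zero tendsto_const) auto
  then have "\<forall>\<^sub>F m in sequentially. C' * \<theta> ^ m < 1/4" by (rule order_tendstoD) simp
  then obtain N where N: "C' * \<theta> ^ N < 1/4"
    using eventually_happens trivial_limit_sequentially by blast
  have quarter: "norm (G N x v) \<le> 1/4 * norm v" if "x \<in> \<Lambda>" "v \<in> F x" for x v
  proof -
    have "norm (G N x v) \<le> opnorm_on (G N x) (F x) * norm v"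
      by (rule norm_le_opnorm_on[OF linear_G subspace_F[OF that(1)] that(2)])
    also have "\<dots> \<le> 1/4 * norm v" using C'(4)[OF that(1), of N] N by (intro mult_right_mono) auto
    finally show ?thesis .
  qed
  obtain r0 where r0: "0 < r0" "\<And>x y y'. x \<in> \<Lambda> \<Longrightarrow> y \<in> leaf r0 x \<Longrightarrow> y' \<in> leaf r0 x \<Longrightarrow>
       norm ((inv f ^^ N) y - (inv f ^^ N) y') \<le> 2 * (1/4) * norm (y - y')"
    using inverse_iterate_contracts_leaf[of "1/4" N] quarter by (metis zero_less_divide_1_iff zero_less_numeral)
  obtain r1 \<alpha> where r1: "0 < r1" "0 < \<alpha>"
    "\<And>x y s. x \<in> \<Lambda> \<Longrightarrow> y \<in> leaf r1 x \<Longrightarrow> dist y x < \<alpha> * s \<Longrightarrow> y \<in> leaf s x"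
    using close_leaf_points_have_small_parameter by metis
  have "min r0 r1 > 0" using r0 r1 by simp
  then obtain \<rho>' where \<rho>': "0 < \<rho>'" "\<rho>' \<le> 1" "\<And>x y. x \<in> \<Lambda> \<Longrightarrow> y \<in> leaf \<rho>' x \<Longrightarrow> f y \<in> leaf (min r0 r1) (f x)"
    using forward_step_into_leaf by metis
  define \<rho> where "\<rho> = min \<rho>' r0"
  have \<rho>: "0 < \<rho>" "\<rho> \<le> 1" using \<rho>' r0 by (auto simp: \<rho>_def)
  \<comment> \<open>Small enough for \<open>c\<close>-close points of a leaf to lie in the leaf of size \<open>\<rho>\<close>.\<close>
  define c where "c = \<alpha> * \<rho> / 2"
  have c: "0 < c" "c < \<alpha> * \<rho>" using \<rho> r1 by (auto simp: c_def)
  have stay: "(f ^^ m) y \<in> leaf \<rho> ((f ^^ m) x)"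
    if x: "x \<in> \<Lambda>" and y: "y \<in> leaf \<rho> x" and close: "\<And>m. dist ((f ^^ m) y) ((f ^^ m) x) \<le> c" for x y m
  proof (induction m)
    case (Suc m)
    have xm: "(f ^^ m) x \<in> \<Lambda>" "(f ^^ Suc m) x \<in> \<Lambda>" by (rule iterate_in_set[OF x])+
    have "(f ^^ m) y \<in> leaf \<rho>' ((f ^^ m) x)"
      using Suc cu_leaf_mono[of \<rho> \<rho>' J \<phi>] by (auto simp: \<rho>_def)
    then have "(f ^^ Suc m) y \<in> leaf (min r0 r1) ((f ^^ Suc m) x)" using \<rho>'(3)[OF xm(1)] by simp
    then have "(f ^^ Suc m) y \<in> leaf r1 ((f ^^ Suc m) x)" using cu_leaf_mono[of "min r0 r1" r1 J \<phi>] by auto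
    then show ?case using r1(3)[OF xm(2)] close[of "Suc m"] c(2) by (meson le_less_trans)
  qed (use y in simp)
  show ?thesis
    unfolding cu_forward_expansive_def
  proof (rule exI[of _ \<rho>], rule exI[of _ c], intro conjI ballI impI \<rho> c(1))
    fix x y assume x: "x \<in> \<Lambda>" and y: "y \<in> leaf \<rho> x" and "y \<noteq> x"
    show "\<exists>m. dist ((f ^^ m) y) ((f ^^ m) x) > c"
    proof (rule ccontr)
      assume "\<not> (\<exists>m. dist ((f ^^ m) y) ((f ^^ m) x) > c)"
      then have close: "\<And>m. dist ((f ^^ m) y) ((f ^^ m) x) \<le> c" by (simp add: not_less)
      have lower: "norm (y - x) \<le> (1/2) ^ k * norm ((f ^^ (N * k)) y - (f ^^ (N * k)) x)" for k
      proof (induction k)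
        case (Suc k)
        let ?y = "(f ^^ (N * Suc k)) y" and ?x = "(f ^^ (N * Suc k)) x"
        have pullback: "(inv f ^^ N) ((f ^^ (N * Suc k)) z) = (f ^^ (N * k)) z" for z
          by (simp add: funpow_add iterate_cancel)
        have x': "?x \<in> \<Lambda>" by (rule iterate_in_set[OF x])
        have "?y \<in> leaf r0 ?x" using stay[OF x y close] cu_leaf_mono[of \<rho> r0 J \<phi>] by (auto simp: \<rho>_def)
        from r0(2)[OF x' this centre_in_leaf[OF x' r0(1)]]
        have "norm ((f ^^ (N * k)) y - (f ^^ (N * k)) x) \<le> 1/2 * norm (?y - ?x)"
          unfolding pullback by simp
        then have "(1/2) ^ k * norm ((f ^^ (N * k)) y - (f ^^ (N * k)) x) \<le> (1/2) ^ k * (1/2 * norm (?y - ?x))"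
          by (intro mult_left_mono) auto
        with Suc show ?case by (simp only: power_Suc mult_ac)
      qed simp
      have "(1/2) ^ k * norm ((f ^^ (N * k)) y - (f ^^ (N * k)) x) \<le> (1/2) ^ k * c" for k
        using close[of "N * k"] by (intro mult_left_mono) (auto simp: dist_norm)
      note order_trans[OF lower this]
      then have "norm (y - x) \<le> c * (1/2) ^ k" for k by (simp only: mult.commute[of c])
      then have "y - x = 0" by (rule eq_0_if_norm_le_geometric) auto
      then show False using \<open>y \<noteq> x\<close> by simp
    qed
  qed
qed

section \<open>Forward expansive leaves are dynamically defined\<close>

text \<open>
  Otherwise there are leaf points with parameters of norm at least \<open>\<delta>\<close> that stay close for
  longer and longer times, and a limit of them contradicts expansivity.
\<close>

lemma uniform_expansivity:
  assumes exp: "\<And>x y. x \<in> \<Lambda> \<Longrightarrow> y \<in> leaf \<epsilon> x \<Longrightarrow> y \<noteq> x \<Longrightarrow> \<exists>m. dist ((f ^^ m) y) ((f ^^ m) x) > c"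
    and \<rho>: "\<rho> < \<epsilon>" "\<epsilon> \<le> 1" and \<delta>: "\<delta> > 0"
  obtains M where "\<And>x z. x \<in> \<Lambda> \<Longrightarrow> z \<in> coord_space J \<Longrightarrow> norm z \<le> \<rho> \<Longrightarrow>
      (\<And>j. j \<le> M \<Longrightarrow> dist ((f ^^ j) (\<phi> x z)) ((f ^^ j) x) \<le> c) \<Longrightarrow> norm z < \<delta>"
proof (rule ccontr)
  let ?K = "coord_space J \<inter> cball 0 \<rho>"
  let ?A = "\<Lambda> \<times> (?K \<inter> {z. \<delta> \<le> norm z})"
  assume no_time: "\<not> thesis"
  have "\<exists>q\<in>?A. \<forall>j\<le>M. dist ((f ^^ j) (\<phi> (fst q) (snd q))) ((f ^^ j) (fst q)) \<le> c" for M
  proof (rule ccontr)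
    assume none: "\<not> ?thesis"
    have "norm z < \<delta>" if "x \<in> \<Lambda>" "z \<in> coord_space J" "norm z \<le> \<rho>"
        "\<And>j. j \<le> M \<Longrightarrow> dist ((f ^^ j) (\<phi> x z)) ((f ^^ j) x) \<le> c" for x z
    proof (rule ccontr)
      assume "\<not> norm z < \<delta>"
      then have "(x, z) \<in> ?A" using that by auto
      with none that(4) show False by fastforce
    qed
    with that[of M] no_time show False by blast
  qed
  then obtain X where X: "\<And>M. X M \<in> ?A"
    "\<And>M j. j \<le> M \<Longrightarrow> dist ((f ^^ j) (\<phi> (fst (X M)) (snd (X M)))) ((f ^^ j) (fst (X M))) \<le> c" by metis
  have compK: "compact ?K" "?K \<subseteq> polydisc J 1"
    using \<rho> by (auto intro!: closed_Int_compact closed_subspace subspace_coord_space norm_less_imp_polydisc)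
  have "compact (?K \<inter> {z. \<delta> \<le> norm z})"
    by (intro compact_Int_closed compK closed_Collect_le continuous_intros)
  then have "compact ?A" by (intro compact_Times compact_set)
  then obtain q \<sigma> where q: "q \<in> ?A" "strict_mono \<sigma>" "(X \<circ> \<sigma>) \<longlonglongrightarrow> q"
    using X(1) unfolding compact_def by blast
  let ?x = "fst q" and ?z = "snd q"
  have bound: "dist ((f ^^ j) (\<phi> ?x ?z)) ((f ^^ j) ?x) \<le> c" for j
  proof -
    let ?d = "\<lambda>q. dist ((f ^^ j) (case q of (x, z) \<Rightarrow> \<phi> x z)) ((f ^^ j) (fst q))"
    have cont: "continuous_on ?A (\<lambda>q. case q of (x, z) \<Rightarrow> \<phi> x z)"
      by (rule continuous_on_subset[OF leaf_map_jointly_continuous[OF compK]]) auto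
    have "continuous_on ?A (\<lambda>q. (f ^^ j) (case q of (x, z) \<Rightarrow> \<phi> x z))"
      by (rule continuous_on_compose2[OF holomorphic_map_continuous[OF holomorphic_iterate, of UNIV] cont]) auto
    moreover have "continuous_on ?A (\<lambda>q. (f ^^ j) (fst q))"
      by (rule continuous_on_compose2[OF holomorphic_map_continuous[OF holomorphic_iterate, of UNIV]
            continuous_on_fst[OF continuous_on_id]]) auto
    ultimately have "continuous_on ?A ?d" by (rule continuous_on_dist)
    then have "(\<lambda>n. ?d ((X \<circ> \<sigma>) n)) \<longlonglongrightarrow> ?d q"
      by (rule continuous_on_tendsto_compose[OF _ q(3,1)]) (use X(1) in auto)
    moreover have "\<forall>n\<ge>j. ?d ((X \<circ> \<sigma>) n) \<le> c"
      using X(2)[of j "\<sigma> _"] seq_suble[OF q(2)] by (auto simp: case_prod_unfold intro: order_trans)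
    ultimately have "?d q \<le> c" by (meson LIMSEQ_le_const2)
    then show ?thesis by (simp add: case_prod_unfold)
  qed
  have x: "?x \<in> \<Lambda>" and z: "?z \<in> coord_space J" "norm ?z \<le> \<rho>" "\<delta> \<le> norm ?z" using q(1) by auto
  have poly: "?z \<in> polydisc J \<epsilon>" "?z \<in> polydisc J 1"
    using z \<rho> by (auto intro!: norm_less_imp_polydisc)
  have "\<phi> ?x ?z \<noteq> ?x"
  proof
    assume "\<phi> ?x ?z = ?x"
    then have "?z = 0"
      using inj_onD[OF inj_leaf_map[OF x], of ?z 0] centre[OF x] poly(2) by (simp add: zero_in_polydisc)
    then show False using z(3) \<delta> by simp
  qed
  moreover have "\<phi> ?x ?z \<in> leaf \<epsilon> ?x" using poly(1) unfolding cu_leaf_def by blast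
  ultimately show False using exp[OF x] bound by (meson not_less)
qed

text \<open>
  Finitely many applications of local invariance. In the theorem below this covers the first \<open>M\<close> steps,
  before uniform expansivity has enough past to look at.
\<close>

lemma inverse_iterates_into_leaf:
  assumes "0 < s" "s < 1"
  shows "\<exists>r. 0 < r \<and> r \<le> s \<and> (\<forall>m\<le>M. \<forall>x\<in>\<Lambda>. \<forall>y\<in>leaf r x. (inv f ^^ m) y \<in> leaf s ((inv f ^^ m) x))"
proof (induction M)
  case 0
  then show ?case using assms by (intro exI[of _ s]) auto
next
  case (Suc M)
  then obtain r where r: "0 < r" "r \<le> s" "\<forall>m\<le>M. \<forall>x\<in>\<Lambda>. \<forall>y\<in>leaf r x. (inv f ^^ m) y \<in> leaf s ((inv f ^^ m) x)"
    by blast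
  obtain t where t: "0 < t" "\<And>x y. x \<in> \<Lambda> \<Longrightarrow> y \<in> leaf t x \<Longrightarrow> inv f y \<in> leaf r (inv f x)"
    using inverse_step_into_leaf[of r] r assms by (metis le_less_trans)
  have "(inv f ^^ m) y \<in> leaf s ((inv f ^^ m) x)"
    if m: "m \<le> Suc M" and x: "x \<in> \<Lambda>" and y: "y \<in> leaf (min r t) x" for m x y
  proof (cases m)
    case 0
    then show ?thesis using y r(2) cu_leaf_mono[of "min r t" s J \<phi> x] by (auto simp: min_le_iff_disj)
  next
    case (Suc m')
    have "inv f y \<in> leaf r (inv f x)" using t(2)[OF x] y cu_leaf_mono[of "min r t" t J \<phi> x] by auto
    moreover have "inv f x \<in> \<Lambda>" using inverse_iterate_in_set[OF x, of 1] by simp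
    ultimately show ?thesis using r(3) m Suc by (simp add: funpow_swap1)
  qed
  then show ?case using r t by (intro exI[of _ "min r t"]) auto
qed

text \<open>
  Suppose that the inverse orbit of a leaf point has stayed in leaves of size \<open>s\<close> up to some time beyond
  \<open>M\<close>. One more step leads at most into a leaf of size \<open>r\<close>. From there the forward orbit retraces \<open>M\<close>
  steps close to the orbit of \<open>x\<close>, so by uniform expansivity the parameter is below \<open>s\<close> again. The same
  argument with arbitrarily small bounds shows that the orbits converge.
\<close>

theorem forward_expansive_imp_dynamically_defined:
  assumes "cu_forward_expansive f \<Lambda> J \<phi>"
  shows "dynamically_defined f \<Lambda> J \<phi>"
  unfolding dynamically_defined_def
proof (intro allI impI)
  fix \<eta> :: real assume \<eta>: "\<eta> > 0"
  obtain \<epsilon> c where \<epsilon>: "0 < \<epsilon>" "\<epsilon> \<le> 1" "c > 0"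
    "\<And>x y. x \<in> \<Lambda> \<Longrightarrow> y \<in> leaf \<epsilon> x \<Longrightarrow> y \<noteq> x \<Longrightarrow> \<exists>m. dist ((f ^^ m) y) ((f ^^ m) x) > c"
    using assms unfolding cu_forward_expansive_def by blast
  have "min c \<eta> > 0" using \<epsilon> \<eta> by simp
  then obtain r0 where r0: "0 < r0" "\<And>x y. x \<in> \<Lambda> \<Longrightarrow> y \<in> leaf r0 x \<Longrightarrow> dist y x < min c \<eta>"
    using small_leaf by metis
  define r where "r = min (min r0 (1/2)) (\<epsilon> / (2 * real CARD('n)))"
  have r: "0 < r" "r < 1" "r \<le> r0" using r0 \<epsilon> by (auto simp: r_def)
  define \<rho> where "\<rho> = \<epsilon> / 2"
  have \<rho>: "\<rho> < \<epsilon>" using \<epsilon> by (simp add: \<rho>_def)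
  have param: "norm z \<le> \<rho>" if "z \<in> polydisc J r" for z
  proof -
    have "norm z \<le> real CARD('n) * r" by (rule norm_le_of_polydisc[OF that r(1)])
    also have "\<dots> \<le> real CARD('n) * (\<epsilon> / (2 * real CARD('n)))"
      by (intro mult_left_mono) (auto simp: r_def)
    finally show ?thesis by (simp add: \<rho>_def)
  qed
  obtain s0 where s0: "0 < s0" "\<And>x y. x \<in> \<Lambda> \<Longrightarrow> y \<in> leaf s0 x \<Longrightarrow> inv f y \<in> leaf r (inv f x)"
    using inverse_step_into_leaf[OF r(1,2)] by metis
  define s where "s = min s0 r"
  have s: "0 < s" "s < 1" "s \<le> r" "s \<le> s0" using s0 r by (auto simp: s_def)
  obtain M where M: "\<And>x z. x \<in> \<Lambda> \<Longrightarrow> z \<in> coord_space J \<Longrightarrow> norm z \<le> \<rho> \<Longrightarrow>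
      (\<And>j. j \<le> M \<Longrightarrow> dist ((f ^^ j) (\<phi> x z)) ((f ^^ j) x) \<le> c) \<Longrightarrow> norm z < s"
    using uniform_expansivity[OF \<epsilon>(4) \<rho> \<epsilon>(2) s(1)] by blast
  obtain t where t: "0 < t" "t \<le> s"
    "\<And>m x y. m \<le> M \<Longrightarrow> x \<in> \<Lambda> \<Longrightarrow> y \<in> leaf t x \<Longrightarrow> (inv f ^^ m) y \<in> leaf s ((inv f ^^ m) x)"
    using inverse_iterates_into_leaf[OF s(1,2), of M] by blast
  have shift: "(f ^^ j) ((inv f ^^ m) y) = (inv f ^^ (m - j)) y" if "j \<le> m" for j m y
    using iterate_cancel(1)[of j "(inv f ^^ (m - j)) y"] funpow_add[of j "m - j" "inv f"] that by simp
  \<comment> \<open>The map \<open>f\<close> takes the point at time \<open>m\<close> back to the points at times \<open>m - j\<close>, which are known to be close.\<close>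
  have recent: "norm z < \<delta>"
    if x: "x \<in> \<Lambda>" and z: "z \<in> polydisc J r" "(inv f ^^ m) y = \<phi> ((inv f ^^ m) x) z" and m: "M' \<le> m"
      and M': "\<And>x z. x \<in> \<Lambda> \<Longrightarrow> z \<in> coord_space J \<Longrightarrow> norm z \<le> \<rho> \<Longrightarrow>
        (\<And>j. j \<le> M' \<Longrightarrow> dist ((f ^^ j) (\<phi> x z)) ((f ^^ j) x) \<le> c) \<Longrightarrow> norm z < \<delta>"
      and close: "\<And>i. i \<le> m \<Longrightarrow> (inv f ^^ i) y \<in> leaf r0 ((inv f ^^ i) x)" for x y z m M' \<delta>
  proof (rule M'[of "(inv f ^^ m) x"])
    show "(inv f ^^ m) x \<in> \<Lambda>" by (rule inverse_iterate_in_set[OF x])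
    show "z \<in> coord_space J" "norm z \<le> \<rho>" using z(1) polydisc_subset_coord_space[of J r] param by auto
    fix j assume "j \<le> M'"
    then have "j \<le> m" using m by simp
    have "dist ((inv f ^^ (m - j)) y) ((inv f ^^ (m - j)) x) < min c \<eta>"
      by (intro r0(2) inverse_iterate_in_set x close) simp
    then show "dist ((f ^^ j) (\<phi> ((inv f ^^ m) x) z)) ((f ^^ j) ((inv f ^^ m) x)) \<le> c"
      using shift[OF \<open>j \<le> m\<close>] z(2)[symmetric] by simp
  qed
  have stay: "(inv f ^^ m) y \<in> leaf s ((inv f ^^ m) x)" if x: "x \<in> \<Lambda>" and y: "y \<in> leaf t x" for x y m
  proof (induction m rule: less_induct)
    case (less m)
    show ?case
    proof (cases "m \<le> M")
      case True
      then show ?thesis using t(3) x y by blast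
    next
      case False
      then obtain m' where m': "m = Suc m'" by (cases m) auto
      have "(inv f ^^ m') y \<in> leaf s0 ((inv f ^^ m') x)"
        using less[of m'] m' cu_leaf_mono[OF s(4), of J \<phi>] by auto
      then have in_r: "(inv f ^^ m) y \<in> leaf r ((inv f ^^ m) x)"
        using s0(2)[OF inverse_iterate_in_set[OF x]] m' by simp
      then obtain z where z: "z \<in> polydisc J r" "(inv f ^^ m) y = \<phi> ((inv f ^^ m) x) z"
        unfolding cu_leaf_def by blast
      have "norm z < s"
      proof (rule recent[OF x z _ M])
        show "M \<le> m" using False by simp
        fix i assume "i \<le> m"
        then show "(inv f ^^ i) y \<in> leaf r0 ((inv f ^^ i) x)"
          using less[of i] in_r cu_leaf_mono[of s r0 J \<phi>] cu_leaf_mono[OF r(3), of J \<phi>] s(3) r(3)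
          by (cases "i = m") auto
      qed
      then have "z \<in> polydisc J s"
        using z(1) polydisc_subset_coord_space[of J r] by (intro norm_less_imp_polydisc) auto
      then show ?thesis using z(2) unfolding cu_leaf_def by blast
    qed
  qed
  have in_local: "y \<in> local_unstable_set f \<eta> x" if x: "x \<in> \<Lambda>" and y: "y \<in> leaf t x" for x y
  proof -
    have close: "(inv f ^^ m) y \<in> leaf r0 ((inv f ^^ m) x)" for m
      using stay[OF x y, of m] cu_leaf_mono[of s r0 J \<phi>] s(3) r(3) by auto
    have "dist ((inv f ^^ m) x) ((inv f ^^ m) y) \<le> \<eta>" for m
      using r0(2)[OF inverse_iterate_in_set[OF x] close, of m] by (simp add: dist_commute)
    moreover have "(\<lambda>m. dist ((inv f ^^ m) x) ((inv f ^^ m) y)) \<longlonglongrightarrow> 0"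
    proof (rule metric_LIMSEQ_I)
      fix e :: real assume "e > 0"
      then obtain r' where r': "0 < r'" "\<And>x y. x \<in> \<Lambda> \<Longrightarrow> y \<in> leaf r' x \<Longrightarrow> dist y x < e"
        using small_leaf by metis
      obtain M' where M': "\<And>x z. x \<in> \<Lambda> \<Longrightarrow> z \<in> coord_space J \<Longrightarrow> norm z \<le> \<rho> \<Longrightarrow>
        (\<And>j. j \<le> M' \<Longrightarrow> dist ((f ^^ j) (\<phi> x z)) ((f ^^ j) x) \<le> c) \<Longrightarrow> norm z < r'"
        using uniform_expansivity[OF \<epsilon>(4) \<rho> \<epsilon>(2) r'(1)] by blast
      have "dist (dist ((inv f ^^ m) x) ((inv f ^^ m) y)) 0 < e" if "m \<ge> M'" for m
      proof -
        have "(inv f ^^ m) y \<in> leaf r ((inv f ^^ m) x)"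
          using stay[OF x y, of m] cu_leaf_mono[OF s(3), of J \<phi>] by blast
        then obtain z where z: "z \<in> polydisc J r" "(inv f ^^ m) y = \<phi> ((inv f ^^ m) x) z"
          unfolding cu_leaf_def by blast
        have "norm z < r'" by (rule recent[OF x z that M' close])
        then have "z \<in> polydisc J r'"
          using z(1) polydisc_subset_coord_space[of J r] by (intro norm_less_imp_polydisc) auto
        then have "(inv f ^^ m) y \<in> leaf r' ((inv f ^^ m) x)" using z(2) unfolding cu_leaf_def by blast
        from r'(2)[OF inverse_iterate_in_set[OF x] this] show ?thesis by (simp add: dist_commute)
      qed
      then show "\<exists>no. \<forall>m\<ge>no. dist (dist ((inv f ^^ m) x) ((inv f ^^ m) y)) 0 < e" by blast
    qed
    ultimately show ?thesis unfolding local_unstable_set_def unstable_set_def by blast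
  qed
  show "\<exists>\<epsilon>\<^sub>0. 0 < \<epsilon>\<^sub>0 \<and> \<epsilon>\<^sub>0 \<le> 1 \<and>
      (\<forall>x\<in>\<Lambda>. \<forall>\<epsilon>. 0 < \<epsilon> \<and> \<epsilon> < \<epsilon>\<^sub>0 \<longrightarrow> leaf \<epsilon> x \<subseteq> local_unstable_set f \<eta> x)"
  proof (intro exI[of _ t] conjI ballI allI impI subsetI)
    show "0 < t" "t \<le> 1" using t s by auto
    fix x \<epsilon> y assume "x \<in> \<Lambda>" "0 < \<epsilon> \<and> \<epsilon> < t" "y \<in> leaf \<epsilon> x"
    then show "y \<in> local_unstable_set f \<eta> x" using in_local cu_leaf_mono[of \<epsilon> t J \<phi> x] by auto
  qed
qed

section \<open>Dynamically defined leaves force uniform hyperbolicity\<close>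

text \<open>
  By definition the inverse orbits stay close to that of \<open>x\<close>. Together with local invariance this
  keeps them inside the leaves, where the contraction estimates hold.
\<close>

lemma dynamically_defined_leaves_stay:
  assumes dyn: "dynamically_defined f \<Lambda> J \<phi>" and r0: "r > 0" and \<eta>: "\<eta> > 0"
  obtains \<epsilon> where "0 < \<epsilon>" "\<epsilon> \<le> 1"
    "\<And>x y m. x \<in> \<Lambda> \<Longrightarrow> y \<in> leaf \<epsilon> x \<Longrightarrow>
       (inv f ^^ m) y \<in> leaf r ((inv f ^^ m) x) \<and> dist ((inv f ^^ m) y) ((inv f ^^ m) x) < \<eta>"
    "\<And>x y. x \<in> \<Lambda> \<Longrightarrow> y \<in> leaf \<epsilon> x \<Longrightarrow> (\<lambda>m. (inv f ^^ m) y - (inv f ^^ m) x) \<longlonglongrightarrow> 0"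
proof -
  obtain r1 \<alpha> where r1: "0 < r1" "r1 \<le> 1" "0 < \<alpha>"
    "\<And>x y s. x \<in> \<Lambda> \<Longrightarrow> y \<in> leaf r1 x \<Longrightarrow> dist y x < \<alpha> * s \<Longrightarrow> y \<in> leaf s x"
    using close_leaf_points_have_small_parameter by metis
  define t where "t = min (r1 / 2) r"
  have t: "0 < t" "t < 1" "t \<le> r1" "t \<le> r" using r1 r0 by (auto simp: t_def)
  obtain u0 where u0: "0 < u0" "\<And>x y. x \<in> \<Lambda> \<Longrightarrow> y \<in> leaf u0 x \<Longrightarrow> inv f y \<in> leaf t (inv f x)"
    using inverse_step_into_leaf[OF t(1,2)] by metis
  define u where "u = min u0 t"
  have u: "0 < u" "u \<le> u0" "u \<le> t" using u0 t by (auto simp: u_def)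
  define \<eta>' where "\<eta>' = min (\<eta> / 2) (\<alpha> * u / 2)"
  have \<eta>': "\<eta>' > 0" "\<eta>' < \<eta>" "\<eta>' < \<alpha> * u" using \<eta> r1 u by (auto simp: \<eta>'_def min_less_iff_disj)
  obtain \<epsilon>0 where \<epsilon>0: "0 < \<epsilon>0" "\<epsilon>0 \<le> 1"
    "\<forall>x\<in>\<Lambda>. \<forall>\<epsilon>. 0 < \<epsilon> \<and> \<epsilon> < \<epsilon>0 \<longrightarrow> leaf \<epsilon> x \<subseteq> local_unstable_set f \<eta>' x"
    using dyn[unfolded dynamically_defined_def, THEN spec, THEN mp, OF \<eta>'(1)] by (elim exE conjE)
  define \<epsilon> where "\<epsilon> = min u (\<epsilon>0 / 2)"
  have \<epsilon>: "0 < \<epsilon>" "\<epsilon> < \<epsilon>0" "\<epsilon> \<le> u" using u \<epsilon>0 by (auto simp: \<epsilon>_def min_less_iff_disj)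
  have loc: "y \<in> local_unstable_set f \<eta>' x" if "x \<in> \<Lambda>" "y \<in> leaf \<epsilon> x" for x y
    by (rule subsetD[OF \<epsilon>0(3)[rule_format, OF that(1) conjI[OF \<epsilon>(1,2)]] that(2)])
  have close: "dist ((inv f ^^ m) y) ((inv f ^^ m) x) \<le> \<eta>'" if "x \<in> \<Lambda>" "y \<in> leaf \<epsilon> x" for x y m
    using loc[OF that] unfolding local_unstable_set_def by (simp add: dist_commute)
  have stay: "(inv f ^^ m) y \<in> leaf u ((inv f ^^ m) x)" if x: "x \<in> \<Lambda>" and y: "y \<in> leaf \<epsilon> x" for x y m
  proof (induction m)
    case 0
    then show ?case using y cu_leaf_mono[OF \<epsilon>(3), of J \<phi>] by auto
  next
    case (Suc m)
    have "(inv f ^^ m) y \<in> leaf u0 ((inv f ^^ m) x)" using Suc cu_leaf_mono[OF u(2), of J \<phi>] by blast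
    then have "(inv f ^^ Suc m) y \<in> leaf t ((inv f ^^ Suc m) x)"
      using u0(2)[OF inverse_iterate_in_set[OF x]] by simp
    then have "(inv f ^^ Suc m) y \<in> leaf r1 ((inv f ^^ Suc m) x)" using cu_leaf_mono[OF t(3), of J \<phi>] by blast
    moreover have "dist ((inv f ^^ Suc m) y) ((inv f ^^ Suc m) x) < \<alpha> * u"
      using close[OF x y, of "Suc m"] \<eta>'(3) by linarith
    ultimately show ?case by (rule r1(4)[OF inverse_iterate_in_set[OF x]])
  qed
  show ?thesis
  proof (rule that[of \<epsilon>])
    fix x y m assume xy: "x \<in> \<Lambda>" "y \<in> leaf \<epsilon> x"
    have "(inv f ^^ m) y \<in> leaf r ((inv f ^^ m) x)"
      using stay[OF xy, of m] cu_leaf_mono[of u r J \<phi>] u(3) t(4) by auto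
    then show "(inv f ^^ m) y \<in> leaf r ((inv f ^^ m) x) \<and> dist ((inv f ^^ m) y) ((inv f ^^ m) x) < \<eta>"
      using close[OF xy, of m] \<eta>'(2) by linarith
  next
    fix x y assume xy: "x \<in> \<Lambda>" "y \<in> leaf \<epsilon> x"
    have "(\<lambda>m. dist ((inv f ^^ m) x) ((inv f ^^ m) y)) \<longlonglongrightarrow> 0"
      using loc[OF xy] unfolding local_unstable_set_def unstable_set_def by blast
    then show "(\<lambda>m. (inv f ^^ m) y - (inv f ^^ m) x) \<longlonglongrightarrow> 0"
      by (subst (asm) dist_commute) (simp add: dist_norm tendsto_norm_zero_iff)
  qed (use \<epsilon> \<epsilon>0 in auto)
qed

lemma projection_to_F:
  assumes x: "x \<in> \<Lambda>"
  obtains p where "linear p" "\<And>w. p w \<in> F x" "\<And>w. w - p w \<in> E x" "\<And>w. w \<in> F x \<Longrightarrow> p w = w"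
proof -
  have unique: "u = u'" if "u \<in> F x" "u' \<in> F x" "w - u \<in> E x" "w - u' \<in> E x" for u u' w
  proof -
    have "u - u' \<in> F x" using that subspace_diff[OF subspace_F[OF x]] by blast
    moreover have "(w - u') - (w - u) \<in> E x" using that subspace_diff[OF subspace_E[OF x]] by blast
    ultimately have "u - u' = 0" using E_F_trivial[OF x, of "u - u'"] by simp
    then show ?thesis by simp
  qed
  define p where "p w = (SOME u. u \<in> F x \<and> w - u \<in> E x)" for w
  have p: "p w \<in> F x \<and> w - p w \<in> E x" for w
    unfolding p_def by (rule someI_ex) (use splitE[OF x, of w] in \<open>metis add_diff_cancel_right'\<close>)
  have p_eq: "p w = u" if "u \<in> F x" "w - u \<in> E x" for w u
    using unique[OF _ that(1) _ that(2)] p by blast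
  show ?thesis
  proof (rule that)
    show "linear p"
    proof (rule linearI)
      fix v w
      have "v + w - (p v + p w) = (v - p v) + (w - p w)" by simp
      then show "p (v + w) = p v + p w"
        using p subspace_add[OF subspace_F[OF x]] subspace_add[OF subspace_E[OF x]] by (intro p_eq) metis+
    next
      fix c :: real and v
      have "c *\<^sub>R v - c *\<^sub>R p v = c *\<^sub>R (v - p v)" by (simp add: scaleR_diff_right)
      then show "p (c *\<^sub>R v) = c *\<^sub>R p v"
        using p subspace_scale[OF subspace_F[OF x]] subspace_scale[OF subspace_E[OF x]] by (intro p_eq) metis+
    qed
    show "p w = w" if "w \<in> F x" for w
      using that subspace_0[OF subspace_E[OF x]] by (intro p_eq) auto
  qed (use p in auto)
qed

text \<open>
  On a small leaf the projection to \<open>F x\<close> along \<open>E x\<close> shrinks distances at most by the factor 3, because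
  differences of leaf points are almost in \<open>F x\<close>. Hence it is injective, and by
  \<open>injective_map_covers_ball\<close> its image contains a ball.
\<close>

lemma leaf_is_graph_over_F:
  assumes \<epsilon>: "\<epsilon> > 0"
  obtains \<rho> where "\<rho> > 0" "\<And>x. x \<in> \<Lambda> \<Longrightarrow> \<exists>q. q 0 = x \<and>
      (\<forall>v\<in>F x. norm v < \<rho> \<longrightarrow> q v \<in> leaf \<epsilon> x \<and> q v - x - v \<in> E x) \<and>
      (\<forall>v\<in>F x. \<forall>v'\<in>F x. norm v < \<rho> \<longrightarrow> norm v' < \<rho> \<longrightarrow> norm (q v - q v') \<le> 3 * norm (v - v'))"
proof -
  let ?S = "coord_space J"
  obtain K where K: "K \<ge> 1"
    "\<forall>x\<in>\<Lambda>. \<forall>e\<in>E x. \<forall>u\<in>F x. norm e \<le> K * norm (e + u) \<and> norm u \<le> K * norm (e + u)"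
    by (rule splitting_angle)
  have "1 / (2 * K) > 0" using K(1) by simp
  then obtain r1 where r1: "0 < r1" "\<And>x y y'. x \<in> \<Lambda> \<Longrightarrow> y \<in> leaf r1 x \<Longrightarrow> y' \<in> leaf r1 x \<Longrightarrow>
       \<exists>w\<in>F x. norm (y - y' - w) \<le> 1 / (2 * K) * norm w"
    using leaf_differences_almost_in_F by metis
  obtain r2 \<alpha> where r2: "0 < r2" "r2 \<le> 1" "0 < \<alpha>"
    "\<And>x z z'. x \<in> \<Lambda> \<Longrightarrow> z \<in> polydisc J r2 \<Longrightarrow> z' \<in> polydisc J r2 \<Longrightarrow> \<alpha> * norm (z - z') \<le> norm (\<phi> x z - \<phi> x z')"
    using leaf_map_bilipschitz by metis
  define r where "r = min \<epsilon> (min r1 r2)"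
  have r: "r > 0" "r \<le> \<epsilon>" "r \<le> r1" "r \<le> r2" using \<epsilon> r1 r2 by (auto simp: r_def)
  define s where "s = r / 2"
  have s: "s > 0" "s < r" using r by (auto simp: s_def)
  define \<rho> where "\<rho> = \<alpha> * s / 3"
  have "\<rho> > 0" using s r2 by (simp add: \<rho>_def)
  show ?thesis
  proof (rule that[OF \<open>\<rho> > 0\<close>])
    fix x assume x: "x \<in> \<Lambda>"
    obtain p where p: "linear p" "\<And>w. p w \<in> F x" "\<And>w. w - p w \<in> E x" "\<And>w. w \<in> F x \<Longrightarrow> p w = w"
      using projection_to_F[OF x] by blast
    have p_bound: "norm (p w) \<le> K * norm w" for w
      using K(2)[rule_format, OF x p(3)[of w] p(2)[of w]] by simp
    have expand: "norm (y - y') \<le> 3 * norm (p (y - y'))" if y: "y \<in> leaf r1 x" "y' \<in> leaf r1 x" for y y'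
    proof -
      let ?d = "y - y'"
      obtain w where w: "w \<in> F x" "norm (?d - w) \<le> 1 / (2 * K) * norm w" using r1(2)[OF x y] by blast
      have "p ?d = w + p (?d - w)" using p(4)[OF w(1)] by (simp add: linear_diff[OF p(1)])
      moreover have "norm (p (?d - w)) \<le> norm w / 2"
      proof -
        have "norm (p (?d - w)) \<le> K * norm (?d - w)" by (rule p_bound)
        also have "\<dots> \<le> K * (1 / (2 * K) * norm w)" using w(2) K(1) by (intro mult_left_mono) auto
        also have "\<dots> = norm w / 2" using K(1) by simp
        finally show ?thesis .
      qed
      ultimately have 1: "norm w \<le> 2 * norm (p ?d)" using norm_triangle_ineq4[of "p ?d" "p (?d - w)"] by simp
      have "1 / (2 * K) * norm w \<le> 1/2 * norm w"
        using K(1) by (intro mult_right_mono) (auto simp: field_simps)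
      then have "norm ?d \<le> 3/2 * norm w" using w(2) norm_triangle_sub[of ?d w] by simp
      with 1 show ?thesis by simp
    qed
    have poly: "z \<in> polydisc J r \<and> z \<in> polydisc J r1 \<and> z \<in> polydisc J r2 \<and> z \<in> polydisc J 1"
      if "z \<in> ?S \<inter> cball 0 s" for z
      using that s r r2 by (auto intro!: norm_less_imp_polydisc)
    have in_r1: "\<phi> x z \<in> leaf r1 x" if "z \<in> ?S \<inter> cball 0 s" for z
      using poly[OF that] unfolding cu_leaf_def by blast
    \<comment> \<open>The leaf, centred at \<open>x\<close> and projected to \<open>F x\<close>.\<close>
    define h where "h z = p (\<phi> x z - x)" for z
    have h_diff: "h z - h z' = p (\<phi> x z - \<phi> x z')" for z z'
      by (simp add: h_def linear_diff[OF p(1), symmetric])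
    have cover: "F x \<inter> ball 0 \<rho> \<subseteq> h ` (?S \<inter> ball 0 s)"
    proof (rule injective_map_covers_ball[OF subspace_coord_space subspace_F[OF x]])
      show "dim (F x) \<le> dim ?S"
        using dim_image_le[OF linear_leaf_tangent[OF x], of ?S] tangent[OF x] by simp
      obtain g where "homeomorphism (polydisc J 1) (\<phi> x ` polydisc J 1) (\<phi> x) g"
        using leaf_map_homeomorphism[OF x] by blast
      then have "continuous_on (?S \<inter> cball 0 s) (\<phi> x)"
        using poly by (intro continuous_on_subset[OF homeomorphism_cont1]) auto
      then have "continuous_on (?S \<inter> cball 0 s) (\<lambda>z. \<phi> x z - x)" by (intro continuous_intros)
      then show "continuous_on (?S \<inter> cball 0 s) h"
        unfolding h_def by (rule continuous_on_compose2[OF linear_continuous_on[OF linear_conv_bounded_linear[THEN iffD1, OF p(1)], of UNIV]]) auto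
      show "inj_on h (?S \<inter> cball 0 s)"
      proof (rule inj_onI)
        fix z z' assume z: "z \<in> ?S \<inter> cball 0 s" "z' \<in> ?S \<inter> cball 0 s" and "h z = h z'"
        then have "\<phi> x z = \<phi> x z'" using expand[OF in_r1[OF z(1)] in_r1[OF z(2)]] h_diff[of z z'] by simp
        then show "z = z'" using inj_onD[OF inj_leaf_map[OF x]] poly z by blast
      qed
      show "h ` (?S \<inter> cball 0 s) \<subseteq> F x" using p(2) by (auto simp: h_def)
      show "h 0 = 0" by (simp add: h_def centre[OF x] linear_0[OF p(1)])
      show "s > 0" by (rule s)
      fix z assume z: "z \<in> ?S" "norm z = s"
      then have z': "z \<in> ?S \<inter> cball 0 s" by simp
      have "\<alpha> * s \<le> norm (\<phi> x z - x)"
        using r2(4)[OF x, of z 0] poly[OF z'] z(2) r2(1) by (simp add: zero_in_polydisc centre[OF x])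
      also have "\<dots> \<le> 3 * norm (h z)"
        using expand[OF in_r1[OF z'] centre_in_leaf[OF x r1(1)]] by (simp add: h_def)
      finally show "\<rho> \<le> norm (h z)" by (simp add: \<rho>_def)
    qed
    define q where "q v = \<phi> x (SOME z. z \<in> ?S \<inter> ball 0 s \<and> h z = v)" for v
    have q: "\<exists>z. z \<in> ?S \<inter> cball 0 s \<and> q v = \<phi> x z \<and> h z = v" if "v \<in> F x" "norm v < \<rho>" for v
    proof -
      have "v \<in> h ` (?S \<inter> ball 0 s)" by (rule subsetD[OF cover]) (use that in auto)
      then have "\<exists>z. z \<in> ?S \<inter> ball 0 s \<and> h z = v" by blast
      from someI_ex[OF this] show ?thesis unfolding q_def by fastforce
    qed
    have q_leaf: "q v \<in> leaf \<epsilon> x" "q v \<in> leaf r1 x" "p (q v - x) = v" if "v \<in> F x" "norm v < \<rho>" for v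
    proof -
      from q[OF that] obtain z where z: "z \<in> ?S \<inter> cball 0 s" "q v = \<phi> x z" "h z = v" by blast
      have "z \<in> polydisc J \<epsilon>" using poly[OF z(1)] polydisc_mono[OF r(2)] by blast
      then show "q v \<in> leaf \<epsilon> x" "q v \<in> leaf r1 x" "p (q v - x) = v"
        using z in_r1[OF z(1)] by (auto simp: cu_leaf_def h_def)
    qed
    have lip: "norm (q v - q v') \<le> 3 * norm (v - v')"
      if "v \<in> F x" "norm v < \<rho>" "v' \<in> F x" "norm v' < \<rho>" for v v'
    proof -
      have "p (q v - q v') = v - v'"
        using q_leaf(3)[OF that(1,2)] q_leaf(3)[OF that(3,4)] by (simp add: linear_diff[OF p(1)] algebra_simps)
      then show ?thesis using expand[OF q_leaf(2)[OF that(1,2)] q_leaf(2)[OF that(3,4)]] by simp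
    qed
    have "0 \<in> F x" by (rule subspace_0[OF subspace_F[OF x]])
    have "q 0 = x"
    proof -
      have "norm (q 0 - x) \<le> 3 * norm (p (q 0 - x))"
        by (rule expand[OF q_leaf(2) centre_in_leaf[OF x r1(1)]]) (use \<open>0 \<in> F x\<close> \<open>\<rho> > 0\<close> in auto)
      then show ?thesis using q_leaf(3)[OF \<open>0 \<in> F x\<close>] \<open>\<rho> > 0\<close> by simp
    qed
    moreover have "q v - x - v \<in> E x" if "v \<in> F x" "norm v < \<rho>" for v
      using p(3)[of "q v - x"] q_leaf(3)[OF that] by simp
    ultimately show "\<exists>q. q 0 = x \<and>
      (\<forall>v\<in>F x. norm v < \<rho> \<longrightarrow> q v \<in> leaf \<epsilon> x \<and> q v - x - v \<in> E x) \<and>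
      (\<forall>v\<in>F x. \<forall>v'\<in>F x. norm v < \<rho> \<longrightarrow> norm v' < \<rho> \<longrightarrow> norm (q v - q v') \<le> 3 * norm (v - v'))"
      using q_leaf(1) lip by blast
  qed
qed


lemma inverse_iterates_contract_leaf:
  assumes b: "b \<ge> 0"
    and step: "\<And>x y y'. x \<in> \<Lambda> \<Longrightarrow> y \<in> leaf r x \<Longrightarrow> y' \<in> leaf r x \<Longrightarrow>
       norm ((inv f ^^ N) y - (inv f ^^ N) y') \<le> b * norm (y - y')"
    and x: "x \<in> \<Lambda>"
    and y: "\<And>m. (inv f ^^ m) y \<in> leaf r ((inv f ^^ m) x)" "\<And>m. (inv f ^^ m) y' \<in> leaf r ((inv f ^^ m) x)"
  shows "norm ((inv f ^^ (N * k)) y - (inv f ^^ (N * k)) y') \<le> b ^ k * norm (y - y')"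
proof (induction k)
  case (Suc k)
  have "norm ((inv f ^^ (N * Suc k)) y - (inv f ^^ (N * Suc k)) y') \<le>
      b * norm ((inv f ^^ (N * k)) y - (inv f ^^ (N * k)) y')"
    using step[OF inverse_iterate_in_set[OF x] y] by (simp add: funpow_add)
  also have "\<dots> \<le> b * (b ^ k * norm (y - y'))" using Suc b by (intro mult_left_mono)
  finally show ?case by (simp add: mult.assoc)
qed simp

text \<open>
  Two difference quotients at \<open>t\<close> differ by a vector of \<open>E x\<close>. The derivative of the inverse iterate
  \<open>f\<^sup>-\<^sup>N\<^sup>k\<close> stretches such a vector by at least \<open>a\<^sup>k / K\<close>. It sends each quotient to a vector of size at most a
  multiple of \<open>b\<^sup>k\<close>, up to the error of linearisation, since it contracts the disc itself by \<open>b\<^sup>k\<close>. So the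
  quotients differ by at most a multiple of \<open>(b/a)\<^sup>k\<close>, where \<open>k\<close> is arbitrary.
\<close>

lemma backward_contracted_disc_is_holomorphic:
  fixes Q :: "complex \<Rightarrow> complex ^ 'n"
  assumes x: "x \<in> \<Lambda>" and t: "norm t < 1"
    and offset: "\<And>t t'. norm t < 1 \<Longrightarrow> norm t' < 1 \<Longrightarrow> Q t - Q t' - (t - t') *s v \<in> E x"
    and lip: "\<And>t t'. norm t < 1 \<Longrightarrow> norm t' < 1 \<Longrightarrow> norm (Q t - Q t') \<le> B * norm (t - t')" and B: "B > 0"
    and contract: "\<And>t t' k. norm t < 1 \<Longrightarrow> norm t' < 1 \<Longrightarrow>
        norm ((inv f ^^ (N * k)) (Q t) - (inv f ^^ (N * k)) (Q t')) \<le> b ^ k * norm (Q t - Q t')"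
    and expand: "\<And>t e k. norm t < 1 \<Longrightarrow> e \<in> E x \<Longrightarrow> a ^ k * norm e \<le> K * norm (G (N * k) (Q t) e)"
    and rates: "0 < b" "2 * b \<le> a" "K > 0"
  obtains w where "(Q has_derivative (\<lambda>s. s *s w)) (at t)"
    and "((\<lambda>s. inverse s *s (Q (t + s) - Q t)) \<longlongrightarrow> w) (at 0)"
proof (rule complex_derivative_Cauchy_criterion)
  fix e :: real assume e: "e > 0"
  let ?d = "\<lambda>s. inverse s *s (Q (t + s) - Q t)"
  have "(\<lambda>k. 4 * B * K * (1/2) ^ k) \<longlonglongrightarrow> 4 * B * K * 0"
    by (intro tendsto_mult LIMSEQ_realpow_zero tendsto_const) auto
  then have "\<forall>\<^sub>F k in sequentially. 4 * B * K * (1/2) ^ k < e" by (rule order_tendstoD) (use e in simp)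
  \<comment> \<open>With this \<open>k\<close>, it is enough that the error of linearising the inverse iterate is of order \<open>b\<^sup>k\<close> near \<open>Q t\<close>.\<close>
  then obtain k where k: "4 * B * K * (1/2) ^ k < e"
    using eventually_happens trivial_limit_sequentially by blast
  let ?g = "inv f ^^ (N * k)" and ?A = "G (N * k) (Q t)"
  have "b ^ k > 0" using rates by simp
  have "(?g has_derivative ?A) (at (Q t))"
    by (rule holomorphic_map_has_derivative[OF holomorphic_inverse_iterate])
  then obtain d where d: "d > 0" "\<And>y. norm (y - Q t) < d \<Longrightarrow> norm (?g y - ?g (Q t) - ?A (y - Q t)) \<le> b ^ k * norm (y - Q t)"
    using \<open>b ^ k > 0\<close> unfolding has_derivative_at_alt by blast
  define \<delta> where "\<delta> = min (1 - norm t) (d / B)"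
  have "\<delta> > 0" using t d B by (simp add: \<delta>_def)
  have quotient: "norm (t + s) < 1 \<and> norm (?A (?d s)) \<le> 2 * b ^ k * B" if s: "0 < norm s" "norm s < \<delta>" for s
  proof -
    let ?D = "Q (t + s) - Q t"
    have ts: "norm (t + s) < 1" using s norm_triangle_ineq[of t s] by (simp add: \<delta>_def)
    have D: "norm ?D \<le> B * norm s" using lip[OF ts t] by simp
    also have "\<dots> < d" using s B by (simp add: \<delta>_def field_simps)
    finally have "norm (?g (Q (t + s)) - ?g (Q t) - ?A ?D) \<le> b ^ k * norm ?D" by (rule d(2))
    moreover have "norm (?g (Q (t + s)) - ?g (Q t)) \<le> b ^ k * norm ?D" by (rule contract[OF ts t])
    ultimately have "norm (?A ?D) \<le> 2 * b ^ k * norm ?D"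
      using norm_triangle_sub[of "?A ?D" "?g (Q (t + s)) - ?g (Q t)"] by (simp add: norm_minus_commute)
    also have "\<dots> \<le> 2 * b ^ k * (B * norm s)" using D \<open>b ^ k > 0\<close> by (intro mult_left_mono) auto
    finally have "norm (?A ?D) / norm s \<le> 2 * b ^ k * B" using s by (simp add: field_simps)
    moreover have "norm (?A (?d s)) = norm (?A ?D) / norm s"
      by (simp only: holomorphic_map_derivative_smult[OF holomorphic_inverse_iterate] norm_vector_smult norm_inverse
          divide_inverse mult.commute)
    ultimately show ?thesis using ts by simp
  qed
  have "norm (?d s - ?d s') < e"
    if s: "0 < norm s" "norm s < \<delta>" and s': "0 < norm s'" "norm s' < \<delta>" for s s'
  proof -
    have in_E: "?d s - v \<in> E x" if "0 < norm s" "norm s < \<delta>" for s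
    proof -
      have "Q (t + s) - Q t - s *s v \<in> E x" using offset[OF _ t, of "t + s"] quotient[OF that] by simp
      then have "inverse s *s (Q (t + s) - Q t - s *s v) \<in> E x"
        by (rule vec.subspace_scale[OF complex_subspace_E[OF x]])
      moreover have "inverse s *s (Q (t + s) - Q t - s *s v) = ?d s - v"
        using that(1) by (simp add: vec_eq_iff field_simps)
      ultimately show ?thesis by simp
    qed
    have cancel: "(u - v) - (u' - v) = u - u'" for u u' :: "complex ^ 'n" by simp
    from expand[OF t subspace_diff[OF subspace_E[OF x] in_E[OF s] in_E[OF s'], unfolded cancel], of k]
    have "a ^ k * norm (?d s - ?d s') \<le> K * norm (?A (?d s) - ?A (?d s'))"
      by (simp only: linear_diff[OF linear_G])
    also have "\<dots> \<le> K * (4 * b ^ k * B)"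
      using quotient[OF s] quotient[OF s'] norm_triangle_ineq4[of "?A (?d s)" "?A (?d s')"] rates(3)
      by (intro mult_left_mono) auto
    also have "\<dots> = 4 * B * K * (1/2) ^ k * (2 * b) ^ k" by (simp add: power_mult_distrib power_divide)
    also have "\<dots> \<le> 4 * B * K * (1/2) ^ k * a ^ k"
      using rates B by (intro mult_left_mono power_mono) auto
    finally have "a ^ k * norm (?d s - ?d s') \<le> a ^ k * (4 * B * K * (1/2) ^ k)" by (simp add: mult.commute)
    moreover have "a ^ k > 0" using rates by simp
    ultimately have "norm (?d s - ?d s') \<le> 4 * B * K * (1/2) ^ k" by (rule mult_left_le_imp_le)
    with k show ?thesis by linarith
  qed
  then show "\<exists>\<delta>>0. \<forall>s s'. 0 < norm s \<and> norm s < \<delta> \<and> 0 < norm s' \<and> norm s' < \<delta> \<longrightarrow> norm (?d s - ?d s') < e"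
    using \<open>\<delta> > 0\<close> by blast
qed (rule that)

text \<open>
  Over a disc in a complex line of \<open>F x\<close>, the leaf is a holomorphic disc on which the inverse iterates
  stay close to those of \<open>x\<close> and converge to them. Therefore \<open>Df\<^sup>-\<^sup>m w \<rightarrow> 0\<close> for its tangent vector \<open>w\<close> at \<open>x\<close>,
  and the \<open>F\<close>-component \<open>v\<close> of \<open>w\<close> inherits this, as the splitting is invariant with angles bounded below.
\<close>

theorem dynamically_defined_imp_unstable:
  assumes dyn: "dynamically_defined f \<Lambda> J \<phi>"
  shows "unstable_direction f \<Lambda> F"
proof (rule unstable_if_backward_images_vanish)
  fix x v0 assume x: "x \<in> \<Lambda>" and v0: "v0 \<in> F x"
  obtain N where N: "8 * (C / \<mu> ^ N) \<le> 1 / (C * \<nu> ^ N)" by (rule domination_at_some_time)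
  define a where "a = 1 / (C * \<nu> ^ N)"
  define b where "b = C / \<mu> ^ N"
  have ab: "0 < b" "8 * b \<le> a" using N rates mu_pos by (auto simp: a_def b_def)
  have dom: "8 * (C / \<mu> ^ N) \<le> a" using ab(2) by (simp add: b_def)
  obtain \<eta> K where K: "\<eta> > 0" "K > 0"
    "\<And>x y e k. x \<in> \<Lambda> \<Longrightarrow> e \<in> E x \<Longrightarrow> \<forall>m. dist ((inv f ^^ m) y) ((inv f ^^ m) x) < \<eta> \<Longrightarrow>
       (a / 2) ^ k * norm e \<le> K * norm (G (N * k) y e)"
    by (rule E_expands_near_backward_orbit[OF a_def dom]) (rule that; assumption)
  obtain r where r: "0 < r" "r \<le> 1"
    "\<And>x y y'. x \<in> \<Lambda> \<Longrightarrow> y \<in> leaf r x \<Longrightarrow> y' \<in> leaf r x \<Longrightarrow>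
       norm ((inv f ^^ N) y - (inv f ^^ N) y') \<le> 2 * b * norm (y - y')"
    by (rule inverse_iterate_contracts_leaf[OF ab(1) F_backward[where m = N, folded b_def]]) (assumption | rule that)+
  obtain \<epsilon> where \<epsilon>: "0 < \<epsilon>" "\<epsilon> \<le> 1"
    "\<And>x y m. x \<in> \<Lambda> \<Longrightarrow> y \<in> leaf \<epsilon> x \<Longrightarrow>
       (inv f ^^ m) y \<in> leaf r ((inv f ^^ m) x) \<and> dist ((inv f ^^ m) y) ((inv f ^^ m) x) < \<eta>"
    "\<And>x y. x \<in> \<Lambda> \<Longrightarrow> y \<in> leaf \<epsilon> x \<Longrightarrow> (\<lambda>m. (inv f ^^ m) y - (inv f ^^ m) x) \<longlonglongrightarrow> 0"
    by (rule dynamically_defined_leaves_stay[OF dyn r(1) K(1)]) (rule that; assumption)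
  obtain \<rho> where \<rho>: "\<rho> > 0" "\<And>x. x \<in> \<Lambda> \<Longrightarrow> \<exists>q. q 0 = x \<and>
      (\<forall>v\<in>F x. norm v < \<rho> \<longrightarrow> q v \<in> leaf \<epsilon> x \<and> q v - x - v \<in> E x) \<and>
      (\<forall>v\<in>F x. \<forall>v'\<in>F x. norm v < \<rho> \<longrightarrow> norm v' < \<rho> \<longrightarrow> norm (q v - q v') \<le> 3 * norm (v - v'))"
    by (rule leaf_is_graph_over_F[OF \<epsilon>(1)]) (rule that; assumption)
  obtain q where "q 0 = x \<and>
      (\<forall>v\<in>F x. norm v < \<rho> \<longrightarrow> q v \<in> leaf \<epsilon> x \<and> q v - x - v \<in> E x) \<and>
      (\<forall>v\<in>F x. \<forall>v'\<in>F x. norm v < \<rho> \<longrightarrow> norm v' < \<rho> \<longrightarrow> norm (q v - q v') \<le> 3 * norm (v - v'))"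
    using \<rho>(2)[OF x] by (elim exE)
  then have q: "q 0 = x"
    "\<And>v. v \<in> F x \<Longrightarrow> norm v < \<rho> \<Longrightarrow> q v \<in> leaf \<epsilon> x"
    "\<And>v. v \<in> F x \<Longrightarrow> norm v < \<rho> \<Longrightarrow> q v - x - v \<in> E x"
    "\<And>v v'. v \<in> F x \<Longrightarrow> v' \<in> F x \<Longrightarrow> norm v < \<rho> \<Longrightarrow> norm v' < \<rho> \<Longrightarrow> norm (q v - q v') \<le> 3 * norm (v - v')"
    by simp_all
  \<comment> \<open>Scaled so that the whole unit disc times \<open>v\<close> lies under the graph.\<close>
  define c where "c = \<rho> / (2 * (norm v0 + 1))"
  have c: "c > 0" using \<rho>(1) by (simp add: c_def add_nonneg_pos)
  define v where "v = c *\<^sub>R v0"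
  have v: "v \<in> F x" "norm v < \<rho>"
  proof -
    show "v \<in> F x" using v0 by (simp add: v_def subspace_scale subspace_F[OF x])
    have "norm v = \<rho> * (norm v0 / (2 * (norm v0 + 1)))" using c \<rho>(1) by (simp add: v_def c_def)
    also have "\<dots> < \<rho> * 1"
    proof (rule mult_strict_left_mono[OF _ \<rho>(1)])
      have pos: "0 < 2 * (norm v0 + 1)" by (simp add: add_nonneg_pos)
      have "norm v0 < 2 * (norm v0 + 1)" by (simp add: add_nonneg_pos)
      then show "norm v0 / (2 * (norm v0 + 1)) < 1" using divide_less_eq_1_pos[OF pos] by blast
    qed
    finally show "norm v < \<rho>" by simp
  qed
  define Q where "Q t = q (t *s v)" for t :: complex
  have tv: "t *s v \<in> F x" "norm (t *s v) < \<rho>" if "norm t < 1" for t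
  proof -
    show "t *s v \<in> F x" using v(1) complex_subspace_F[OF x] by (simp add: vec.subspace_scale)
    have "norm t * norm v \<le> norm v" using that by (intro mult_left_le_one_le) auto
    then show "norm (t *s v) < \<rho>" using v(2) by (simp add: norm_vector_smult)
  qed
  have Q_leaf: "Q t \<in> leaf \<epsilon> x" if "norm t < 1" for t
    unfolding Q_def by (rule q(2)[OF tv[OF that]])
  have Q_offset: "Q t - Q t' - (t - t') *s v \<in> E x" if "norm t < 1" "norm t' < 1" for t t'
  proof -
    have eq: "Q t - Q t' - (t - t') *s v = (Q t - x - t *s v) - (Q t' - x - t' *s v)"
      by (simp add: vec_eq_iff algebra_simps)
    show ?thesis
      unfolding eq unfolding Q_def
      by (rule subspace_diff[OF subspace_E[OF x] q(3)[OF tv[OF that(1)]] q(3)[OF tv[OF that(2)]]])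
  qed
  have Q_lip: "norm (Q t - Q t') \<le> (3 * norm v + 1) * norm (t - t')" if "norm t < 1" "norm t' < 1" for t t'
  proof -
    have "norm (Q t - Q t') \<le> 3 * norm ((t - t') *s v)"
      using q(4)[OF tv(1)[OF that(1)] tv(1)[OF that(2)] tv(2)[OF that(1)] tv(2)[OF that(2)]]
      by (simp add: Q_def vec.scale_left_diff_distrib)
    also have "\<dots> = 3 * norm v * norm (t - t')" by (simp only: norm_vector_smult) simp
    finally show ?thesis by (simp only: distrib_right) (simp add: add_increasing2)
  qed
  have Q_contract: "norm ((inv f ^^ (N * k)) (Q t) - (inv f ^^ (N * k)) (Q t')) \<le> (2 * b) ^ k * norm (Q t - Q t')"
    if "norm t < 1" "norm t' < 1" for t t' k
    using \<epsilon>(3)[OF x Q_leaf] that ab(1) by (intro inverse_iterates_contract_leaf[OF _ r(3) x]) auto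
  have Q_expand: "(a / 2) ^ k * norm e \<le> K * norm (G (N * k) (Q t) e)" if "norm t < 1" "e \<in> E x" for t e k
  proof -
    have "\<forall>m. dist ((inv f ^^ m) (Q t)) ((inv f ^^ m) x) < \<eta>" using \<epsilon>(3)[OF x Q_leaf[OF that(1)]] by blast
    then show ?thesis by (rule K(3)[OF x that(2)])
  qed
  have holomorphic: thesis
    if t: "norm t < 1" and thesis_rule: "\<And>w. (Q has_derivative (\<lambda>s. s *s w)) (at t) \<Longrightarrow>
        ((\<lambda>s. inverse s *s (Q (t + s) - Q t)) \<longlongrightarrow> w) (at 0) \<Longrightarrow> thesis" for t thesis
    by (rule backward_contracted_disc_is_holomorphic[OF x t Q_offset Q_lip _ Q_contract Q_expand _ _ K(2)])
      (use ab thesis_rule in \<open>auto intro: add_nonneg_pos\<close>)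
  obtain w where w: "(Q has_derivative (\<lambda>s. s *s w)) (at 0)" "((\<lambda>s. inverse s *s (Q s - Q 0)) \<longlongrightarrow> w) (at 0)"
    using holomorphic[of 0] by auto
  \<comment> \<open>The \<open>E\<close>-component of \<open>w\<close> need not be identified: invariance of the splitting separates the two.\<close>
  have wv: "w - v \<in> E x"
  proof (rule Lim_in_closed_set)
    show "closed (E x)" by (rule closed_subspace[OF subspace_E[OF x]])
    show "((\<lambda>s. inverse s *s (Q s - Q 0) - v) \<longlongrightarrow> w - v) (at 0)" by (intro tendsto_intros w)
    have "\<forall>\<^sub>F s in at (0::complex). norm s < 1 \<and> s \<noteq> 0" by (auto simp: eventually_at intro!: exI[of _ 1])
    then show "\<forall>\<^sub>F s in at 0. inverse s *s (Q s - Q 0) - v \<in> E x"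
    proof eventually_elim
      case (elim s)
      then have "inverse s *s (Q s - Q 0) - v = inverse s *s (Q s - Q 0 - (s - 0) *s v)"
        by (simp add: vec_eq_iff field_simps)
      moreover have "inverse s *s (Q s - Q 0 - (s - 0) *s v) \<in> E x"
        using Q_offset[of s 0] elim by (intro vec.subspace_scale[OF complex_subspace_E[OF x]]) simp
      ultimately show ?case by metis
    qed
  qed simp
  have Gw: "(\<lambda>m. G m x w) \<longlonglongrightarrow> 0"
  proof (rule vec_tendstoI)
    fix i
    let ?p = "\<lambda>m t. ((inv f ^^ m) (Q t) - (inv f ^^ m) x) $ i"
    have deriv: "(?p m has_field_derivative (G m (Q t) w) $ i) (at t)" if "(Q has_derivative (\<lambda>s. s *s w)) (at t)" for m t w
    proof (rule has_field_derivative_component)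
      have "((\<lambda>t. (inv f ^^ m) (Q t)) has_derivative (\<lambda>s. G m (Q t) (s *s w))) (at t)"
        by (rule has_derivative_compose[OF that holomorphic_map_has_derivative[OF holomorphic_inverse_iterate]])
      then show "((\<lambda>t. (inv f ^^ m) (Q t) - (inv f ^^ m) x) has_derivative (\<lambda>s. s *s G m (Q t) w)) (at t)"
        using has_derivative_diff[OF _ has_derivative_const]
        by (fastforce simp: holomorphic_map_derivative_smult[OF holomorphic_inverse_iterate])
    qed
    have "(\<lambda>m. deriv (?p m) 0) \<longlonglongrightarrow> 0"
    proof (rule deriv_tendsto_0_of_bounded_pointwise)
      show "?p m holomorphic_on ball 0 1" for m
        unfolding holomorphic_on_def
      proof
        fix t :: complex assume "t \<in> ball 0 1"
        then have "norm t < 1" by simp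
        then show "?p m field_differentiable at t within ball 0 1"
        proof (rule holomorphic)
          fix w assume "(Q has_derivative (\<lambda>s. s *s w)) (at t)"
          from deriv[OF this] show ?thesis
            using field_differentiable_at_within field_differentiable_def by blast
        qed
      qed
      show "norm (?p m t) \<le> \<eta>" if "t \<in> ball 0 1" for m t
        using \<epsilon>(3)[OF x Q_leaf, of t m] that Finite_Cartesian_Product.norm_nth_le[of "(inv f ^^ m) (Q t) - (inv f ^^ m) x" i]
        by (simp add: dist_norm)
      show "(\<lambda>m. ?p m t) \<longlonglongrightarrow> 0" if "t \<in> ball 0 1" for t
        using tendsto_vec_nth[OF \<epsilon>(4)[OF x Q_leaf, of t], of i] that by simp
    qed
    moreover have "deriv (?p m) 0 = (G m x w) $ i" for m
      using DERIV_imp_deriv[OF deriv[OF w(1), of m]] q(1) by (simp add: Q_def)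
    ultimately show "(\<lambda>m. (G m x w) $ i) \<longlonglongrightarrow> 0 $ i" by simp
  qed
  obtain L where L: "\<forall>x\<in>\<Lambda>. \<forall>e\<in>E x. \<forall>u\<in>F x. norm e \<le> L * norm (e + u) \<and> norm u \<le> L * norm (e + u)"
    by (rule splitting_angle) (rule that; assumption)
  have bound: "norm (G m x v) \<le> norm (G m x w) * L" for m
  proof -
    have "G m x w = G m x (w - v) + G m x v" using linear_add[OF linear_G, of m x "w - v" v] by simp
    then show ?thesis
      using L[rule_format, OF inverse_iterate_in_set[OF x] derivative_preserves_splitting(3)[OF x wv]
          derivative_preserves_splitting(4)[OF x v(1)], of m] by (simp add: mult.commute)
  qed
  have "(\<lambda>m. G m x v) \<longlonglongrightarrow> 0"
  proof (rule Lim_null_comparison)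
    show "\<forall>\<^sub>F m in sequentially. norm (G m x v) \<le> norm (G m x w) * L"
      using bound by (rule always_eventually[OF allI])
    show "(\<lambda>m. norm (G m x w) * L) \<longlonglongrightarrow> 0"
      by (intro tendsto_mult_left_zero tendsto_norm_zero Gw)
  qed
  then have "(\<lambda>m. inverse c *\<^sub>R G m x v) \<longlonglongrightarrow> inverse c *\<^sub>R 0" by (intro tendsto_intros)
  moreover have "inverse c *\<^sub>R G m x v = G m x v0" for m
    using c by (simp add: v_def linear_cmul[OF linear_G])
  ultimately show "(\<lambda>m. G m x v0) \<longlonglongrightarrow> 0" by simp
qed

end

theorem theoremA:
  fixes f :: "complex ^ 'n \<Rightarrow> complex ^ 'n"
    and \<Lambda> :: "(complex ^ 'n) set"
    and E F :: "complex ^ 'n \<Rightarrow> (complex ^ 'n) set"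
    and J :: "'n set"
    and \<phi> :: "complex ^ 'n \<Rightarrow> complex ^ 'n \<Rightarrow> complex ^ 'n"
  assumes "CARD('n) \<ge> 2"
    and "biholomorphism f"
    and "compact \<Lambda>"
    and "f ` \<Lambda> = \<Lambda>"
    and "partially_hyperbolic f \<Lambda> E F"
    and "cu_leaf_family f \<Lambda> F J \<phi>"
  shows "(uniformly_hyperbolic f \<Lambda> E F \<longleftrightarrow> cu_forward_expansive f \<Lambda> J \<phi>) \<and>
         (cu_forward_expansive f \<Lambda> J \<phi> \<longleftrightarrow> dynamically_defined f \<Lambda> J \<phi>)"
proof -
  obtain \<nu> \<mu> C where rates: "0 < \<nu>" "\<nu> < \<mu>" "\<nu> < 1" "C > 0"
    "\<forall>m. \<forall>x\<in>\<Lambda>. opnorm_on (frechet_derivative (f ^^ m) (at x)) (E x) \<le> C * \<nu> ^ m \<and>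
           opnorm_on (frechet_derivative (inv f ^^ m) (at x)) (F x) \<le> C / \<mu> ^ m"
    and splitting: "invariant_splitting f \<Lambda> E F"
    using assms(5) unfolding partially_hyperbolic_def by (elim exE conjE)
  from assms(6) have leaves: "\<forall>x\<in>\<Lambda>. C1_embedding J (\<phi> x) \<and> \<phi> x 0 = x" "C1_continuous_on \<Lambda> J \<phi>"
    "\<forall>x\<in>\<Lambda>. disc_derivative J (\<phi> x) 0 ` coord_space J = F x"
    "\<forall>\<epsilon>\<^sub>1. 0 < \<epsilon>\<^sub>1 \<and> \<epsilon>\<^sub>1 < 1 \<longrightarrow> (\<exists>\<epsilon>\<^sub>2. 0 < \<epsilon>\<^sub>2 \<and> \<epsilon>\<^sub>2 \<le> 1 \<and>
           (\<forall>x\<in>\<Lambda>. inv f ` cu_leaf J \<phi> \<epsilon>\<^sub>2 x \<subseteq> cu_leaf J \<phi> \<epsilon>\<^sub>1 (inv f x)))"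
    unfolding cu_leaf_family_def by simp_all
  interpret partially_hyperbolic_leaves f \<Lambda> E F \<nu> \<mu> C J \<phi>
    by unfold_locales (use assms(2-4) rates splitting leaves in blast)+
  show ?thesis
    using unstable_imp_forward_expansive forward_expansive_imp_dynamically_defined
      dynamically_defined_imp_unstable assms(5) unfolding uniformly_hyperbolic_def by blast
qed

end
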